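(* Let $\lambda\in\mathcal{P}^k$ and $1\le r\le k$, put $\widetilde{h}_r=h_0+h_1+\dots+h_r$ (with $h_0=1$), and let $d_{A_1}\lambda,d_{A_2}\lambda,\dots$ be the list of all weak strips of size $r$ over $\lambda$ (with distinct $A_a\subsetneq I$). Then for every choice of indices $a_1<\dots<a_m$, $d_{A_{a_1}\cap\dots\cap A_{a_m}}\lambda$ is defined and equals the meet $(d_{A_{a_1}}\lambda)\wedge\dots\wedge(d_{A_{a_m}}\lambda)$ in $(\mathcal{P}^k,\le)$, and \[ \widetilde{g}^{(k)}_{\lambda}\,\widetilde{h}_r=\sum_{m\ge1}(-1)^{m-1}\sum_{a_1<\dots<a_m}\widetilde{g}^{(k)}_{d_{A_{a_1}\cap\dots\cap A_{a_m}}\lambda}. \]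
   Context: Fix a positive integer $k$. Let $I=\mathbb{Z}/(k+1)\mathbb{Z}=\{0,1,\dots,k\}$ and let $W=\tilde S_{k+1}$ be the affine symmetric group with Coxeter generators $s_i$ ($i\in I$), relations $s_i^2=1$, $s_is_{i+1}s_i=s_{i+1}s_is_{i+1}$, and $s_is_j=s_js_i$ when $i-j\not\equiv 0,\pm1 \pmod{k+1}$. Let $l$ be the length function, $\le$ the strong (Bruhat) order, and $\le_L$ the left weak order: $u\le_L v$ iff $l(vu^{-1})+l(u)=l(v)$. Let $W^\circ\subset W$ be the set of affine Grassmannian elements, i.e. $w$ with $ws_i>w$ for all $i\in\{1,\dots,k\}$. For $A\subsetneq I$, $d_A=s_{i_1}\cdots s_{i_m}$ where $A=\{i_1,\dots,i_m\}$ and the word $i_1\cdots i_m$ is cyclically decreasing (distinct letters, and no $j$ occurs to the left of $j+1$, indices mod $k+1$); this is independent of the choice of word. $\mathcal{P}^k$ is the set of partitions $\lambda$ with $\lambda_1\le k$. The residue of the cell in row $i$, column $j$ is $j-i \bmod (k+1)$. For $\lambda\in\mathcal{P}^k$, $w_\lambda=s_{i_1}\cdots s_{i_l}$ where $(i_1,\dots,i_l)$ are the residues of the cells of $\lambda$ read from the shortest row to the longest, each row from right to left; $\lambda\mapsto w_\lambda$ is a bijection $\mathcal{P}^k\to W^\circ$, and $\mathcal P^k$ carries the strong order $\mu\le\lambda\iff w_\mu\le w_\lambda$; $\wedge$ denotes meet in this poset. For $A\subsetneq I$ with $d_Aw_\lambda\in W^\circ$, $d_A\lambda$ denotes the partition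 $\mu$ with $w_\mu=d_Aw_\lambda$. We say $d_A\lambda$ is a weak strip of size $r$ over $\lambda$ if $d_Aw_\lambda\in W^\circ$, $d_Aw_\lambda\ge_L w_\lambda$ and $|A|=r$. Demazure action: for $s=s_i$, $\phi_s(x)=sx$ if $sx>x$ and $\phi_s(x)=x$ otherwise; for $x=t_1\cdots t_n$ reduced, $x*y=\phi_{t_1}\cdots\phi_{t_n}(y)$. Let $h_r$ be the complete homogeneous symmetric functions and $\Lambda^{(k)}=\mathbb{Z}[h_1,\dots,h_k]$. The $K$-$k$-Schur functions $\{g^{(k)}_w\}_{w\in W^\circ}$ are the family (a basis of $\Lambda^{(k)}$) determined by $g^{(k)}_e=1$ and, for $w\in W^\circ$ and $1\le r\le k$, $h_r\,g^{(k)}_w=\sum (-1)^{r+l(w)-l(d_A*w)} g^{(k)}_{d_A*w}$, summed over $A\subsetneq I$ with $|A|=r$ and $d_A*w\in W^\circ$. Write $g^{(k)}_\lambda=g^{(k)}_{w_\lambda}$ and $\widetilde{g}^{(k)}_{\lambda}=\sum_{\mu\in\mathcal{P}^k,\ \mu\le\lambda} g^{(k)}_{\mu}$. *)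

theory Defs
  imports "HOL-Algebra.Group" "HOL-Algebra.Lattice" "HOL-Library.Multiset"
begin

section \<open>The affine symmetric group\<close>

text \<open>
  The index set \<open>\<int>/(k+1)\<close> is represented by \<open>{..k}\<close>.  The group is given by its Coxeter
  presentation: elements are classes of words in the generators.  Since the generators are
  involutions, words without inverse letters suffice.  For \<open>k = 1\<close> there is no braid relation
  (infinite dihedral group), as usual for the affine symmetric group of rank two.
\<close>

inductive cox_eq :: "nat \<Rightarrow> nat list \<Rightarrow> nat list \<Rightarrow> bool" for k :: nat where
  refl: "cox_eq k u u"
| sym: "cox_eq k u v \<Longrightarrow> cox_eq k v u"
| trans: "cox_eq k u v \<Longrightarrow> cox_eq k v w \<Longrightarrow> cox_eq k u w"
| square: "i \<le> k \<Longrightarrow> cox_eq k (u @ [i, i] @ v) (u @ v)"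
| braid: "k \<ge> 2 \<Longrightarrow> i \<le> k \<Longrightarrow> j = (i + 1) mod (k + 1) \<Longrightarrow>
    cox_eq k (u @ [i, j, i] @ v) (u @ [j, i, j] @ v)"
| comm: "i \<le> k \<Longrightarrow> j \<le> k \<Longrightarrow> i \<noteq> j \<Longrightarrow> j \<noteq> (i + 1) mod (k + 1) \<Longrightarrow> i \<noteq> (j + 1) mod (k + 1) \<Longrightarrow>
    cox_eq k (u @ [i, j] @ v) (u @ [j, i] @ v)"

definition wcls :: "nat \<Rightarrow> nat list \<Rightarrow> nat list set" where
  "wcls k u = {v. cox_eq k u v}"

definition affS :: "nat \<Rightarrow> nat list set monoid" where
  "affS k = \<lparr>carrier = wcls k ` lists {..k},
             monoid.mult = (\<lambda>X Y. \<Union>u\<in>X. \<Union>v\<in>Y. wcls k (u @ v)),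
             one = wcls k []\<rparr>"

definition gen :: "nat \<Rightarrow> nat \<Rightarrow> nat list set" where
  "gen k i = wcls k [i]"

lemma cox_eq_append_left: "cox_eq k u v \<Longrightarrow> cox_eq k (w @ u) (w @ v)"
proof (induction rule: cox_eq.induct)
  case (square i u v)
  then show ?case using cox_eq.square[of i k "w @ u" v] by simp
next
  case (braid i j u v)
  then show ?case using cox_eq.braid[of k i j "w @ u" v] by simp
next
  case (comm i j u v)
  then show ?case using cox_eq.comm[of i k j "w @ u" v] by simp
qed (rule cox_eq.refl, erule cox_eq.sym, erule (1) cox_eq.trans)

lemma cox_eq_append_right: "cox_eq k u v \<Longrightarrow> cox_eq k (u @ w) (v @ w)"
proof (induction rule: cox_eq.induct)
  case (square i u v)
  then show ?case using cox_eq.square[of i k u "v @ w"] by simp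
next
  case (braid i j u v)
  then show ?case using cox_eq.braid[of k i j u "v @ w"] by simp
next
  case (comm i j u v)
  then show ?case using cox_eq.comm[of i k j u "v @ w"] by simp
qed (rule cox_eq.refl, erule cox_eq.sym, erule (1) cox_eq.trans)

lemma wcls_eq_iff: "wcls k u = wcls k v \<longleftrightarrow> cox_eq k u v"
proof
  assume "wcls k u = wcls k v"
  then have "v \<in> wcls k u" by (simp add: wcls_def cox_eq.refl)
  then show "cox_eq k u v" by (simp add: wcls_def)
next
  assume "cox_eq k u v"
  then have "cox_eq k u w \<longleftrightarrow> cox_eq k v w" for w
    using cox_eq.sym cox_eq.trans by blast
  then show "wcls k u = wcls k v" by (simp add: wcls_def)
qed

lemma mult_affS: "wcls k u \<otimes>\<^bsub>affS k\<^esub> wcls k v = wcls k (u @ v)"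
proof -
  have eq: "wcls k (u' @ v') = wcls k (u @ v)" if u': "u' \<in> wcls k u" and v': "v' \<in> wcls k v" for u' v'
  proof -
    have "cox_eq k (u @ v) (u' @ v)"
      using u' by (simp add: wcls_def cox_eq_append_right)
    moreover have "cox_eq k (u' @ v) (u' @ v')"
      using v' by (simp add: wcls_def cox_eq_append_left)
    ultimately have "cox_eq k (u @ v) (u' @ v')" by (rule cox_eq.trans)
    then show ?thesis by (simp add: wcls_eq_iff cox_eq.sym)
  qed
  have "u \<in> wcls k u" "v \<in> wcls k v"
    by (simp_all add: wcls_def cox_eq.refl)
  then have "(\<Union>u'\<in>wcls k u. \<Union>v'\<in>wcls k v. wcls k (u' @ v')) = wcls k (u @ v)"
    using eq by blast
  then show ?thesis by (simp add: affS_def)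
qed

lemma one_affS: "\<one>\<^bsub>affS k\<^esub> = wcls k []"
  by (simp add: affS_def)

lemma cox_eq_rev: "set u \<subseteq> {..k} \<Longrightarrow> cox_eq k (rev u @ u) []"
proof (induction u)
  case (Cons a u)
  then have "cox_eq k (rev u @ [a, a] @ u) (rev u @ u)" by (intro cox_eq.square) auto
  moreover have "cox_eq k (rev u @ u) []" using Cons by simp
  ultimately show ?case by (simp add: cox_eq.trans)
qed (simp add: cox_eq.refl)

lemma group_affS: "group (affS k)"
proof (rule groupI)
  fix x assume "x \<in> carrier (affS k)"
  then obtain u where u: "u \<in> lists {..k}" "x = wcls k u" by (auto simp: affS_def)
  have "wcls k (rev u) \<otimes>\<^bsub>affS k\<^esub> x = \<one>\<^bsub>affS k\<^esub>"
    using u cox_eq_rev[of u k] by (auto simp: mult_affS one_affS wcls_eq_iff lists_eq_set)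
  moreover have "wcls k (rev u) \<in> carrier (affS k)"
    using u by (auto simp: affS_def)
  ultimately show "\<exists>y\<in>carrier (affS k). y \<otimes>\<^bsub>affS k\<^esub> x = \<one>\<^bsub>affS k\<^esub>" by blast
next
  fix x y assume "x \<in> carrier (affS k)" "y \<in> carrier (affS k)"
  then obtain u v where "u \<in> lists {..k}" "x = wcls k u" "v \<in> lists {..k}" "y = wcls k v"
    by (auto simp: affS_def)
  then show "x \<otimes>\<^bsub>affS k\<^esub> y \<in> carrier (affS k)"
    by (simp add: mult_affS) (auto simp: affS_def)
next
  fix x y z assume "x \<in> carrier (affS k)" "y \<in> carrier (affS k)" "z \<in> carrier (affS k)"
  then obtain u v w where "x = wcls k u" "y = wcls k v" "z = wcls k w"
    by (auto simp: affS_def)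
  then show "x \<otimes>\<^bsub>affS k\<^esub> y \<otimes>\<^bsub>affS k\<^esub> z = x \<otimes>\<^bsub>affS k\<^esub> (y \<otimes>\<^bsub>affS k\<^esub> z)"
    by (simp add: mult_affS)
next
  show "\<one>\<^bsub>affS k\<^esub> \<in> carrier (affS k)" by (auto simp: affS_def)
next
  fix x assume "x \<in> carrier (affS k)"
  then obtain u where "x = wcls k u" by (auto simp: affS_def)
  then show "\<one>\<^bsub>affS k\<^esub> \<otimes>\<^bsub>affS k\<^esub> x = x" by (simp add: mult_affS one_affS)
qed

definition len :: "nat \<Rightarrow> nat list set \<Rightarrow> nat" where
  "len k x = (LEAST n. \<exists>u\<in>lists {..k}. x = wcls k u \<and> n = length u)"

definition reduced_word :: "nat \<Rightarrow> nat list \<Rightarrow> nat list set \<Rightarrow> bool" where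
  "reduced_word k u x \<longleftrightarrow> u \<in> lists {..k} \<and> x = wcls k u \<and> length u = len k x"

definition reflections :: "nat \<Rightarrow> nat list set set" where
  "reflections k =
     {x \<otimes>\<^bsub>affS k\<^esub> gen k i \<otimes>\<^bsub>affS k\<^esub> inv\<^bsub>affS k\<^esub> x | x i. x \<in> carrier (affS k) \<and> i \<le> k}"

definition strong_le :: "nat \<Rightarrow> nat list set \<Rightarrow> nat list set \<Rightarrow> bool" where
  "strong_le k = (\<lambda>x y. x \<in> carrier (affS k) \<and>
     (\<exists>t\<in>reflections k. y = t \<otimes>\<^bsub>affS k\<^esub> x) \<and> len k x < len k y)\<^sup>*\<^sup>*"

definition strong_less :: "nat \<Rightarrow> nat list set \<Rightarrow> nat list set \<Rightarrow> bool" where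
  "strong_less k x y \<longleftrightarrow> strong_le k x y \<and> x \<noteq> y"

definition lweak_le :: "nat \<Rightarrow> nat list set \<Rightarrow> nat list set \<Rightarrow> bool" where
  "lweak_le k u v \<longleftrightarrow> len k (v \<otimes>\<^bsub>affS k\<^esub> inv\<^bsub>affS k\<^esub> u) + len k u = len k v"

definition Wgr :: "nat \<Rightarrow> nat list set set" where
  "Wgr k = {w \<in> carrier (affS k). \<forall>i\<in>{1..k}. strong_less k w (w \<otimes>\<^bsub>affS k\<^esub> gen k i)}"

definition cyc_decreasing :: "nat \<Rightarrow> nat list \<Rightarrow> bool" where
  "cyc_decreasing k u \<longleftrightarrow> distinct u \<and>
     (\<forall>q<length u. \<forall>p<q. u ! q \<noteq> (u ! p + 1) mod (k + 1))"

text \<open>For proper subsets \<open>A\<close> of \<open>{..k}\<close> the class does not depend on the word chosen.\<close>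

definition dA :: "nat \<Rightarrow> nat set \<Rightarrow> nat list set" where
  "dA k A = wcls k (SOME u. set u = A \<and> cyc_decreasing k u)"

definition demazure_gen :: "nat \<Rightarrow> nat \<Rightarrow> nat list set \<Rightarrow> nat list set" where
  "demazure_gen k i x =
     (if strong_less k x (gen k i \<otimes>\<^bsub>affS k\<^esub> x) then gen k i \<otimes>\<^bsub>affS k\<^esub> x else x)"

text \<open>The result does not depend on the reduced word chosen for \<open>x\<close>.\<close>

definition demazure :: "nat \<Rightarrow> nat list set \<Rightarrow> nat list set \<Rightarrow> nat list set" where
  "demazure k x y = foldr (demazure_gen k) (SOME u. reduced_word k u x) y"


section \<open>Bounded partitions\<close>

definition Par :: "nat \<Rightarrow> nat list set" where
  "Par k = {la. sorted_wrt (\<ge>) la \<and> set la \<subseteq> {1..k}}"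

text \<open>Rows and columns are numbered from 1, so row \<open>i\<close> of \<open>la\<close> has \<open>la ! (i - 1)\<close> cells.\<close>

definition residue :: "nat \<Rightarrow> nat \<Rightarrow> nat \<Rightarrow> nat" where
  "residue k i j = nat ((int j - int i) mod (int k + 1))"

definition par_word :: "nat \<Rightarrow> nat list \<Rightarrow> nat list" where
  "par_word k la = concat (map (\<lambda>i. map (residue k i) (rev [1..<la ! (i - 1) + 1]))
                               (rev [1..<length la + 1]))"

definition par_elt :: "nat \<Rightarrow> nat list \<Rightarrow> nat list set" where
  "par_elt k la = wcls k (par_word k la)"

definition par_poset :: "nat \<Rightarrow> nat list gorder" where
  "par_poset k = \<lparr>carrier = Par k, eq = (=),
                  le = (\<lambda>mu la. strong_le k (par_elt k mu) (par_elt k la))\<rparr>"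

definition act_defined :: "nat \<Rightarrow> nat set \<Rightarrow> nat list \<Rightarrow> bool" where
  "act_defined k A la \<longleftrightarrow> A \<subset> {..k} \<and> dA k A \<otimes>\<^bsub>affS k\<^esub> par_elt k la \<in> Wgr k"

definition act :: "nat \<Rightarrow> nat set \<Rightarrow> nat list \<Rightarrow> nat list" where
  "act k A la = (THE mu. mu \<in> Par k \<and> par_elt k mu = dA k A \<otimes>\<^bsub>affS k\<^esub> par_elt k la)"

definition weak_strips :: "nat \<Rightarrow> nat list \<Rightarrow> nat \<Rightarrow> nat set set" where
  "weak_strips k la r = {A. act_defined k A la \<and> card A = r \<and>
     lweak_le k (par_elt k la) (dA k A \<otimes>\<^bsub>affS k\<^esub> par_elt k la)}"


section \<open>Symmetric functions\<close>

text \<open>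
  Integral formal power series in variables \<open>x\<^sub>0, x\<^sub>1, \<dots>\<close>.  A multiset \<open>M\<close> of indices
  stands for the monomial that is the product of the \<open>x\<^sub>i\<close> over \<open>i\<close> in \<open>M\<close>
  (with multiplicity).
\<close>

typedef pseries = "UNIV :: (nat multiset \<Rightarrow> int) set"
  morphisms mcoeff Abs_pseries ..

setup_lifting type_definition_pseries

lemma finite_submultisets: "finite {A. A \<subseteq># (M :: 'a multiset)}"
proof (rule finite_subset)
  show "{A. A \<subseteq># M} \<subseteq> (\<Union>n\<le>size M. multisets_of_size (set_mset M) n)"
    by (auto simp: multisets_of_size_def size_mset_mono dest: mset_subset_eqD)
qed auto

lemma submset_diff_diff: "B \<subseteq># A \<Longrightarrow> A \<subseteq># M \<Longrightarrow> M - A = M - B - (A - (B :: 'a multiset))"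
  by (simp add: subseteq_mset_def multiset_eq_iff)

lemma submset_double_diff: "A \<subseteq># M \<Longrightarrow> M - (M - A) = (A :: 'a multiset)"
  by (simp add: subseteq_mset_def multiset_eq_iff)

lemma submset_diff_mono:
  "B \<subseteq># A \<Longrightarrow> A \<subseteq># M \<Longrightarrow> A - B \<subseteq># M - (B :: 'a multiset)"
  "B \<subseteq># A \<Longrightarrow> A \<subseteq># M \<Longrightarrow> B \<subseteq># (M :: 'a multiset)"
  unfolding subseteq_mset_def by (auto intro: diff_le_mono le_trans)

lemma submset_add:
  assumes "A \<subseteq># M" "B \<subseteq># M - A"
  shows "A + B \<subseteq># (M :: 'a multiset)"
  unfolding subseteq_mset_def
proof
  fix a
  show "count (A + B) a \<le> count M a"
    using assms[unfolded subseteq_mset_def, THEN spec[of _ a]] by simp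
qed

instantiation pseries :: comm_ring_1
begin

lift_definition zero_pseries :: pseries is "\<lambda>_. 0" .
lift_definition one_pseries :: pseries is "\<lambda>M. if M = {#} then 1 else 0" .
lift_definition plus_pseries :: "pseries \<Rightarrow> pseries \<Rightarrow> pseries" is "\<lambda>f g M. f M + g M" .
lift_definition uminus_pseries :: "pseries \<Rightarrow> pseries" is "\<lambda>f M. - f M" .
lift_definition minus_pseries :: "pseries \<Rightarrow> pseries \<Rightarrow> pseries" is "\<lambda>f g M. f M - g M" .
lift_definition times_pseries :: "pseries \<Rightarrow> pseries \<Rightarrow> pseries"
  is "\<lambda>f g M. \<Sum>A | A \<subseteq># M. f A * g (M - A)" .

instance
proof
  fix a b c :: pseries
  show "a * b * c = a * (b * c)"
  proof (transfer, rule ext)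
    fix f g h :: "nat multiset \<Rightarrow> int" and M
    have "(\<Sum>A | A \<subseteq># M. (\<Sum>B | B \<subseteq># A. f B * g (A - B)) * h (M - A))
        = (\<Sum>(A, B) \<in> (SIGMA A:{A. A \<subseteq># M}. {B. B \<subseteq># A}). f B * g (A - B) * h (M - A))"
      by (simp add: sum_distrib_right sum.Sigma finite_submultisets)
    also have "\<dots> = (\<Sum>(A, B) \<in> (SIGMA A:{A. A \<subseteq># M}. {B. B \<subseteq># M - A}).
                       f A * g B * h (M - A - B))"
      by (rule sum.reindex_bij_witness[where i = "\<lambda>(A, B). (A + B, A)" and j = "\<lambda>(A, B). (B, A - B)"])
         (auto simp flip: submset_diff_diff simp: submset_diff_mono submset_add)
    also have "\<dots> = (\<Sum>A | A \<subseteq># M. f A * (\<Sum>B | B \<subseteq># M - A. g B * h (M - A - B)))"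
      by (simp add: sum_distrib_left sum.Sigma finite_submultisets mult.assoc)
    finally show "(\<Sum>A | A \<subseteq># M. (\<Sum>B | B \<subseteq># A. f B * g (A - B)) * h (M - A)) =
      (\<Sum>A | A \<subseteq># M. f A * (\<Sum>B | B \<subseteq># M - A. g B * h (M - A - B)))" .
  qed
  show "a * b = b * a"
  proof (transfer, rule ext)
    fix f g :: "nat multiset \<Rightarrow> int" and M
    show "(\<Sum>A | A \<subseteq># M. f A * g (M - A)) = (\<Sum>A | A \<subseteq># M. g A * f (M - A))"
      by (rule sum.reindex_bij_witness[where i = "\<lambda>A. M - A" and j = "\<lambda>A. M - A"])
         (auto simp: submset_double_diff mult.commute)
  qed
  show "1 * a = a"
  proof (transfer, rule ext)
    fix f :: "nat multiset \<Rightarrow> int" and M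
    have "(\<Sum>A | A \<subseteq># M. (if A = {#} then 1 else 0) * f (M - A))
        = (\<Sum>A | A \<subseteq># M. if A = {#} then f M else 0)"
      by (rule sum.cong) auto
    then show "(\<Sum>A | A \<subseteq># M. (if A = {#} then 1 else 0) * f (M - A)) = f M"
      by (simp add: finite_submultisets)
  qed
  show "(a + b) * c = a * c + b * c"
    by transfer (simp add: distrib_right sum.distrib)
  show "(0 :: pseries) \<noteq> 1"
  proof transfer
    show "(\<lambda>_ :: nat multiset. 0 :: int) \<noteq> (\<lambda>M. if M = {#} then 1 else 0)"
      by (metis zero_neq_one)
  qed
  show "a + b + c = a + (b + c)" by transfer (simp add: add.assoc)
  show "a + b = b + a" by transfer (simp add: add.commute)
  show "0 + a = a" by transfer simp
  show "- a + a = 0" by transfer simp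
  show "a - b = a + - b" by transfer simp
qed

end

lift_definition hsym :: "nat \<Rightarrow> pseries" is "\<lambda>r M. if size M = r then 1 else 0" .

lemma hsym_0: "hsym 0 = 1"
  by transfer (auto simp: fun_eq_iff)

definition htilde :: "nat \<Rightarrow> pseries" where
  "htilde r = (\<Sum>i=0..r. hsym i)"

inductive_set Lam :: "nat \<Rightarrow> pseries set" for k :: nat where
  one: "1 \<in> Lam k"
| hsym: "1 \<le> i \<Longrightarrow> i \<le> k \<Longrightarrow> hsym i \<in> Lam k"
| add: "f \<in> Lam k \<Longrightarrow> g \<in> Lam k \<Longrightarrow> f + g \<in> Lam k"
| uminus: "f \<in> Lam k \<Longrightarrow> - f \<in> Lam k"
| mult: "f \<in> Lam k \<Longrightarrow> g \<in> Lam k \<Longrightarrow> f * g \<in> Lam k"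

text \<open>
  The defining properties of the family of \<open>K\<close>-\<open>k\<close>-Schur functions, which determine its values
  on \<open>Wgr k\<close> uniquely; values outside \<open>Wgr k\<close> are irrelevant.
  The exponent of the sign is a nonnegative integer, because
  \<open>len k (demazure k (dA k A) w) \<le> card A + len k w\<close>; so truncated subtraction does no harm.
\<close>

definition is_KkSchur :: "nat \<Rightarrow> (nat list set \<Rightarrow> pseries) \<Rightarrow> bool" where
  "is_KkSchur k g \<longleftrightarrow>
     (\<forall>w\<in>Wgr k. g w \<in> Lam k) \<and>
     g \<one>\<^bsub>affS k\<^esub> = 1 \<and>
     (\<forall>w\<in>Wgr k. \<forall>r\<in>{1..k}.
        hsym r * g w =
        (\<Sum>A | A \<subset> {..k} \<and> card A = r \<and> demazure k (dA k A) w \<in> Wgr k.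
           (- 1) ^ (r + len k w - len k (demazure k (dA k A) w)) * g (demazure k (dA k A) w)))"

definition gtilde :: "nat \<Rightarrow> (nat list set \<Rightarrow> pseries) \<Rightarrow> nat list \<Rightarrow> pseries" where
  "gtilde k g la =
     (\<Sum>mu | mu \<in> Par k \<and> mu \<sqsubseteq>\<^bsub>par_poset k\<^esub> la. g (par_elt k mu))"

end

theory Submission
  imports Defs "HOL-Library.Sublist"
begin

text \<open>
  Write \<open>G w = (\<Sum>x \<le> w. g x)\<close>, with \<open>g x = 0\<close> outside the affine Grassmannian elements.  The
  Pieri rule says that \<open>h\<^sub>r\<close> acts as the sum over \<open>|A| = r\<close> of the products along \<open>d\<^sub>A\<close> of operators
  \<open>\<tau>\<^sub>i = D\<^sub>i - 1\<close>, and the lifting property gives \<open>D\<^sub>i (G w) = G (s\<^sub>i * w)\<close>.  Expanding the products, the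
  coefficient of \<open>g x\<close> in \<open>(h\<^sub>0 + \<dots> + h\<^sub>r) G w\<close> is the sum of \<open>(-1)\<^bsup>|A - B|\<^esup>\<close> over all
  \<open>B \<subseteq> A\<close> with \<open>|A| \<le> r\<close> and \<open>x \<le> d\<^sub>B * w\<close>.  Moving \<open>w\<close> to the other side of the last inequality turns it
  into \<open>z \<le> d\<^sub>B\<close> for some \<open>z\<close> that does not depend on \<open>B\<close>, so by the subword property it means
  \<open>C \<subseteq> B\<close> for a fixed set \<open>C\<close> (or never holds).  Hence the coefficient is 1 if \<open>|C| \<le> r\<close> and 0
  otherwise, and intersecting index sets gives meets.

  It remains to see that weak strips over \<open>w\<close> are closed under intersection, can be enlarged up to
  size \<open>k\<close>, and that \<open>d\<^sub>C w\<close> is a weak strip when \<open>C\<close> is minimal.  To this end the coset of \<open>w\<close> is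
  encoded by a sequence \<open>\<alpha>\<close> of integers with \<open>\<alpha> (p + k + 1) = \<alpha> p - 1\<close>, on which \<open>s\<^sub>i\<close>
  interchanges the entries in positions \<open>i\<close> and \<open>i + 1\<close> modulo \<open>k + 1\<close>; the step is an ascent
  among Grassmannian elements iff \<open>\<alpha> (i + 1) < \<alpha> i\<close>.  A set \<open>A\<close> is a weak strip iff in each of its
  runs \<open>q, q + 1, \<dots>, t\<close> all of \<open>\<alpha> (q + 1), \<dots>, \<alpha> (t + 1)\<close> are smaller than \<open>\<alpha> q\<close>.
\<close>

section \<open>Alternating sums\<close>

text \<open>The element \<open>w\<close> can change sides because every Demazure operator has an
  adjoint: x \<le> s_i * y holds iff the smaller of x and s_i x is below y, and likewise on the
  right. Left and right operators commute, so a bound by \<open>d_B * w\<close> becomes a bound by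
  \<open>d_B\<close> after right operators have been applied to x alone.

  The sequence \<alpha> of the coset x W_0 is a step function, constant on windows of length k + 1,
  composed with the inverse of the affine permutation x; W_0 permutes the entries of each window and
  is not seen.

  The obstacle is that \<open>d_B * w\<close> need not be affine Grassmannian. But a letter leading
  out of the Grassmannian elements acts as right multiplication by a generator of W_0, and by
  adjunction this lets no new Grassmannian element in below. So x \<le> d_B * w already holds for a
  weak strip inside B, and the minimal C is itself one.

  Enlarging strips rests on quasi-periodicity: if no residue could be added, \<alpha> would increase
  weakly from one run start to the next all around the circle, although it drops by one after a full
  turn.\<close>

lemma sum_alternating_Pow:
  assumes "finite T"
  shows "(\<Sum>S\<in>Pow T. (- 1) ^ card S) = (if T = {} then 1 else 0 :: 'a :: comm_ring_1)"
  using assms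
proof (induction T)
  case (insert x T)
  have fin: "finite S" if "S \<in> Pow T" for S using that insert(1) finite_subset by auto
  have inj: "inj_on (insert x) (Pow T)" using insert(2) by (auto simp: inj_on_def)
  have "(\<Sum>S\<in>Pow (insert x T). (- 1) ^ card S)
      = (\<Sum>S\<in>Pow T. (- 1) ^ card S) + (\<Sum>S\<in>Pow T. (- 1) ^ card (insert x S) :: 'a)"
    unfolding Pow_insert using insert(1,2)
    by (subst sum.union_disjoint) (auto simp: sum.reindex[OF inj])
  also have "(\<Sum>S\<in>Pow T. (- 1) ^ card (insert x S) :: 'a) = (\<Sum>S\<in>Pow T. - ((- 1) ^ card S))"
  proof (rule sum.cong)
    fix S assume S: "S \<in> Pow T"
    then have "x \<notin> S" using insert(2) by auto
    then show "(- 1) ^ card (insert x S) = - ((- 1) ^ card S :: 'a)" using fin[OF S] by simp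
  qed simp
  finally show ?case by (simp add: sum_negf)
qed simp

lemma sum_alternating_interval:
  assumes "finite A" "C \<subseteq> A"
  shows "(\<Sum>B | C \<subseteq> B \<and> B \<subseteq> A. (- 1) ^ card (A - B)) = (if A = C then 1 else 0 :: 'a :: comm_ring_1)"
proof -
  have "(\<Sum>B | C \<subseteq> B \<and> B \<subseteq> A. (- 1) ^ card (A - B) :: 'a) = (\<Sum>D\<in>Pow (A - C). (- 1) ^ card D)"
    by (rule sum.reindex_bij_witness[where i = "\<lambda>D. A - D" and j = "\<lambda>B. A - B"])
       (use assms in \<open>auto simp: double_diff\<close>)
  also have "\<dots> = (if A - C = {} then 1 else 0)" using assms by (intro sum_alternating_Pow) simp
  finally show ?thesis using assms by auto
qed

text \<open>Used for each coefficient separately: \<open>P a\<close> says that x is below the strip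
  with index a, \<open>Q S\<close> that x is below the strip of the intersection over S. Only sets S
  of indices satisfying \<open>P\<close> contribute, and leaving the empty set out of an alternating
  sum that vanishes yields 1.\<close>

lemma inclusion_exclusion_indicator:
  assumes "finite T" "\<And>S. S \<subseteq> T \<Longrightarrow> S \<noteq> {} \<Longrightarrow> Q S \<longleftrightarrow> (\<forall>a\<in>S. P a)"
  shows "(\<Sum>S | S \<subseteq> T \<and> S \<noteq> {}. (- 1) ^ (card S - 1) * (if Q S then 1 else 0))
    = (if \<exists>a\<in>T. P a then 1 else 0 :: 'a :: comm_ring_1)"
proof -
  let ?U = "{a \<in> T. P a}"
  have fU: "finite ?U" using assms(1) by simp
  have "(\<Sum>S | S \<subseteq> T \<and> S \<noteq> {}. (- 1) ^ (card S - 1) * (if Q S then 1 else 0 :: 'a))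
      = (\<Sum>S\<in>Pow ?U - {{}}. - ((- 1) ^ card S))"
  proof (rule sum.mono_neutral_cong_right)
    show "finite {S. S \<subseteq> T \<and> S \<noteq> {}}" using assms(1) by simp
    show "Pow ?U - {{}} \<subseteq> {S. S \<subseteq> T \<and> S \<noteq> {}}" by auto
    show "\<forall>S\<in>{S. S \<subseteq> T \<and> S \<noteq> {}} - (Pow ?U - {{}}).
        (- 1) ^ (card S - 1) * (if Q S then 1 else 0 :: 'a) = 0"
      using assms(2) by auto
    fix S assume S: "S \<in> Pow ?U - {{}}"
    then have "finite S" "S \<noteq> {}" using fU finite_subset by auto
    then have "card S = Suc (card S - 1)" by (simp add: card_gt_0_iff)
    then have "(- 1) ^ card S = - ((- 1) ^ (card S - 1) :: 'a)" by (metis power_Suc mult_minus1)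
    moreover have "Q S" using assms(2)[of S] S by auto
    ultimately show "(- 1) ^ (card S - 1) * (if Q S then 1 else 0 :: 'a) = - ((- 1) ^ card S)" by simp
  qed
  also have "\<dots> = - ((\<Sum>S\<in>Pow ?U. (- 1) ^ card S) - 1)"
    using fU by (simp add: sum_negf sum_diff1)
  also have "\<dots> = (if \<exists>a\<in>T. P a then 1 else 0)"
    using sum_alternating_Pow[OF fU, where 'a = 'a] by auto
  finally show ?thesis .
qed

section \<open>The Coxeter group: lengths and strong exchange\<close>

declare in_listsI [rule del] in_listsD [rule del] \<comment> \<open>keeps membership in \<open>lists\<close> folded\<close>

locale affine =
  fixes k :: nat
  assumes k_pos: "1 \<le> k"
begin

abbreviation W :: "nat list set set" where "W \<equiv> carrier (affS k)"
abbreviation mul :: "nat list set \<Rightarrow> nat list set \<Rightarrow> nat list set" (infixl "\<cdot>" 70)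
  where "x \<cdot> y \<equiv> x \<otimes>\<^bsub>affS k\<^esub> y"
abbreviation unit :: "nat list set" ("\<epsilon>") where "\<epsilon> \<equiv> \<one>\<^bsub>affS k\<^esub>"
abbreviation inve :: "nat list set \<Rightarrow> nat list set" where "inve x \<equiv> inv\<^bsub>affS k\<^esub> x"
abbreviation s :: "nat \<Rightarrow> nat list set" where "s i \<equiv> gen k i"
abbreviation ln :: "nat list set \<Rightarrow> nat" where "ln x \<equiv> len k x"
abbreviation cl :: "nat list \<Rightarrow> nat list set" where "cl u \<equiv> wcls k u"
abbreviation words :: "nat list set" where "words \<equiv> lists {..k}"

sublocale group "affS k" by (rule group_affS)

lemma cl_closed [simp]: "u \<in> words \<Longrightarrow> cl u \<in> W"
  by (auto simp: affS_def)

lemma word_exists: "x \<in> W \<Longrightarrow> \<exists>u\<in>words. x = cl u"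
  by (auto simp: affS_def)

lemma s_closed [simp]: "i \<le> k \<Longrightarrow> s i \<in> W"
  by (simp add: gen_def)

lemma rev_words [simp]: "rev u \<in> words \<longleftrightarrow> u \<in> words"
  by (simp add: in_lists_conv_set)

lemma cl_Nil: "cl [] = \<epsilon>" by (simp add: one_affS)

lemma cl_append: "cl (u @ v) = cl u \<cdot> cl v" by (simp add: mult_affS)

lemma cl_Cons: "cl (i # u) = s i \<cdot> cl u" by (simp add: gen_def mult_affS)

lemma s_square [simp]: "i \<le> k \<Longrightarrow> s i \<cdot> s i = \<epsilon>"
  using cox_eq.square[of i k "[]" "[]"] by (simp add: gen_def mult_affS one_affS wcls_eq_iff)

lemma s_s_left [simp]: "i \<le> k \<Longrightarrow> x \<in> W \<Longrightarrow> s i \<cdot> (s i \<cdot> x) = x"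
  by (simp flip: m_assoc)

lemma s_s_right [simp]: "i \<le> k \<Longrightarrow> x \<in> W \<Longrightarrow> x \<cdot> s i \<cdot> s i = x"
  by (simp add: m_assoc)

lemma inv_s [simp]: "i \<le> k \<Longrightarrow> inve (s i) = s i"
  by (simp add: inv_equality)

lemma s_braid:
  assumes "k \<ge> 2" "i \<le> k" "j = (i + 1) mod (k + 1)"
  shows "s i \<cdot> (s j \<cdot> s i) = s j \<cdot> (s i \<cdot> s j)"
  using cox_eq.braid[OF assms, of "[]" "[]"] by (simp add: gen_def mult_affS wcls_eq_iff)

lemma s_comm:
  assumes "i \<le> k" "j \<le> k" "j \<noteq> (i + 1) mod (k + 1)" "i \<noteq> (j + 1) mod (k + 1)"
  shows "s i \<cdot> s j = s j \<cdot> s i"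
  using cox_eq.comm[OF assms(1,2) _ assms(3,4), of "[]" "[]"]
  by (cases "i = j") (simp_all add: gen_def mult_affS wcls_eq_iff)

lemma inv_cl: "u \<in> words \<Longrightarrow> inve (cl u) = cl (rev u)"
  using cox_eq_rev[of u k]
  by (intro inv_equality) (auto simp: mult_affS one_affS wcls_eq_iff lists_eq_set)

lemma conj_cancel [simp]: "i \<le> k \<Longrightarrow> t \<in> W \<Longrightarrow> s i \<cdot> (s i \<cdot> t \<cdot> s i) \<cdot> s i = t"
  by (simp add: m_assoc)

lemma conj_eq_iff:
  assumes "i \<le> k" "t \<in> W" "y \<in> W"
  shows "s i \<cdot> t \<cdot> s i = y \<longleftrightarrow> t = s i \<cdot> y \<cdot> s i"
  using assms by auto

lemma s_mul_eq_unit_iff: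
  assumes "i \<le> k" "t \<in> W" shows "s i \<cdot> t = \<epsilon> \<longleftrightarrow> t = s i"
  using assms by (metis s_s_left s_square r_one s_closed)

lemma cox_eq_words: "cox_eq k u v \<Longrightarrow> u \<in> words \<longleftrightarrow> v \<in> words"
  by (induction rule: cox_eq.induct) (auto simp: lists_eq_set)

lemma cox_eq_even_length: "cox_eq k u v \<Longrightarrow> even (length u) \<longleftrightarrow> even (length v)"
  by (induction rule: cox_eq.induct) auto

text \<open>The parity of the number of prefixes \<open>v i\<close> of the word with \<open>v i v\<^sup>-\<^sup>1 = t\<close>.\<close>

fun refl_parity :: "nat list \<Rightarrow> nat list set \<Rightarrow> bool" where
  "refl_parity [] t = False"
| "refl_parity (i # u) t = ((t = s i) \<noteq> refl_parity u (s i \<cdot> t \<cdot> s i))"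

lemma refl_parity_prefix:
  assumes "\<And>t. t \<in> W \<Longrightarrow> refl_parity v t = refl_parity v' t" "u \<in> words" "t \<in> W"
  shows "refl_parity (u @ v) t = refl_parity (u @ v') t"
  using assms(2,3) by (induction u arbitrary: t) (auto simp: assms(1))

text \<open>Both sides of each relation list the same conjugates up to cancelling pairs: the square
  relation lists \<open>s i\<close> twice, and the two braid words list the three reflections
  \<open>s i\<close>, \<open>s i \<cdot> s j \<cdot> s i\<close>, \<open>s j\<close> in opposite
  orders. So the parity belongs to the group element and not to the word.\<close>

lemma refl_parity_cong:
  "cox_eq k u v \<Longrightarrow> u \<in> words \<Longrightarrow> t \<in> W \<Longrightarrow> refl_parity u t = refl_parity v t"
proof (induction arbitrary: t rule: cox_eq.induct)
  case (trans u v w)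
  then show ?case using cox_eq_words by metis
next
  case (sym u v)
  then show ?case using cox_eq_words by metis
next
  case (square i u v)
  show ?case
    using square by (intro refl_parity_prefix) (auto simp add: conj_eq_iff s_mul_eq_unit_iff)
next
  case (braid i j u v)
  have j: "j \<le> k" using braid by simp
  have b: "s i \<cdot> (s j \<cdot> s i) = s j \<cdot> (s i \<cdot> s j)" using braid by (intro s_braid) auto
  have b': "s i \<cdot> (s j \<cdot> (s i \<cdot> x)) = s j \<cdot> (s i \<cdot> (s j \<cdot> x))" if "x \<in> W" for x
    using b that braid(2) j by (simp flip: m_assoc)
  have c: "s i \<cdot> (s j \<cdot> (s i \<cdot> (s j \<cdot> s i))) = s j"
    using b'[of "s j \<cdot> s i"] braid(2) j by simp
  have c': "s j \<cdot> (s i \<cdot> (s j \<cdot> (s i \<cdot> s j))) = s i"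
    using b'[of "s i \<cdot> s j"] braid(2) j by simp
  show ?case
  proof (rule refl_parity_prefix)
    fix t assume t: "t \<in> W"
    have ij: "s i \<in> W" "s j \<in> W" using braid(2) j by simp_all
    have "s j \<cdot> s i \<cdot> s j = s i \<cdot> s j \<cdot> s i" using ij b by (simp add: m_assoc)
    then have 1: "s i \<cdot> t \<cdot> s i = s j \<longleftrightarrow> t = s i \<cdot> s j \<cdot> s i"
      and 2: "s j \<cdot> t \<cdot> s j = s i \<longleftrightarrow> t = s i \<cdot> s j \<cdot> s i"
      using conj_eq_iff[OF braid(2) t ij(2)] conj_eq_iff[OF j t ij(1)] by simp_all
    have "s j \<cdot> (s i \<cdot> t \<cdot> s i) \<cdot> s j = s i \<longleftrightarrow> t = s i \<cdot> (s j \<cdot> s i \<cdot> s j) \<cdot> s i"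
      using t ij braid(2) j by (subst conj_eq_iff, (simp_all)[3], subst conj_eq_iff) simp_all
    moreover have "s i \<cdot> (s j \<cdot> s i \<cdot> s j) \<cdot> s i = s j" using ij c by (simp add: m_assoc)
    ultimately have 3: "s j \<cdot> (s i \<cdot> t \<cdot> s i) \<cdot> s j = s i \<longleftrightarrow> t = s j" by simp
    have "s i \<cdot> (s j \<cdot> t \<cdot> s j) \<cdot> s i = s j \<longleftrightarrow> t = s j \<cdot> (s i \<cdot> s j \<cdot> s i) \<cdot> s j"
      using t ij braid(2) j by (subst conj_eq_iff, (simp_all)[3], subst conj_eq_iff) simp_all
    moreover have "s j \<cdot> (s i \<cdot> s j \<cdot> s i) \<cdot> s j = s i" using ij c' by (simp add: m_assoc)
    ultimately have 4: "s i \<cdot> (s j \<cdot> t \<cdot> s j) \<cdot> s i = s j \<longleftrightarrow> t = s i" by simp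
    have 5: "s i \<cdot> (s j \<cdot> (s i \<cdot> t \<cdot> s i) \<cdot> s j) \<cdot> s i = s j \<cdot> (s i \<cdot> (s j \<cdot> t \<cdot> s j) \<cdot> s i) \<cdot> s j"
      using ij t b b' by (simp add: m_assoc)
    show "refl_parity ([i, j, i] @ v) t = refl_parity ([j, i, j] @ v) t"
      by (simp only: append_Cons append_Nil refl_parity.simps 1 2 3 4 5) blast
  qed (use braid in auto)
next
  case (comm i j u v)
  have b: "s i \<cdot> s j = s j \<cdot> s i" using comm by (intro s_comm) auto
  have b': "s i \<cdot> (s j \<cdot> x) = s j \<cdot> (s i \<cdot> x)" if "x \<in> W" for x
    using b that comm(1,2) by (simp flip: m_assoc)
  show ?case
  proof (rule refl_parity_prefix)
    fix t assume t: "t \<in> W"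
    have ij: "s i \<in> W" "s j \<in> W" using comm by simp_all
    have "s i \<cdot> s j \<cdot> s i = s j" "s j \<cdot> s i \<cdot> s j = s i"
      using comm(1,2) b by (metis s_closed s_s_right)+
    then have 1: "s i \<cdot> t \<cdot> s i = s j \<longleftrightarrow> t = s j" and 2: "s j \<cdot> t \<cdot> s j = s i \<longleftrightarrow> t = s i"
      using conj_eq_iff[OF comm(1) t ij(2)] conj_eq_iff[OF comm(2) t ij(1)] by simp_all
    have 3: "s j \<cdot> (s i \<cdot> t \<cdot> s i) \<cdot> s j = s i \<cdot> (s j \<cdot> t \<cdot> s j) \<cdot> s i"
      using ij t b b' by (simp add: m_assoc)
    show "refl_parity ([i, j] @ v) t = refl_parity ([j, i] @ v) t"
      by (simp only: append_Cons append_Nil refl_parity.simps 1 2 3) blast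
  qed (use comm in auto)
qed auto

lemma refl_parity_cl:
  "cl u = cl v \<Longrightarrow> u \<in> words \<Longrightarrow> t \<in> W \<Longrightarrow> refl_parity u t = refl_parity v t"
  using refl_parity_cong by (simp add: wcls_eq_iff)

lemma refl_parity_append:
  assumes "u \<in> words" "t \<in> W"
  shows "refl_parity (u @ v) t = (refl_parity u t \<noteq> refl_parity v (inve (cl u) \<cdot> t \<cdot> cl u))"
  using assms
proof (induction u arbitrary: t)
  case (Cons i u)
  have iu: "i \<le> k" "u \<in> words" using Cons.hyps by simp_all
  then have "inve (cl (i # u)) \<cdot> t \<cdot> cl (i # u) = inve (cl u) \<cdot> (s i \<cdot> t \<cdot> s i) \<cdot> cl u"
    using Cons.prems by (simp add: cl_Cons inv_mult_group m_assoc)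
  then show ?case using Cons iu by simp blast
qed (simp add: cl_Nil)

text \<open>An odd count is not zero, so t is the conjugate of some letter c by the prefix before
  it, and multiplying by t deletes c.\<close>

lemma refl_parity_delete:
  assumes "refl_parity u t" "u \<in> words" "t \<in> W"
  shows "\<exists>a c b. u = a @ c # b \<and> t \<cdot> cl u = cl (a @ b)"
  using assms
proof (induction u arbitrary: t)
  case (Cons i u)
  show ?case
  proof (cases "t = s i")
    case True
    then have "t \<cdot> cl (i # u) = cl u" using Cons.prems by (simp add: cl_Cons)
    then show ?thesis by (metis append_Nil)
  next
    case False
    then have "refl_parity u (s i \<cdot> t \<cdot> s i)" "u \<in> words" "s i \<cdot> t \<cdot> s i \<in> W"
      using Cons.prems by simp_all
    then obtain a c b where *: "u = a @ c # b" "s i \<cdot> t \<cdot> s i \<cdot> cl u = cl (a @ b)"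
      using Cons.IH by blast
    have "s i \<cdot> cl (a @ b) = t \<cdot> cl (i # u)"
      unfolding *(2)[symmetric] using Cons.prems by (simp add: cl_Cons m_assoc)
    then have "t \<cdot> cl (i # u) = cl ((i # a) @ b)" by (simp add: cl_Cons)
    then show ?thesis using *(1) by (metis append_Cons)
  qed
qed simp

section \<open>Length function\<close>

lemma ln_cl_le: "u \<in> words \<Longrightarrow> ln (cl u) \<le> length u"
  unfolding len_def by (rule Least_le) auto

lemma reduced_exists:
  assumes "x \<in> W" shows "\<exists>u\<in>words. x = cl u \<and> length u = ln x"
proof -
  have "\<exists>n. \<exists>u\<in>words. x = cl u \<and> n = length u" using word_exists[OF assms] by blast
  from LeastI_ex[OF this] show ?thesis unfolding len_def by auto
qed

lemma reducedE:
  assumes "x \<in> W" obtains u where "u \<in> words" "x = cl u" "length u = ln x"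
  using reduced_exists[OF assms] by blast

lemma ln_unit [simp]: "ln \<epsilon> = 0"
  using ln_cl_le[of "[]"] by (simp add: cl_Nil)

lemma even_ln: "u \<in> words \<Longrightarrow> even (ln (cl u)) \<longleftrightarrow> even (length u)"
  using reduced_exists[of "cl u"] cox_eq_even_length by (force simp: wcls_eq_iff)

lemma even_ln_mul:
  assumes "x \<in> W" "y \<in> W"
  shows "even (ln (x \<cdot> y)) \<longleftrightarrow> (even (ln x) \<longleftrightarrow> even (ln y))"
proof -
  obtain u v where "u \<in> words" "x = cl u" "v \<in> words" "y = cl v" using assms word_exists by meson
  then show ?thesis using even_ln[of "u @ v"] by (simp add: even_ln cl_append)
qed

lemma ln_mul_le:
  assumes "x \<in> W" "y \<in> W"
  shows "ln (x \<cdot> y) \<le> ln x + ln y"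
proof -
  obtain u v where "u \<in> words" "x = cl u" "length u = ln x" "v \<in> words" "y = cl v" "length v = ln y"
    using reducedE[OF assms(1)] reducedE[OF assms(2)] by metis
  then show ?thesis using ln_cl_le[of "u @ v"] by (simp add: cl_append)
qed

lemma ln_inv [simp]:
  assumes "x \<in> W" shows "ln (inve x) = ln x"
proof -
  have le: "ln (inve x) \<le> ln x" if "x \<in> W" for x
  proof -
    obtain u where "u \<in> words" "x = cl u" "length u = ln x" using reducedE[OF \<open>x \<in> W\<close>] .
    then show ?thesis using ln_cl_le[of "rev u"] by (simp add: inv_cl)
  qed
  show ?thesis using le[of x] le[of "inve x"] assms by simp
qed

lemma ln_s: "i \<le> k \<Longrightarrow> ln (s i) = 1"
proof -
  assume i: "i \<le> k"
  have "ln (s i) \<le> 1" using i ln_cl_le[of "[i]"] by (simp add: gen_def)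
  moreover have "odd (ln (s i))" using even_ln[of "[i]"] i by (simp add: gen_def)
  ultimately show ?thesis by (metis One_nat_def dvd_0_right le_SucE le_zero_eq)
qed

lemma ln_s_mul:
  assumes "i \<le> k" "x \<in> W"
  shows "ln (s i \<cdot> x) = ln x + 1 \<or> ln x = ln (s i \<cdot> x) + 1"
proof -
  have "ln (s i \<cdot> x) \<le> 1 + ln x" "ln x \<le> 1 + ln (s i \<cdot> x)"
    using ln_mul_le[of "s i" x] ln_mul_le[of "s i" "s i \<cdot> x"] assms by (auto simp: ln_s)
  moreover have "ln (s i \<cdot> x) \<noteq> ln x" using even_ln_mul[of "s i" x] assms by (auto simp: ln_s)
  ultimately show ?thesis by linarith
qed

lemma ln_mul_s:
  assumes "i \<le> k" "x \<in> W"
  shows "ln (x \<cdot> s i) = ln x + 1 \<or> ln x = ln (x \<cdot> s i) + 1"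
  using ln_s_mul[of i "inve x"] assms ln_inv[of "x \<cdot> s i"] by (simp add: inv_mult_group)

section \<open>Reflections and strong exchange\<close>

lemma reflections_closed: "t \<in> reflections k \<Longrightarrow> t \<in> W"
  by (auto simp: reflections_def)

lemma reflection_square: "t \<in> reflections k \<Longrightarrow> t \<cdot> t = \<epsilon>"
proof -
  have c: "inve x \<cdot> (x \<cdot> y) = y" if "x \<in> W" "y \<in> W" for x y
    using that by (simp flip: m_assoc)
  show "t \<in> reflections k \<Longrightarrow> t \<cdot> t = \<epsilon>"
    by (auto simp: reflections_def m_assoc c)
qed

lemma reflection_cancel [simp]: "t \<in> reflections k \<Longrightarrow> x \<in> W \<Longrightarrow> t \<cdot> (t \<cdot> x) = x"
  by (simp add: reflection_square reflections_closed flip: m_assoc)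

lemma reflections_conj:
  assumes "t \<in> reflections k" "x \<in> W" shows "x \<cdot> t \<cdot> inve x \<in> reflections k"
proof -
  obtain y i where "t = y \<cdot> s i \<cdot> inve y" "y \<in> W" "i \<le> k" using assms(1) by (auto simp: reflections_def)
  then have "x \<cdot> t \<cdot> inve x = (x \<cdot> y) \<cdot> s i \<cdot> inve (x \<cdot> y)" "x \<cdot> y \<in> W"
    using assms(2) by (simp_all add: inv_mult_group m_assoc)
  then show ?thesis using \<open>i \<le> k\<close> unfolding reflections_def by blast
qed

lemma s_reflection: "i \<le> k \<Longrightarrow> s i \<in> reflections k"
  unfolding reflections_def by (auto intro!: exI[of _ \<epsilon>] exI[of _ i])

lemma even_ln_reflection:
  assumes "t \<in> reflections k" shows "odd (ln t)"
proof -
  obtain y i where "t = y \<cdot> s i \<cdot> inve y" "y \<in> W" "i \<le> k" using assms(1) by (auto simp: reflections_def)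
  then show ?thesis by (simp add: even_ln_mul ln_s)
qed

text \<open>In a word v i v^{-1} for t the counts of the two outer parts are equal, because
  \<open>v @ rev v\<close> represents the unit and has count zero. They cancel, and the middle
  letter alone is left.\<close>

lemma refl_parity_self:
  assumes "t \<in> reflections k" "u \<in> words" "t = cl u"
  shows "refl_parity u t"
proof -
  obtain y i where t: "t = y \<cdot> s i \<cdot> inve y" "y \<in> W" "i \<le> k" using assms(1) by (auto simp: reflections_def)
  obtain v where v: "v \<in> words" "y = cl v" using word_exists t by metis
  have tW: "t \<in> W" using t by simp
  have tv: "t = cl (v @ [i] @ rev v)"
    using t v by (simp add: cl_append cl_Cons inv_cl m_assoc)
  have conj: "inve (cl v) \<cdot> t \<cdot> cl v = s i"
  proof -
    have "inve (cl v) \<cdot> (cl v \<cdot> s i \<cdot> inve (cl v)) \<cdot> cl v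
        = (inve (cl v) \<cdot> cl v) \<cdot> s i \<cdot> (inve (cl v) \<cdot> cl v)"
      using t v by (simp only: m_assoc cl_closed s_closed m_closed inv_closed)
    then show ?thesis using t v by simp
  qed
  have "refl_parity (v @ rev v) t = refl_parity [] t"
    using v tW inv_cl[of v] by (intro refl_parity_cl) (auto simp: cl_append cl_Nil simp flip: inv_cl)
  then have "refl_parity v t = refl_parity (rev v) (s i)"
    using v tW conj by (simp add: refl_parity_append)
  then have "refl_parity (v @ [i] @ rev v) t"
    using v tW conj t(3) by (simp add: refl_parity_append)
  then show ?thesis using refl_parity_cl[of u "v @ [i] @ rev v" t] assms tv tW by simp
qed

text \<open>One direction is deletion of a letter. For the other, an even count for u becomes odd
  when a word of t itself is put in front, so t shortens \<open>t \<cdot> cl u\<close>; that is,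
  \<open>cl u\<close> is the shorter of the two.\<close>

lemma refl_parity_iff:
  assumes t: "t \<in> reflections k" and u: "u \<in> words"
  shows "refl_parity u t \<longleftrightarrow> ln (t \<cdot> cl u) < ln (cl u)"
proof -
  have tW: "t \<in> W" using t by (rule reflections_closed)
  have less: "ln (t \<cdot> cl v) < ln (cl v)" if rv: "refl_parity v t" "v \<in> words" for v
  proof -
    obtain v' where v': "v' \<in> words" "cl v = cl v'" "length v' = ln (cl v)"
      using reducedE[OF cl_closed[OF rv(2)]] .
    then have "refl_parity v' t" using rv tW refl_parity_cl by metis
    then obtain a c b where "v' = a @ c # b" "t \<cdot> cl v' = cl (a @ b)"
      using refl_parity_delete v' tW by metis
    then show ?thesis using ln_cl_le[of "a @ b"] v' by auto
  qed
  show ?thesis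
  proof
    assume "ln (t \<cdot> cl u) < ln (cl u)"
    show "refl_parity u t"
    proof (rule ccontr)
      assume n: "\<not> refl_parity u t"
      obtain v where v: "v \<in> words" "t = cl v" using word_exists tW by metis
      have "inve (cl v) \<cdot> t \<cdot> cl v = t"
        using v tW by (metis l_inv l_one)
      then have "refl_parity (v @ u) t"
        using refl_parity_self[OF t v] n v tW by (simp add: refl_parity_append)
      then have "ln (t \<cdot> cl (v @ u)) < ln (cl (v @ u))" using u v by (intro less) auto
      then have "ln (cl u) < ln (t \<cdot> cl u)" using t u v by (simp add: cl_append)
      then show False using \<open>ln (t \<cdot> cl u) < ln (cl u)\<close> by simp
    qed
  qed (use less u in blast)
qed

text \<open>The word u may be non-reduced, so deletion can be repeated on the words that it
  produces.\<close>

lemma strong_exchange: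
  assumes "t \<in> reflections k" "u \<in> words" "ln (t \<cdot> cl u) < ln (cl u)"
  shows "\<exists>a c b. u = a @ c # b \<and> t \<cdot> cl u = cl (a @ b)"
  using assms refl_parity_iff refl_parity_delete reflections_closed by blast

text \<open>Right multiplication by \<open>s j\<close> is left multiplication by a conjugate
  reflection, so it deletes a letter of the reduced word \<open>i # u\<close> of
  \<open>s i \<cdot> x\<close>. A letter of u would contradict that \<open>s j\<close> is an ascent
  of x; hence i itself is deleted.\<close>

lemma left_right_ascent_eq:
  assumes "i \<le> k" "j \<le> k" "x \<in> W"
    and "ln (s i \<cdot> x) > ln x" "ln (x \<cdot> s j) > ln x" "ln (s i \<cdot> x \<cdot> s j) < ln (s i \<cdot> x)"
  shows "s i \<cdot> x = x \<cdot> s j"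
proof -
  obtain u where u: "u \<in> words" "x = cl u" "length u = ln x" using reducedE[OF assms(3)] .
  define t where "t = (s i \<cdot> x) \<cdot> s j \<cdot> inve (s i \<cdot> x)"
  have t: "t \<in> reflections k" unfolding t_def using assms by (intro reflections_conj s_reflection) auto
  have tx: "t \<cdot> cl (i # u) = s i \<cdot> x \<cdot> s j"
    using assms u(2) by (simp add: t_def cl_Cons m_assoc)
  have "i # u \<in> words" "ln (t \<cdot> cl (i # u)) < ln (cl (i # u))"
    unfolding tx using u assms by (simp_all add: cl_Cons)
  then obtain a c b where abc: "i # u = a @ c # b" "t \<cdot> cl (i # u) = cl (a @ b)"
    using strong_exchange[OF t, of "i # u"] by blast
  show ?thesis
  proof (cases a)
    case Nil
    then have "s i \<cdot> x \<cdot> s j = x" using abc tx u by simp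
    then show ?thesis using assms by (metis s_s_right m_closed s_closed)
  next
    case (Cons a0 a')
    then have "s i \<cdot> x \<cdot> s j = s i \<cdot> cl (a' @ b)" using abc tx by (simp add: cl_Cons)
    moreover have ab: "a' @ b \<in> words" using abc Cons u by auto
    ultimately have "x \<cdot> s j = cl (a' @ b)"
      using assms by (metis cl_closed m_assoc m_closed s_closed s_s_left)
    then have "ln (x \<cdot> s j) \<le> length (a' @ b)" using ln_cl_le[OF ab] by simp
    then have "ln (x \<cdot> s j) < ln x" using abc Cons u by auto
    then show ?thesis using assms by simp
  qed
qed

section \<open>Strong order and Demazure action\<close>

abbreviation sle :: "nat list set \<Rightarrow> nat list set \<Rightarrow> bool" (infix "\<preceq>" 50)
  where "x \<preceq> y \<equiv> strong_le k x y"

lemma sle_refl [simp]: "x \<preceq> x"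
  by (simp add: strong_le_def)

lemma sle_trans [trans]: "x \<preceq> y \<Longrightarrow> y \<preceq> z \<Longrightarrow> x \<preceq> z"
  by (simp add: strong_le_def)

lemma sle_step: "x \<in> W \<Longrightarrow> t \<in> reflections k \<Longrightarrow> ln x < ln (t \<cdot> x) \<Longrightarrow> x \<preceq> t \<cdot> x"
  unfolding strong_le_def by (rule r_into_rtranclp) blast

lemma sle_induct [consumes 1, case_names refl step]:
  assumes "x \<preceq> y" "P x"
    "\<And>y t. x \<preceq> y \<Longrightarrow> P y \<Longrightarrow> y \<in> W \<Longrightarrow> t \<in> reflections k \<Longrightarrow> ln y < ln (t \<cdot> y) \<Longrightarrow> P (t \<cdot> y)"
  shows "P y"
  using assms(1) unfolding strong_le_def
proof (induction rule: rtranclp_induct)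
  case (step y z)
  then show ?case using assms(3)[of y] by (auto simp: strong_le_def)
qed (rule assms(2))

lemma sle_ln: "x \<preceq> y \<Longrightarrow> x = y \<or> ln x < ln y"
  by (induction rule: sle_induct) auto

lemma sle_closed': "x \<preceq> y \<Longrightarrow> y \<in> W \<Longrightarrow> x \<in> W"
  unfolding strong_le_def by (induction rule: converse_rtranclp_induct) simp_all

text \<open>Conjugating t by y turns left into right reflections. The strong order is defined by
  left reflections, and inversion carries all facts about left multiplication over to the
  right.\<close>

lemma sle_inv: "x \<preceq> y \<Longrightarrow> x \<in> W \<Longrightarrow> inve x \<preceq> inve y"
proof (induction rule: sle_induct)
  case (step y t)
  have tW: "t \<in> W" "inve t = t"
    using step reflections_closed reflection_square by (simp_all add: inv_equality)
  define t' where "t' = inve y \<cdot> t \<cdot> inve (inve y)"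
  have t': "t' \<in> reflections k" unfolding t'_def using step by (intro reflections_conj) simp_all
  have eq: "t' \<cdot> inve y = inve (t \<cdot> y)"
    using step tW by (simp add: t'_def inv_mult_group m_assoc)
  have "ln (inve y) < ln (inve (t \<cdot> y))" using step tW by simp
  then have "inve y \<preceq> inve (t \<cdot> y)"
    using sle_step[OF _ t', of "inve y"] step eq by simp
  then show ?case using step sle_trans by blast
qed simp

text \<open>The step to the smaller of x and s_i x, as the Demazure generator \<open>up i\<close> is
  the step to the larger one; \<open>upr\<close> and \<open>dnr\<close> are the same two steps on
  the right. Lengths are compared instead of the strong order, which \<open>up_eq\<close> shows to
  be equivalent.\<close>

definition dn :: "nat \<Rightarrow> nat list set \<Rightarrow> nat list set" where
  "dn i x = (if ln (s i \<cdot> x) < ln x then s i \<cdot> x else x)"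

definition upr :: "nat \<Rightarrow> nat list set \<Rightarrow> nat list set" where
  "upr i x = (if ln x < ln (x \<cdot> s i) then x \<cdot> s i else x)"

definition dnr :: "nat \<Rightarrow> nat list set \<Rightarrow> nat list set" where
  "dnr i x = (if ln (x \<cdot> s i) < ln x then x \<cdot> s i else x)"

abbreviation up :: "nat \<Rightarrow> nat list set \<Rightarrow> nat list set" where "up \<equiv> demazure_gen k"

lemma s_sle: "i \<le> k \<Longrightarrow> x \<in> W \<Longrightarrow> ln x < ln (s i \<cdot> x) \<Longrightarrow> x \<preceq> s i \<cdot> x"
  by (intro sle_step s_reflection)

lemma s_sle': "i \<le> k \<Longrightarrow> x \<in> W \<Longrightarrow> ln (s i \<cdot> x) < ln x \<Longrightarrow> s i \<cdot> x \<preceq> x"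
  using s_sle[of i "s i \<cdot> x"] by simp

lemma strong_less_s_iff: "i \<le> k \<Longrightarrow> x \<in> W \<Longrightarrow> strong_less k x (s i \<cdot> x) \<longleftrightarrow> ln x < ln (s i \<cdot> x)"
  using s_sle[of i x] sle_ln[of x "s i \<cdot> x"] by (auto simp: strong_less_def)

lemma strong_less_s_iff':
  assumes "i \<le> k" "x \<in> W"
  shows "strong_less k x (x \<cdot> s i) \<longleftrightarrow> ln x < ln (x \<cdot> s i)"
proof -
  have "x \<preceq> x \<cdot> s i" if "ln x < ln (x \<cdot> s i)"
    using sle_inv[OF s_sle[of i "inve x"]] assms that ln_inv[of "x \<cdot> s i"]
    by (simp add: inv_mult_group)
  then show ?thesis using sle_ln[of x "x \<cdot> s i"] by (auto simp: strong_less_def)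
qed

lemma up_eq: "i \<le> k \<Longrightarrow> x \<in> W \<Longrightarrow> up i x = (if ln x < ln (s i \<cdot> x) then s i \<cdot> x else x)"
  by (simp add: demazure_gen_def strong_less_s_iff)

lemma up_closed [simp]: "i \<le> k \<Longrightarrow> x \<in> W \<Longrightarrow> up i x \<in> W"
  and dn_closed [simp]: "i \<le> k \<Longrightarrow> x \<in> W \<Longrightarrow> dn i x \<in> W"
  and upr_closed [simp]: "i \<le> k \<Longrightarrow> x \<in> W \<Longrightarrow> upr i x \<in> W"
  and dnr_closed [simp]: "i \<le> k \<Longrightarrow> x \<in> W \<Longrightarrow> dnr i x \<in> W"
  by (simp_all add: demazure_gen_def dn_def upr_def dnr_def)

lemma sle_up: "i \<le> k \<Longrightarrow> x \<in> W \<Longrightarrow> x \<preceq> up i x" "i \<le> k \<Longrightarrow> x \<in> W \<Longrightarrow> s i \<cdot> x \<preceq> up i x"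
  and sle_dn: "i \<le> k \<Longrightarrow> x \<in> W \<Longrightarrow> dn i x \<preceq> x" "i \<le> k \<Longrightarrow> x \<in> W \<Longrightarrow> dn i x \<preceq> s i \<cdot> x"
  using ln_s_mul[of i x] by (auto simp: up_eq dn_def s_sle s_sle')

lemma dn_up: "i \<le> k \<Longrightarrow> x \<in> W \<Longrightarrow> dn i (up i x) = dn i x"
  and up_dn: "i \<le> k \<Longrightarrow> x \<in> W \<Longrightarrow> up i (dn i x) = up i x"
  using ln_s_mul[of i x] by (auto simp: up_eq dn_def)

text \<open>The lifting property for a single reflection. If the order were reversed, all lengths
  would be forced, and t would delete a letter of a reduced word of \<open>t \<cdot> x\<close>
  beginning with i. Deleting that i means \<open>t = s i\<close>; deleting another letter makes
  \<open>s i \<cdot> x\<close> shorter than x.\<close>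

lemma reflection_step_s:
  assumes "x \<in> W" "t \<in> reflections k" "ln x < ln (t \<cdot> x)" "i \<le> k" "t \<noteq> s i"
  shows "s i \<cdot> x \<preceq> s i \<cdot> (t \<cdot> x)"
proof -
  have tW: "t \<in> W" using assms reflections_closed by simp
  define t' where "t' = s i \<cdot> t \<cdot> inve (s i)"
  have t': "t' \<in> reflections k" unfolding t'_def using assms by (intro reflections_conj) simp_all
  have eq: "t' \<cdot> (s i \<cdot> x) = s i \<cdot> (t \<cdot> x)" using assms tW by (simp add: t'_def m_assoc)
  have "odd (ln t')" using even_ln_reflection[OF t'] .
  then have par: "even (ln (s i \<cdot> (t \<cdot> x))) \<longleftrightarrow> odd (ln (s i \<cdot> x))"
    unfolding eq[symmetric] using t' reflections_closed assms by (subst even_ln_mul) simp_all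
  have "ln (s i \<cdot> x) < ln (s i \<cdot> (t \<cdot> x))"
  proof (rule ccontr)
    assume "\<not> ?thesis"
    then have "ln (s i \<cdot> (t \<cdot> x)) < ln (s i \<cdot> x)" using par by (metis linorder_neqE_nat)
    then have len: "ln (s i \<cdot> x) = ln x + 1" "ln (s i \<cdot> (t \<cdot> x)) = ln x" "ln (t \<cdot> x) = ln x + 1"
      using assms tW ln_s_mul[of i x] ln_s_mul[of i "t \<cdot> x"] by auto
    obtain v where v: "v \<in> words" "s i \<cdot> (t \<cdot> x) = cl v" "length v = ln x"
      using reducedE[of "s i \<cdot> (t \<cdot> x)"] assms tW len by (metis m_closed s_closed)
    have tx: "cl (i # v) = t \<cdot> x" unfolding cl_Cons v(2)[symmetric] using assms tW by simp
    have "t \<cdot> cl (i # v) = x" unfolding tx using assms tW by simp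
    moreover have "i # v \<in> words" using v assms by simp
    ultimately obtain a c b where abc: "i # v = a @ c # b" "x = cl (a @ b)"
      using strong_exchange[of t "i # v"] assms tx len by auto
    show False
    proof (cases a)
      case Nil
      then have "x = s i \<cdot> (t \<cdot> x)" using abc v by simp
      then have "t \<cdot> x = s i \<cdot> x" using assms tW by (metis m_closed s_s_left)
      then show False using assms tW by simp
    next
      case (Cons a0 a')
      then have "s i \<cdot> x = cl (a' @ b)" using abc assms v by (auto simp: cl_Cons)
      then have "ln (s i \<cdot> x) \<le> length (a' @ b)" using ln_cl_le[of "a' @ b"] abc Cons v by auto
      then show False using len v abc Cons by auto
    qed
  qed
  then show ?thesis using sle_step[of "s i \<cdot> x" t'] eq t' assms by simp
qed

lemma up_dn_mono:
  assumes "x \<preceq> y" "x \<in> W" "i \<le> k"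
  shows "up i x \<preceq> up i y \<and> dn i x \<preceq> dn i y"
  using assms(1)
proof (induction rule: sle_induct)
  case (step y t)
  have ty: "t \<cdot> y \<in> W" using step reflections_closed by simp
  have yW: "y \<in> W" using step by simp
  have "up i y \<preceq> up i (t \<cdot> y) \<and> dn i y \<preceq> dn i (t \<cdot> y)"
  proof (cases "t = s i")
    case True
    then show ?thesis using step assms by (simp add: up_eq dn_def)
  next
    case False
    have 1: "y \<preceq> t \<cdot> y" using step by (intro sle_step)
    have 2: "s i \<cdot> y \<preceq> s i \<cdot> (t \<cdot> y)" using step False assms by (intro reflection_step_s)
    have "y \<preceq> up i (t \<cdot> y)" "s i \<cdot> y \<preceq> up i (t \<cdot> y)"
      using sle_trans[OF 1 sle_up(1)[OF assms(3) ty]] sle_trans[OF 2 sle_up(2)[OF assms(3) ty]] .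
    moreover have "dn i y \<preceq> t \<cdot> y" "dn i y \<preceq> s i \<cdot> (t \<cdot> y)"
      using sle_trans[OF sle_dn(1)[OF assms(3) yW] 1] sle_trans[OF sle_dn(2)[OF assms(3) yW] 2] .
    ultimately show ?thesis
      by (simp add: up_eq[OF assms(3) yW] dn_def[of i "t \<cdot> y"])
  qed
  then show ?case using step sle_trans by blast
qed simp

lemma up_mono: "x \<preceq> y \<Longrightarrow> x \<in> W \<Longrightarrow> i \<le> k \<Longrightarrow> up i x \<preceq> up i y"
  and dn_mono: "x \<preceq> y \<Longrightarrow> x \<in> W \<Longrightarrow> i \<le> k \<Longrightarrow> dn i x \<preceq> dn i y"
  using up_dn_mono by blast+

text \<open>A Galois connection between \<open>dn i\<close> and \<open>up i\<close>, obtained from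
  monotonicity of both and \<open>dn_up\<close>, \<open>up_dn\<close>. It is the form in which the
  lifting property is used from here on.\<close>

lemma sle_up_iff:
  assumes "x \<in> W" "y \<in> W" "i \<le> k"
  shows "x \<preceq> up i y \<longleftrightarrow> dn i x \<preceq> y"
  by (metis assms dn_up up_dn up_mono dn_mono sle_up(1) sle_dn(1) sle_trans up_closed dn_closed)

lemma upr_eq: "i \<le> k \<Longrightarrow> x \<in> W \<Longrightarrow> upr i x = inve (up i (inve x))"
  and dnr_eq: "i \<le> k \<Longrightarrow> x \<in> W \<Longrightarrow> dnr i x = inve (dn i (inve x))"
  using ln_inv[of "x \<cdot> s i"] by (simp_all add: up_eq upr_def dnr_def dn_def inv_mult_group)

lemma sle_inv_iff: "x \<in> W \<Longrightarrow> y \<in> W \<Longrightarrow> inve x \<preceq> inve y \<longleftrightarrow> x \<preceq> y"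
  using sle_inv[of x y] sle_inv[of "inve x" "inve y"] by auto

lemma sle_upr_iff:
  assumes "x \<in> W" "y \<in> W" "i \<le> k"
  shows "x \<preceq> upr i y \<longleftrightarrow> dnr i x \<preceq> y"
  using assms sle_up_iff[of "inve x" "inve y" i]
    sle_inv_iff[of x "upr i y"] sle_inv_iff[of "dnr i x" y]
  by (simp add: upr_eq dnr_eq)

text \<open>Left and right letters interfere only where both ascend from x but not jointly; then
  \<open>left_right_ascent_eq\<close> gives s_i x = x s_j, and both sides are this element.\<close>

lemma up_upr_commute:
  assumes "x \<in> W" "i \<le> k" "j \<le> k"
  shows "up i (upr j x) = upr j (up i x)"
proof -
  have eq: "s i \<cdot> x = x \<cdot> s j"
    if "ln x < ln (s i \<cdot> x)" "ln x < ln (x \<cdot> s j)" "\<not> ln (s i \<cdot> x) < ln (s i \<cdot> x \<cdot> s j)"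
    using that assms ln_mul_s[of j "s i \<cdot> x"] by (intro left_right_ascent_eq) auto
  have a: "s i \<cdot> (x \<cdot> s j) = s i \<cdot> x \<cdot> s j" using assms by (simp add: m_assoc)
  have l: "ln (s i \<cdot> x) = ln x + 1 \<or> ln x = ln (s i \<cdot> x) + 1"
    "ln (x \<cdot> s j) = ln x + 1 \<or> ln x = ln (x \<cdot> s j) + 1"
    "ln (s i \<cdot> x \<cdot> s j) = ln (s i \<cdot> x) + 1 \<or> ln (s i \<cdot> x) = ln (s i \<cdot> x \<cdot> s j) + 1"
    "ln (s i \<cdot> x \<cdot> s j) = ln (x \<cdot> s j) + 1 \<or> ln (x \<cdot> s j) = ln (s i \<cdot> x \<cdot> s j) + 1"
    using assms ln_s_mul[of i x] ln_mul_s[of j x] ln_mul_s[of j "s i \<cdot> x"] ln_s_mul[of i "x \<cdot> s j"] a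
    by simp_all
  have W: "s i \<cdot> x \<in> W" "x \<cdot> s j \<in> W" using assms by simp_all
  note defs = up_eq[OF assms(2,1)] up_eq[OF assms(2) W(2)] upr_def[of j x] upr_def[of j "s i \<cdot> x"] a
  consider (equal) "ln x < ln (s i \<cdot> x)" "ln x < ln (x \<cdot> s j)" "s i \<cdot> x = x \<cdot> s j"
    | (both) "ln x < ln (s i \<cdot> x)" "ln x < ln (x \<cdot> s j)" "ln (s i \<cdot> x) < ln (s i \<cdot> x \<cdot> s j)"
    | (right) "\<not> ln x < ln (s i \<cdot> x)" "ln x < ln (x \<cdot> s j)"
    | (left) "ln x < ln (s i \<cdot> x)" "\<not> ln x < ln (x \<cdot> s j)"
    | (none) "\<not> ln x < ln (s i \<cdot> x)" "\<not> ln x < ln (x \<cdot> s j)"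
    using eq by blast
  then show ?thesis
  proof cases
    case equal
    have "s i \<cdot> x \<cdot> s j = x" using equal(3) assms by simp
    then have "upr j (s i \<cdot> x) = s i \<cdot> x" using equal(1) by (simp add: upr_def)
    moreover have "up i (s i \<cdot> x) = s i \<cdot> x" using equal(1) assms by (simp add: up_eq)
    moreover have "up i x = s i \<cdot> x" using equal(1) assms by (simp add: up_eq)
    moreover have "upr j x = s i \<cdot> x" using equal(2) by (simp add: upr_def flip: equal(3))
    ultimately show ?thesis by simp
  next
    case both
    then have "ln (x \<cdot> s j) < ln (s i \<cdot> x \<cdot> s j)" using l by linarith
    then show ?thesis using both by (simp add: defs)
  next
    case right
    then have "\<not> ln (x \<cdot> s j) < ln (s i \<cdot> x \<cdot> s j)" using l by linarith
    then show ?thesis using right by (simp add: defs)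
  next
    case left
    then have "\<not> ln (s i \<cdot> x) < ln (s i \<cdot> x \<cdot> s j)" using l by linarith
    then show ?thesis using left by (simp add: defs)
  qed (simp add: defs)
qed

section \<open>Demazure products along words\<close>

abbreviation upw :: "nat list \<Rightarrow> nat list set \<Rightarrow> nat list set" where
  "upw u x \<equiv> foldr up u x"

lemma upw_closed [simp]: "u \<in> words \<Longrightarrow> x \<in> W \<Longrightarrow> upw u x \<in> W"
  by (induction u) auto

lemma upw_filter_sle:
  "u \<in> words \<Longrightarrow> x \<in> W \<Longrightarrow> upw (filter P u) x \<preceq> upw u x"
proof (induction u)
  case (Cons i u)
  then have 1: "i \<le> k" "u \<in> words" "upw (filter P u) x \<preceq> upw u x" by auto
  have fw: "filter P u \<in> words" using 1 by (auto simp: in_lists_conv_set)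
  have "upw u x \<preceq> up i (upw u x)" using 1 Cons by (intro sle_up) auto
  then show ?case using 1 fw Cons.prems by (auto intro: up_mono sle_trans)
qed simp

lemma upw_reduced: "u \<in> words \<Longrightarrow> ln (cl u) = length u \<Longrightarrow> upw u \<epsilon> = cl u"
proof (induction u)
  case (Cons i u)
  then have 1: "i \<le> k" "u \<in> words" by auto
  then have "ln (cl u) = length u"
    using Cons.prems ln_cl_le[of u] ln_s_mul[of i "cl u"] by (auto simp: cl_Cons)
  then show ?case using Cons 1 by (simp add: up_eq cl_Cons)
qed (simp add: cl_Nil)

lemma ln_prefix: "u @ v \<in> words \<Longrightarrow> ln (cl (u @ v)) = length (u @ v) \<Longrightarrow> ln (cl u) = length u"
  using ln_mul_le[of "cl u" "cl v"] ln_cl_le[of u] ln_cl_le[of v] by (simp add: cl_append)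

text \<open>Since the two actions commute, v can be built up on the right after u has acted on the
  unit. The word u then matters only through \<open>upw u \<epsilon>\<close>.\<close>

lemma upw_right:
  assumes "v \<in> words" "ln (cl v) = length v" "u \<in> words"
  shows "upw u (cl v) = fold upr v (upw u \<epsilon>)"
  using assms(1,2)
proof (induction v rule: rev_induct)
  case (snoc j v)
  then have 1: "j \<le> k" "v \<in> words" by auto
  have 2: "ln (cl v) = length v" using snoc.prems ln_prefix by blast
  then have "cl (v @ [j]) = upr j (cl v)"
    using snoc.prems by (simp add: upr_def cl_append cl_Cons cl_Nil 1)
  moreover have "upw u (upr j y) = upr j (upw u y)" if "y \<in> W" for y
    using assms(3) that 1 by (induction u) (auto simp: up_upr_commute)
  ultimately show ?case using snoc.IH 1 2 by simp
qed (simp add: cl_Nil)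

text \<open>Moving \<open>w\<close> to the other side: \<open>z\<close> is obtained from \<open>x\<close> by right multiplications
  downwards along the inverse of \<open>w\<close>, and does not depend on \<open>u\<close>.\<close>

lemma sle_upw_residual:
  assumes "x \<in> W" "w \<in> W"
  shows "\<exists>z\<in>W. \<forall>u\<in>words. x \<preceq> upw u w \<longleftrightarrow> z \<preceq> upw u \<epsilon>"
proof -
  obtain v where v: "v \<in> words" "w = cl v" "length v = ln w" using reducedE[OF assms(2)] .
  have fc: "fold upr v y \<in> W" if "v \<in> words" "y \<in> W" for y v
    using that by (induction v arbitrary: y) auto
  \<comment> \<open>The right-hand adjunction removes the letters of v one at a time. It holds for
    every y, so the same residual serves all words u.\<close>
  have *: "foldr dnr v x \<in> W \<and> (\<forall>y\<in>W. x \<preceq> fold upr v y \<longleftrightarrow> foldr dnr v x \<preceq> y)"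
    using v(1)
  proof (induction v)
    case (Cons j v)
    then show ?case using sle_upr_iff by simp
  qed (use assms in simp)
  show ?thesis
    by (rule bexI[of _ "foldr dnr v x"]) (use * upw_right[of v] v in auto)
qed

text \<open>Independence of the reduced word chosen by \<open>demazure\<close>: two reduced words of
  one element agree on the unit by \<open>upw_reduced\<close>, hence everywhere by
  \<open>upw_right\<close>.\<close>

lemma demazure_cl:
  assumes "u \<in> words" "ln (cl u) = length u" "y \<in> W"
  shows "demazure k (cl u) y = upw u y"
proof -
  define u' where "u' = (SOME u'. reduced_word k u' (cl u))"
  have "reduced_word k u (cl u)" using assms by (simp add: reduced_word_def)
  then have u': "u' \<in> words" "cl u' = cl u" "ln (cl u') = length u'"
    unfolding u'_def by (metis (mono_tags, lifting) reduced_word_def someI)+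
  obtain v where "v \<in> words" "y = cl v" "ln (cl v) = length v" using reducedE[OF assms(3)] by metis
  then have "upw u' y = upw u y" using upw_right assms u' upw_reduced by metis
  then show ?thesis by (simp add: demazure_def u'_def)
qed

text \<open>Going down a chain of reflections from \<open>cl u\<close>, every step deletes a letter
  by strong exchange.\<close>

lemma sle_subword: "x \<preceq> cl u \<Longrightarrow> u \<in> words \<Longrightarrow> \<exists>v. subseq v u \<and> x = cl v"
proof -
  assume *: "x \<preceq> cl u" and u: "u \<in> words"
  show ?thesis
    using * unfolding strong_le_def
  proof (induction rule: converse_rtranclp_induct)
    case (step x y)
    then obtain v t where v: "subseq v u" "y = cl v" and t: "t \<in> reflections k" "y = t \<cdot> x"
      and x: "x \<in> W" "ln x < ln y" by blast
    have vw: "v \<in> words" using u list_emb_set[OF v(1)] by (fastforce simp: in_lists_conv_set)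
    have "t \<cdot> cl v = x" using t x by (simp flip: v(2))
    then obtain a c b where "v = a @ c # b" "x = cl (a @ b)"
      using strong_exchange[OF t(1) vw] x v by auto
    moreover have "subseq (a @ b) (a @ c # b)" by (intro list_emb_append_mono) auto
    ultimately show ?case using v(1) subseq_order.trans by metis
  qed auto
qed

lemma finite_sle: "w \<in> W \<Longrightarrow> finite {x. x \<preceq> w}"
proof -
  assume "w \<in> W"
  then obtain u where "u \<in> words" "w = cl u" using word_exists by metis
  then have "{x. x \<preceq> w} \<subseteq> cl ` set (subseqs u)" using sle_subword by fastforce
  then show ?thesis by (rule finite_subset) simp
qed

section \<open>Affine Grassmannian elements as integer sequences\<close>

lemma ln_s_le: "i \<le> k \<Longrightarrow> x \<in> W \<Longrightarrow> ln (s i \<cdot> x) \<le> ln x + 1"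
  using ln_s_mul[of i x] by linarith

lemma Wgr_iff: "w \<in> Wgr k \<longleftrightarrow> w \<in> W \<and> (\<forall>j\<in>{1..k}. ln w < ln (w \<cdot> s j))"
  by (auto simp: Wgr_def strong_less_s_iff')

lemma Wgr_closed: "w \<in> Wgr k \<Longrightarrow> w \<in> W"
  by (simp add: Wgr_iff)

lemma unit_Wgr: "\<epsilon> \<in> Wgr k"
  by (auto simp: Wgr_iff ln_s)

lemma Wgr_mul_s: "w \<in> Wgr k \<Longrightarrow> j \<in> {1..k} \<Longrightarrow> w \<cdot> s j \<notin> Wgr k"
proof
  assume *: "w \<in> Wgr k" "j \<in> {1..k}" "w \<cdot> s j \<in> Wgr k"
  then have "ln w < ln (w \<cdot> s j)" "ln (w \<cdot> s j) < ln (w \<cdot> s j \<cdot> s j)" unfolding Wgr_iff by blast+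
  moreover have "w \<cdot> s j \<cdot> s j = w" using * Wgr_closed by simp
  ultimately show False by simp
qed

lemma Wgr_descent:
  assumes "w \<in> Wgr k" "i \<le> k" "ln (s i \<cdot> w) < ln w"
  shows "s i \<cdot> w \<in> Wgr k"
proof -
  have w: "w \<in> W" using assms Wgr_closed by simp
  have "ln (s i \<cdot> w) < ln (s i \<cdot> w \<cdot> s j)" if j: "j \<in> {1..k}" for j
  proof (rule ccontr)
    assume n: "\<not> ?thesis"
    have jk: "j \<le> k" using j by simp
    have "ln w < ln (w \<cdot> s j)" using assms(1) j by (simp add: Wgr_iff)
    moreover have "w \<cdot> s j = s i \<cdot> (s i \<cdot> w \<cdot> s j)" using w assms(2) jk by (simp add: m_assoc)
    then have "ln (w \<cdot> s j) \<le> ln (s i \<cdot> w \<cdot> s j) + 1"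
      using ln_s_mul[of i "s i \<cdot> w \<cdot> s j"] w assms(2) jk by auto
    moreover have "ln (s i \<cdot> w \<cdot> s j) + 1 = ln (s i \<cdot> w)"
      using n ln_mul_s[of j "s i \<cdot> w"] w assms(2) jk by auto
    ultimately show False using assms(3) by simp
  qed
  then show ?thesis using w assms(2) by (simp add: Wgr_iff)
qed

text \<open>A left ascent loses the Grassmannian property only by acquiring a right descent
  \<open>s j\<close>, and then \<open>left_right_ascent_eq\<close> applies: the coset is
  unchanged.\<close>

lemma Wgr_ascent:
  assumes "w \<in> Wgr k" "i \<le> k" "ln w < ln (s i \<cdot> w)" "s i \<cdot> w \<notin> Wgr k"
  shows "\<exists>j\<in>{1..k}. s i \<cdot> w = w \<cdot> s j"
proof -
  have w: "w \<in> W" using assms Wgr_closed by simp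
  obtain j where j: "j \<in> {1..k}" "\<not> ln (s i \<cdot> w) < ln (s i \<cdot> w \<cdot> s j)"
    using assms w by (auto simp: Wgr_iff)
  have jk: "j \<le> k" using j by simp
  have "s i \<cdot> w = w \<cdot> s j"
    using assms w j jk ln_mul_s[of j "s i \<cdot> w"]
    by (intro left_right_ascent_eq) (auto simp: Wgr_iff)
  then show ?thesis using j by blast
qed

lemma descent_exists:
  assumes "w \<in> W" "w \<noteq> \<epsilon>" shows "\<exists>i\<le>k. ln (s i \<cdot> w) < ln w"
proof -
  obtain u where u: "u \<in> words" "w = cl u" "length u = ln w" using reducedE[OF assms(1)] .
  then obtain i v where iv: "u = i # v" using assms by (cases u) (auto simp: cl_Nil)
  then have "s i \<cdot> w = cl v" "ln (cl v) \<le> length v" using u ln_cl_le by (auto simp: cl_Cons)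
  then show ?thesis using u iv by (intro exI[of _ i]) auto
qed

section \<open>Affine transpositions of the integers\<close>

abbreviation n :: int where "n \<equiv> int k + 1"

text \<open>The index ranges over all integers, and \<open>S\<close> likewise, so that neighbouring
  positions p and p + 1 need no reduction modulo n.\<close>

definition sg :: "int \<Rightarrow> int \<Rightarrow> int" where
  "sg i p = (if n dvd p - i then p + 1 else if n dvd p - i - 1 then p - 1 else p)"

abbreviation S :: "int \<Rightarrow> nat list set" where "S p \<equiv> s (nat (p mod n))"

lemma mod_le [simp]: "nat (p mod n) \<le> k"
proof -
  have "p mod n < n" by (rule pos_mod_bound) simp
  then show ?thesis by simp
qed

lemma n_dvd_small: "n dvd d \<Longrightarrow> \<bar>d\<bar> < n \<Longrightarrow> d = 0"
  using zdvd_imp_le[of n "\<bar>d\<bar>"] by auto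

lemma n_dvd_1: "\<not> n dvd 1" "\<not> n dvd -1"
  using n_dvd_small[of 1] n_dvd_small[of "-1"] k_pos by auto

lemma sg_cases:
  "n dvd p - i \<Longrightarrow> sg i p = p + 1"
  "n dvd p - i - 1 \<Longrightarrow> sg i p = p - 1"
  "\<not> n dvd p - i \<Longrightarrow> \<not> n dvd p - i - 1 \<Longrightarrow> sg i p = p"
proof -
  show "n dvd p - i - 1 \<Longrightarrow> sg i p = p - 1"
    using dvd_diff[of n "p - i" "p - i - 1"] n_dvd_1 by (auto simp: sg_def)
qed (simp_all add: sg_def)

lemma sg_period: "sg i (p + n * m) = sg i p + n * m"
proof -
  have "n dvd p + n * m - i \<longleftrightarrow> n dvd p - i" "n dvd p + n * m - i - 1 \<longleftrightarrow> n dvd p - i - 1"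
    by (metis add_diff_eq diff_add_eq dvd_add_left_iff dvd_triv_left diff_diff_eq2 add.commute)+
  then show ?thesis by (simp add: sg_def)
qed

lemma sg_cong: "n dvd i - j \<Longrightarrow> sg i = sg j"
proof -
  assume d: "n dvd i - j"
  have "n dvd p - i \<longleftrightarrow> n dvd p - j" for p
    using dvd_add_left_iff[OF d, of "p - i"] by simp
  then have "n dvd p - i \<longleftrightarrow> n dvd p - j" "n dvd p - i - 1 \<longleftrightarrow> n dvd p - j - 1" for p
    by (metis diff_diff_eq diff_diff_add add.commute)+
  then show ?thesis by (auto simp: sg_def fun_eq_iff)
qed

lemma sg_mod: "sg (p mod n) = sg p"
  by (rule sg_cong) (simp add: mod_eq_dvd_iff[symmetric])

lemma S_cong: "n dvd i - j \<Longrightarrow> S i = S j"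
  by (simp add: mod_eq_dvd_iff[symmetric])

lemma S_nat: "i \<le> k \<Longrightarrow> S (int i) = s i"
  by simp

lemma sg_sg: "sg i (sg i p) = p"
proof -
  consider "n dvd p - i" | "n dvd p - i - 1" | "\<not> n dvd p - i" "\<not> n dvd p - i - 1" by blast
  then show ?thesis
  proof cases
    case 1
    then have "sg i (p + 1) = p" by (subst sg_cases(2)) simp_all
    then show ?thesis using 1 by (simp add: sg_cases)
  next
    case 2
    then have "sg i (p - 1) = p" by (subst sg_cases(1)) (simp_all add: algebra_simps)
    then show ?thesis using 2 by (simp add: sg_cases)
  qed (simp add: sg_cases)
qed

lemma sg_braid:
  assumes "k \<ge> 2"
  shows "sg i (sg (i + 1) (sg i p)) = sg (i + 1) (sg i (sg (i + 1) p))"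
proof -
  have s: "sg i p = sg 0 (p - i) + i" "sg (i + 1) p = sg 1 (p - i) + i" for p
    by (auto simp: sg_def diff_diff_add)
  have "n \<ge> 3" using assms by simp
  then have nd: "\<not> n dvd 1" "\<not> n dvd -1" "\<not> n dvd 2" "\<not> n dvd -2"
    using n_dvd_small[of 1] n_dvd_small[of "-1"] n_dvd_small[of 2] n_dvd_small[of "-2"] by auto
  have sh: "n dvd q + c \<longleftrightarrow> n dvd c" "n dvd q - c \<longleftrightarrow> n dvd c" if "n dvd q" for q c
    using that by (simp_all add: dvd_add_right_iff dvd_diff_right_iff)
  have "sg 0 (sg 1 (sg 0 q)) = sg 1 (sg 0 (sg 1 q))" for q
  proof -
    consider "n dvd q" | "n dvd q - 1" | "n dvd q - 2" | "\<not> n dvd q" "\<not> n dvd q - 1" "\<not> n dvd q - 2"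
      by blast
    then show ?thesis
    proof cases
      case 1
      then show ?thesis
        using nd sh[OF 1, of 1] sh[OF 1, of 2] sh[OF 1, of "-1"] by (simp add: sg_def add.commute)
    next
      case 2
      have "q = (q - 1) + 1" "q + 1 = (q - 1) + 2" "q - 2 = (q - 1) - 1" "q - 3 = (q - 1) - 2"
        by simp_all
      then have "\<not> n dvd q" "\<not> n dvd q + 1" "\<not> n dvd q - 2" "\<not> n dvd q - 3"
        using nd sh[OF 2] by metis+
      then show ?thesis using 2 by (simp add: sg_def)
    next
      case 3
      have "q = (q - 2) + 2" "q - 1 = (q - 2) + 1" "q - 3 = (q - 2) - 1" "q - 4 = (q - 2) - 2"
        by simp_all
      then have "\<not> n dvd q" "\<not> n dvd q - 1" "\<not> n dvd q - 3" "\<not> n dvd q - 4"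
        using nd sh[OF 3] by metis+
      then show ?thesis using 3 by (simp add: sg_def)
    qed (simp add: sg_def)
  qed
  then show ?thesis by (simp add: s)
qed

lemma sg_comm:
  assumes "\<not> n dvd i - j" "\<not> n dvd i - j - 1" "\<not> n dvd i - j + 1"
  shows "sg i (sg j p) = sg j (sg i p)"
proof -
  have dd: "n dvd a - b" if "n dvd a" "n dvd b" for a b :: int using that by (rule dvd_diff)

  consider "n dvd p - i" | "n dvd p - i - 1" | "n dvd p - j" | "n dvd p - j - 1"
    | "\<not> n dvd p - i" "\<not> n dvd p - i - 1" "\<not> n dvd p - j" "\<not> n dvd p - j - 1" by blast
  then show ?thesis
  proof cases
    case 1
    then have "\<not> n dvd p - j" "\<not> n dvd p - j - 1" "\<not> n dvd p + 1 - j" "\<not> n dvd p + 1 - j - 1"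
      using assms dd[of "p - j" "p - i"] dd[of "p - j - 1" "p - i"] dd[of "p + 1 - j" "p - i"]
        dd[of "p + 1 - j - 1" "p - i"] by (auto simp: algebra_simps)
    then show ?thesis using 1 by (simp add: sg_cases)
  next
    case 2
    then have "\<not> n dvd p - j" "\<not> n dvd p - j - 1" "\<not> n dvd p - 1 - j" "\<not> n dvd p - 1 - j - 1"
      using assms dd[of "p - j" "p - i - 1"] dd[of "p - j - 1" "p - i - 1"] dd[of "p - 1 - j" "p - i - 1"]
        dd[of "p - 1 - j - 1" "p - i - 1"] by (auto simp: algebra_simps)
    then show ?thesis using 2 by (simp add: sg_cases)
  next
    case 3
    then have "\<not> n dvd p - i" "\<not> n dvd p - i - 1" "\<not> n dvd p + 1 - i" "\<not> n dvd p + 1 - i - 1"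
      using assms dd[of "p - j" "p - i"] dd[of "p - j" "p - i - 1"] dd[of "p - j" "p + 1 - i"]
        dd[of "p - j" "p + 1 - i - 1"] by (auto simp: algebra_simps)
    then show ?thesis using 3 by (simp add: sg_cases)
  next
    case 4
    then have "\<not> n dvd p - i" "\<not> n dvd p - i - 1" "\<not> n dvd p - 1 - i" "\<not> n dvd p - 1 - i - 1"
      using assms dd[of "p - j - 1" "p - i"] dd[of "p - j - 1" "p - i - 1"] dd[of "p - j - 1" "p - 1 - i"]
        dd[of "p - j - 1" "p - 1 - i - 1"] by (auto simp: algebra_simps)
    then show ?thesis using 4 by (simp add: sg_cases)
  qed (simp add: sg_cases)
qed

lemma int_succ_mod: "int ((nat (p mod n) + 1) mod (k + 1)) = (p + 1) mod n"
proof -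
  have "int ((nat (p mod n) + 1) mod (k + 1)) = (p mod n + 1) mod n" by (simp add: zmod_int ac_simps)
  then show ?thesis by (simp add: mod_add_left_eq)
qed

lemma S_braid:
  assumes "k \<ge> 2" shows "S p \<cdot> (S (p + 1) \<cdot> S p) = S (p + 1) \<cdot> (S p \<cdot> S (p + 1))"
proof (rule s_braid)
  show "nat ((p + 1) mod n) = (nat (p mod n) + 1) mod (k + 1)"
    by (metis int_succ_mod nat_int)
qed (use assms in simp_all)

lemma nat_mod_succ: "nat (q mod n) = (nat (p mod n) + 1) mod (k + 1) \<longleftrightarrow> n dvd q - p - 1"
proof -
  have "nat (q mod n) = (nat (p mod n) + 1) mod (k + 1) \<longleftrightarrow> q mod n = (p + 1) mod n"
    by (metis int_succ_mod nat_int int_nat_eq pos_mod_sign zero_less_one add_nonneg_pos of_nat_0_le_iff)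
  then show ?thesis by (simp add: mod_eq_dvd_iff algebra_simps)
qed

lemma S_comm:
  assumes "\<not> n dvd q - p - 1" "\<not> n dvd p - q - 1"
  shows "S p \<cdot> S q = S q \<cdot> S p"
  using assms by (intro s_comm) (simp_all only: nat_mod_succ mod_le simp_thms)

text \<open>f is composed with the inverse of the affine permutation of u. This is a left action, in
  which a new first letter exchanges neighbouring entries. The value type is left open because the
  action is used on integer sequences and on predicates.\<close>

definition act_word :: "nat list \<Rightarrow> (int \<Rightarrow> 'b) \<Rightarrow> int \<Rightarrow> 'b" where
  "act_word u f = foldr (\<lambda>i f. f \<circ> sg (int i)) u f"

lemma act_word_simps [simp]:
  "act_word [] f = f" "act_word (i # u) f = act_word u f \<circ> sg (int i)"
  by (simp_all add: act_word_def)

lemma act_word_append: "act_word (u @ v) f = act_word u (act_word v f)"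
  by (simp add: act_word_def)

lemma act_word_cong: "cox_eq k u v \<Longrightarrow> act_word u f = act_word v f"
proof (induction rule: cox_eq.induct)
  case (square i u v)
  show ?case by (simp add: act_word_append fun_eq_iff sg_sg comp_def)
next
  case (braid i j u v)
  have "sg (int j) = sg (int i + 1)"
    using braid by (intro sg_cong) (simp add: zmod_int mod_eq_dvd_iff[symmetric] add.commute)
  then show ?case using sg_braid[of "int i"] braid
    by (simp add: act_word_append comp_def)
next
  case (comm i j u v)
  have "nat (int i mod n) = i" "nat (int j mod n) = j" using comm by simp_all
  then have "\<not> n dvd int j - int i - 1" "\<not> n dvd int i - int j - 1"
    using comm(4,5) nat_mod_succ[of "int j" "int i"] nat_mod_succ[of "int i" "int j"] by simp_all
  moreover have "\<bar>int i - int j\<bar> < n" using comm(1,2) by linarith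
  then have "\<not> n dvd int i - int j" using comm(3) n_dvd_small[of "int i - int j"] by auto
  moreover have "n dvd int i - int j + 1 \<longleftrightarrow> n dvd int j - int i - 1"
    using dvd_minus_iff[of n "int j - int i - 1"] by (simp add: algebra_simps)
  ultimately have "sg (int i) (sg (int j) p) = sg (int j) (sg (int i) p)" for p
    by (intro sg_comm) simp_all
  then show ?case by (simp add: act_word_append comp_def)
qed simp_all

lemma act_word_cl: "cl u = cl v \<Longrightarrow> act_word u f = act_word v f"
  by (simp add: wcls_eq_iff act_word_cong)

text \<open>The coset \<open>x W\<^sub>0\<close>, \<open>W\<^sub>0 = \<langle>s\<^sub>1, \<dots>, s\<^sub>k\<rangle>\<close>, is recorded as a quasi-periodic integer sequence.\<close>

definition al0 :: "int \<Rightarrow> int" where "al0 p = - ((p - 1) div n)"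

text \<open>\<open>al x p\<close> is minus the number m of the window mn + 1, ..., mn + n that
  contains the preimage of p under the affine permutation x.\<close>

definition al :: "nat list set \<Rightarrow> int \<Rightarrow> int" where
  "al x = act_word (SOME u. x = cl u) al0"

lemma al_cl: "al (cl u) = act_word u al0"
proof -
  have "cl u = cl (SOME v. cl u = cl v)" by (rule someI[of "\<lambda>v. cl u = cl v" u]) simp
  then show ?thesis unfolding al_def using act_word_cl by metis
qed

lemma al_unit: "al \<epsilon> = al0"
  using al_cl[of "[]"] by (simp add: cl_Nil)

lemma al_S: "x \<in> W \<Longrightarrow> al (S p \<cdot> x) = al x \<circ> sg p"
proof -
  assume "x \<in> W"
  then obtain u where "x = cl u" using word_exists by metis
  then show ?thesis using al_cl[of "nat (p mod n) # u"] by (simp add: al_cl cl_Cons sg_mod)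
qed

lemma al_period:
  assumes "x \<in> W" shows "al x (p + n * m) = al x p - m"
proof -
  obtain u where "x = cl u" using word_exists assms by metis
  moreover have "act_word u al0 (p + n * m) = act_word u al0 p - m"
  proof (induction u arbitrary: p)
    case Nil
    have "p + n * m - 1 = (p - 1) + n * m" by simp
    moreover have "((p - 1) + n * m) div n = m + (p - 1) div n" by (rule div_mult_self2) simp
    ultimately show ?case by (simp only: act_word_simps al0_def)
  qed (simp add: sg_period)
  ultimately show ?thesis by (simp add: al_cl)
qed

lemma al_period1: "x \<in> W \<Longrightarrow> al x (p + n) = al x p - 1"
  using al_period[of x p 1] by simp

text \<open>For 1 \<le> j \<le> k the letter j exchanges two entries of \<open>al0\<close> within
  one window, on which \<open>al0\<close> is constant.\<close>

lemma al_mul_s: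
  assumes "x \<in> W" "j \<in> {1..k}" shows "al (x \<cdot> s j) = al x"
proof -
  obtain u where u: "x = cl u" using word_exists assms by metis
  have "al0 (sg (int j) p) = al0 p" for p
  proof -
    have eq: "q div n = (q - 1) div n" if "n dvd q - int j" for q
    proof -
      obtain m where "q = int j + n * m" using \<open>n dvd q - int j\<close> by (metis dvd_def add.commute diff_add_cancel)
      moreover from this have "q - 1 = (int j - 1) + n * m" by simp
      moreover have "(int j + n * m) div n = m + int j div n" "(int j - 1 + n * m) div n = m + (int j - 1) div n"
        by (rule div_mult_self2, simp)+
      moreover have "int j div n = 0" "(int j - 1) div n = 0"
        using assms(2) by (simp_all add: div_pos_pos_trivial)
      ultimately show ?thesis by (simp only:)
    qed
    show ?thesis using eq[of p] eq[of "p - 1"]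
      by (auto simp: sg_def al0_def algebra_simps)
  qed
  then have "al0 \<circ> sg (int j) = al0" by auto
  then show ?thesis using al_cl[of "u @ [j]"] u
    by (simp add: cl_append al_cl act_word_append gen_def)
qed

lemma Wgr_cases:
  assumes "w \<in> Wgr k"
  shows "ln (S p \<cdot> w) < ln w \<or> (ln w < ln (S p \<cdot> w) \<and> S p \<cdot> w \<in> Wgr k) \<or>
      (\<exists>j\<in>{1..k}. S p \<cdot> w = w \<cdot> s j)"
  using Wgr_closed[OF assms] Wgr_ascent[OF assms, of "nat (p mod n)"] ln_s_mul[of "nat (p mod n)" w]
  by fastforce

text \<open>Induction on the length; for shorter elements the three cases exclude each other, so
  \<open>down\<close> and \<open>fix'\<close> read them backwards. The substance is
  \<open>U\<close>. If the entries were in the wrong order at a Grassmannian ascent p, take a left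
  descent q of w: the commutation or braid relation of p and q then shows that s_p w is not longer
  than w, or that it is some w s_j.\<close>

lemma al_trichotomy:
  assumes "w \<in> Wgr k"
  shows "(ln (S p \<cdot> w) < ln w \<longrightarrow> al w p < al w (p + 1)) \<and>
    (ln w < ln (S p \<cdot> w) \<and> S p \<cdot> w \<in> Wgr k \<longrightarrow> al w p > al w (p + 1)) \<and>
    ((\<exists>j\<in>{1..k}. S p \<cdot> w = w \<cdot> s j) \<longrightarrow> al w p = al w (p + 1))"
  using assms
proof (induction "ln w" arbitrary: w p rule: less_induct)
  case less
  note wg = \<open>w \<in> Wgr k\<close>
  have wW: "w \<in> W" using wg Wgr_closed by simp
  note cases = Wgr_cases
  have down: "ln (S p \<cdot> w') < ln w'" if "w' \<in> Wgr k" "ln w' < ln w" "al w' p < al w' (p + 1)" for w' p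
    using cases[OF that(1), of p] less(1)[OF that(2,1), of p] that(3) by auto
  have fix': "\<exists>j\<in>{1..k}. S p \<cdot> w' = w' \<cdot> s j"
    if "w' \<in> Wgr k" "ln w' < ln w" "al w' p = al w' (p + 1)" for w' p
    using cases[OF that(1), of p] less(1)[OF that(2,1), of p] that(3) by auto
  have F: "al w p = al w (p + 1)" if "\<exists>j\<in>{1..k}. S p \<cdot> w = w \<cdot> s j" for p
  proof -
    have "al (S p \<cdot> w) = al w" using that al_mul_s wW by auto
    then have "al w (sg p p) = al w p" using al_S[OF wW, of p] by (metis comp_apply)
    then show ?thesis by (simp add: sg_def)
  qed
  have D: "al w p < al w (p + 1)" if d: "ln (S p \<cdot> w) < ln w" for p
  proof -
    have g: "S p \<cdot> w \<in> Wgr k" using Wgr_descent wg d by simp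
    have "S p \<cdot> (S p \<cdot> w) = w" using wW by simp
    then have "al (S p \<cdot> w) p > al (S p \<cdot> w) (p + 1)" using less(1)[OF d g, of p] d wg by simp
    then show ?thesis by (simp add: al_S[OF wW] sg_cases)
  qed
  have U: "al w p > al w (p + 1)" if u: "ln w < ln (S p \<cdot> w)" "S p \<cdot> w \<in> Wgr k" for p
  proof (cases "w = \<epsilon>")
    case True
    have "n dvd p"
    proof (rule ccontr)
      assume "\<not> n dvd p"
      then have "p mod n > 0" using pos_mod_sign[of n p] by (auto simp: dvd_eq_mod_eq_0 less_le)
      then have "nat (p mod n) \<in> {1..k}" using mod_le[of p] by simp
      then have "\<epsilon> \<cdot> S p \<notin> Wgr k" using Wgr_mul_s[OF unit_Wgr] by blast
      then show False using u True by simp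
    qed
    then obtain m where m: "p = n * m" by blast
    have "p - 1 = (n - 1) + n * (m - 1)" by (simp add: m algebra_simps)
    then have "(p - 1) div n = m - 1" by (simp add: div_pos_pos_trivial del: add_diff_cancel_right')
    then show ?thesis using True m by (simp add: al_unit al0_def)
  next
    case False
    show ?thesis
    proof (rule ccontr)
      assume "\<not> ?thesis"
      then have le: "al w p \<le> al w (p + 1)" by simp
      obtain i where i: "i \<le> k" "ln (s i \<cdot> w) < ln w" using descent_exists[OF wW False] by blast
      define q where "q = int i"
      have q: "ln (S q \<cdot> w) < ln w" using i by (simp add: q_def)
      define w' where "w' = S q \<cdot> w"
      have nofix: "\<not> (\<exists>j\<in>{1..k}. S p \<cdot> w = w \<cdot> s j)" using Wgr_mul_s[OF wg] u by auto
      \<comment> \<open>\<open>?w2\<close> lies two descents below w, and s_p w = s_q s_p s_q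
        \<open>?w2\<close> by the braid relation. If s_q lowers \<open>?w2\<close>, then s_p w is
        not longer than w; if it preserves the coset of \<open>?w2\<close>, then s_p w = w s_j is
        not Grassmannian.\<close>
      have braid_case: False
        if q: "ln (S q \<cdot> w) < ln w"
          and br: "S p \<cdot> (S q \<cdot> S p) = S q \<cdot> (S p \<cdot> S q)"
          and a1: "al (S q \<cdot> w) p < al (S q \<cdot> w) (p + 1)"
          and a2: "al (S p \<cdot> (S q \<cdot> w)) q \<le> al (S p \<cdot> (S q \<cdot> w)) (q + 1)" for q
      proof -
        let ?w1 = "S q \<cdot> w" and ?w2 = "S p \<cdot> (S q \<cdot> w)"
        have g1: "?w1 \<in> Wgr k" using Wgr_descent wg q by simp
        have d1: "ln ?w2 < ln ?w1" using down[OF g1 q a1] .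
        have g2: "?w2 \<in> Wgr k" using Wgr_descent g1 d1 by simp
        have d2: "ln ?w2 < ln w" using d1 q by simp
        have br': "S p \<cdot> (S q \<cdot> (S p \<cdot> x)) = S q \<cdot> (S p \<cdot> (S q \<cdot> x))" if "x \<in> W" for x
          using br that by (simp flip: m_assoc)
        have pw: "S p \<cdot> w = S q \<cdot> (S p \<cdot> (S q \<cdot> ?w2))" using br'[of ?w2] wW by simp
        show False
        proof (cases "al ?w2 q < al ?w2 (q + 1)")
          case True
          have "ln (S q \<cdot> ?w2) < ln ?w2" using down[OF g2 d2 True] .
          moreover have "ln (S q \<cdot> (S p \<cdot> (S q \<cdot> ?w2))) \<le> ln (S p \<cdot> (S q \<cdot> ?w2)) + 1"
            "ln (S p \<cdot> (S q \<cdot> ?w2)) \<le> ln (S q \<cdot> ?w2) + 1"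
            using wW by (intro ln_s_le; simp)+
          moreover have "ln (S p \<cdot> w) = ln (S q \<cdot> (S p \<cdot> (S q \<cdot> ?w2)))" using pw by (rule arg_cong)
          ultimately have "ln (S p \<cdot> w) \<le> ln w" using d1 q by linarith
          then show False using u by simp
        next
          case False
          then obtain j where j: "j \<in> {1..k}" "S q \<cdot> ?w2 = ?w2 \<cdot> s j" using fix'[OF g2 d2] a2 by force
          have "S p \<cdot> w = w \<cdot> s j" unfolding pw j(2) using wW j(1) by (simp add: m_assoc)
          then show False using nofix j by blast
        qed
      qed
      consider "n dvd q - p - 1" | "n dvd q - p" | "k \<ge> 2" "n dvd q - p + 1"
        | "\<not> n dvd q - p - 1" "\<not> n dvd q - p" "\<not> n dvd q - p + 1"
      proof (cases "k \<ge> 2")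
        case True then show ?thesis using that by blast
      next
        case False
        then have "k = 1" using k_pos by simp
        then have "n dvd q - p + 1 \<Longrightarrow> n dvd q - p - 1" by presburger
        then show ?thesis using that by blast
      qed
      then show False
      proof cases
        case 1
        have q1: "ln (S (p + 1) \<cdot> w) < ln w" using S_cong[of q "p + 1"] 1 q by (simp add: algebra_simps)
        have lt: "al w (p + 1) < al w (p + 2)" using D[OF q1] by (simp add: add.assoc)
        show False
        \<comment> \<open>There is no braid relation for k = 1, but then positions p and p + 2 are
          one period apart and the two inequalities contradict each other.\<close>
        proof (cases "k = 1")
          case True
          then have "al w (p + 2) = al w p - 1" using al_period1[OF wW, of p] by simp
          then show False using lt le by simp
        next
          case False
          then have k2: "k \<ge> 2" using k_pos by simp
          then have nd: "\<not> n dvd - 2" "\<not> n dvd 2" using n_dvd_small[of "-2"] n_dvd_small[of 2] by auto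
          have v: "sg (p + 1) p = p" "sg (p + 1) (p + 1) = p + 2" "sg (p + 1) (p + 2) = p + 1"
            "sg p p = p + 1" "sg p (p + 1) = p" "sg p (p + 2) = p + 2"
            using nd n_dvd_1 by (auto simp: sg_def)
          show False
            using le lt v wW by (intro braid_case[OF q1 S_braid[OF k2]]) (auto simp: al_S add.assoc)
        qed
      next
        case 2
        then show False using S_cong[of q p] q u by simp
      next
        case 3
        have nd: "\<not> n dvd - 2" "\<not> n dvd 2" using 3 n_dvd_small[of "-2"] n_dvd_small[of 2] by auto
        have q1: "ln (S (p - 1) \<cdot> w) < ln w" using S_cong[of q "p - 1"] 3 q by (simp add: algebra_simps)
        have lt: "al w (p - 1) < al w p" using D[OF q1] by simp
        have v: "sg (p - 1) (p + 1) = p + 1" "sg (p - 1) p = p - 1" "sg (p - 1) (p - 1) = p"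
            "sg p p = p + 1" "sg p (p + 1) = p" "sg p (p - 1) = p - 1"
            using nd n_dvd_1 by (auto simp: sg_def)
        have br: "S p \<cdot> (S (p - 1) \<cdot> S p) = S (p - 1) \<cdot> (S p \<cdot> S (p - 1))"
          using S_braid[OF 3(1), of "p - 1"] by simp
        show False
          using le lt v wW by (intro braid_case[OF q1 br]) (auto simp: al_S)
      next
        case 4
        have nd: "\<not> n dvd p - q" "\<not> n dvd p - q + 1" "\<not> n dvd p - q - 1"
          using 4 dvd_minus_iff[of n "q - p"] dvd_minus_iff[of n "q - p - 1"] dvd_minus_iff[of n "q - p + 1"]
          by (simp_all add: algebra_simps)
        have cm: "S p \<cdot> S q = S q \<cdot> S p" using 4 nd by (intro S_comm) simp_all
        have g1: "S q \<cdot> w \<in> Wgr k" using Wgr_descent wg q by simp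
        have pw: "S p \<cdot> w = S q \<cdot> (S p \<cdot> (S q \<cdot> w))"
          using wW cm by (simp flip: m_assoc)
        have v: "sg q p = p" "sg q (p + 1) = p + 1"
          using nd by (auto simp: sg_def algebra_simps)
        show False
        proof (cases "al (S q \<cdot> w) p < al (S q \<cdot> w) (p + 1)")
          case True
          have "ln (S p \<cdot> (S q \<cdot> w)) < ln (S q \<cdot> w)" using down[OF g1 q True] .
          moreover have "ln (S q \<cdot> (S p \<cdot> (S q \<cdot> w))) \<le> ln (S p \<cdot> (S q \<cdot> w)) + 1"
            using wW by (intro ln_s_le; simp)
          moreover have "ln (S p \<cdot> w) = ln (S q \<cdot> (S p \<cdot> (S q \<cdot> w)))" using pw by (rule arg_cong)
          ultimately have "ln (S p \<cdot> w) \<le> ln w" using q by linarith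
          then show False using u by simp
        next
          case False
          then have "al (S q \<cdot> w) p = al (S q \<cdot> w) (p + 1)" using le v wW by (simp add: al_S)
          then obtain j where j: "j \<in> {1..k}" "S p \<cdot> (S q \<cdot> w) = S q \<cdot> w \<cdot> s j" using fix'[OF g1 q] by blast
          have "S p \<cdot> w = w \<cdot> s j" unfolding pw j(2) using wW j(1) by (simp add: m_assoc)
          then show False using nofix j by blast
        qed
      qed
    qed
  qed
  show ?case using D U F by blast
qed

lemma al_less_iff: "w \<in> Wgr k \<Longrightarrow> al w p < al w (p + 1) \<longleftrightarrow> ln (S p \<cdot> w) < ln w"
  and al_greater_iff: "w \<in> Wgr k \<Longrightarrow> al w (p + 1) < al w p \<longleftrightarrow> ln w < ln (S p \<cdot> w) \<and> S p \<cdot> w \<in> Wgr k"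
  using al_trichotomy[of w p] Wgr_cases[of w p] by linarith+

section \<open>Cyclically decreasing words\<close>

lemma cyc_decreasing_Nil: "cyc_decreasing k []"
  by (simp add: cyc_decreasing_def)

lemma cyc_decreasing_Cons:
  "cyc_decreasing k (i # u) \<longleftrightarrow> i \<notin> set u \<and> (i + 1) mod (k + 1) \<notin> set u \<and> cyc_decreasing k u"
proof -
  have "(\<forall>q<Suc m. \<forall>p<q. P p q) \<longleftrightarrow> (\<forall>q<m. P 0 (Suc q)) \<and> (\<forall>q<m. \<forall>p<q. P (Suc p) (Suc q))"
    for m and P :: "nat \<Rightarrow> nat \<Rightarrow> bool"
    by (auto simp: less_Suc_eq_0_disj)
  from this[of "length u" "\<lambda>p q. (i # u) ! q \<noteq> ((i # u) ! p + 1) mod (k + 1)"] show ?thesis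
    unfolding cyc_decreasing_def by (auto simp: in_set_conv_nth)
qed

lemma cyc_decreasing_subseq: "subseq v u \<Longrightarrow> cyc_decreasing k u \<Longrightarrow> cyc_decreasing k v"
proof (induction rule: list_emb.induct)
  case (list_emb_Cons2 x y xs ys)
  then show ?case using list_emb_set[of "(=)" xs ys] by (auto simp: cyc_decreasing_Cons)
qed (simp_all add: cyc_decreasing_Cons cyc_decreasing_Nil)

lemma cyc_decreasing_filter: "cyc_decreasing k u \<Longrightarrow> cyc_decreasing k (filter P u)"
  by (rule cyc_decreasing_subseq[OF subseq_filter_left])

lemma cyc_decreasing_distinct: "cyc_decreasing k u \<Longrightarrow> distinct u"
  by (simp add: cyc_decreasing_def)

text \<open>An index set is viewed as an n-periodic set of integers, so that its cyclic runs become
  ordinary intervals.\<close>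

definition in_res :: "nat set \<Rightarrow> int \<Rightarrow> bool" where
  "in_res A p \<longleftrightarrow> nat (p mod n) \<in> A"

lemma in_res_cong: "n dvd p - q \<Longrightarrow> in_res A p \<longleftrightarrow> in_res A q"
  by (simp add: in_res_def mod_eq_dvd_iff[symmetric])

lemma in_res_period: "in_res A (p + n) \<longleftrightarrow> in_res A p"
  by (rule in_res_cong) simp

lemma in_res_int: "i \<le> k \<Longrightarrow> in_res A (int i) \<longleftrightarrow> i \<in> A"
  by (simp add: in_res_def)

lemma in_res_insert: "i \<le> k \<Longrightarrow> in_res (insert i A) p \<longleftrightarrow> n dvd p - int i \<or> in_res A p"
proof -
  assume i: "i \<le> k"
  have "nat (p mod n) = i \<longleftrightarrow> p mod n = int i mod n"
    using i pos_mod_sign[of n p] by auto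
  then show ?thesis by (auto simp: in_res_def mod_eq_dvd_iff)
qed

lemma not_in_res_exists: "A \<subset> {..k} \<Longrightarrow> \<exists>z. 0 \<le> z \<and> z < n \<and> \<not> in_res A z"
proof -
  assume "A \<subset> {..k}"
  then obtain i where "i \<le> k" "i \<notin> A" by blast
  then show ?thesis by (intro exI[of _ "int i"]) (simp add: in_res_int)
qed

text \<open>The letters are z + m - 1, ..., z modulo n. Rows of partitions have this form, and all
  cyclically decreasing words can be cut out of such words.\<close>

fun row_word :: "int \<Rightarrow> nat \<Rightarrow> nat list" where
  "row_word z 0 = []"
| "row_word z (Suc m) = nat ((z + int m) mod n) # row_word z m"

lemma row_word_words [simp]: "row_word z m \<in> words"
  by (induction m) (simp_all del: nat_le_iff)

lemma in_res_row_word: "in_res (set (row_word z m)) p \<longleftrightarrow> (\<exists>x. z \<le> x \<and> x < z + int m \<and> n dvd p - x)"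
proof (induction m)
  case (Suc m)
  have "in_res (set (row_word z (Suc m))) p \<longleftrightarrow> n dvd p - (z + int m) \<or> in_res (set (row_word z m)) p"
    using in_res_insert[OF mod_le, of "z + int m" "set (row_word z m)" p]
    by (simp add: mod_eq_dvd_iff[symmetric])
  also have "\<dots> \<longleftrightarrow> (\<exists>x. z \<le> x \<and> x < z + int (Suc m) \<and> n dvd p - x)"
    unfolding Suc.IH by (auto simp: zless_add1_eq intro: exI[of _ "z + int m"])
      (metis add.assoc add.commute of_nat_Suc zless_add1_eq)
  finally show ?case .
qed (auto simp: in_res_def)

lemma row_word_cyc: "m \<le> k \<Longrightarrow> cyc_decreasing k (row_word z m)"
proof (induction m)
  case (Suc m)
  have not: "\<not> in_res (set (row_word z m)) y" if "z + int m \<le> y" "y \<le> z + int m + 1" for y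
  proof
    assume "in_res (set (row_word z m)) y"
    then obtain x where x: "z \<le> x" "x < z + int m" "n dvd y - x" by (auto simp: in_res_row_word)
    then have "y - x = 0" using that Suc.prems by (intro n_dvd_small) auto
    then show False using x that by simp
  qed
  have "nat ((z + int m) mod n) \<notin> set (row_word z m)" using not[of "z + int m"] by (simp add: in_res_def)
  moreover have "(nat ((z + int m) mod n) + 1) mod (k + 1) = nat ((z + int m + 1) mod n)"
    by (metis int_succ_mod nat_int)
  then have "(nat ((z + int m) mod n) + 1) mod (k + 1) \<notin> set (row_word z m)"
    using not[of "z + int m + 1"] by (simp add: in_res_def)
  ultimately show ?case using Suc by (simp add: cyc_decreasing_Cons)
qed (simp add: cyc_decreasing_Nil)

text \<open>The circle is cut at a residue z outside A. The row z + k, ..., z + 1 contains every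
  other residue, and filtering it by A keeps it cyclically decreasing.\<close>

lemma cyc_word_exists:
  assumes "A \<subset> {..k}" shows "\<exists>u. set u = A \<and> cyc_decreasing k u"
proof -
  obtain z where z: "0 \<le> z" "z < n" "\<not> in_res A z" using not_in_res_exists[OF assms] by blast
  have "i \<in> set (row_word (z + 1) k)" if "i \<in> A" for i
  proof -
    have i: "i \<le> k" using that assms by auto
    have nz: "int i \<noteq> z" using z that i by (auto simp: in_res_int)
    have "int i - (int i + n) = - n" by simp
    then have d: "n dvd int i - (int i + n)" by (simp only: dvd_minus_iff dvd_refl)
    have "in_res (set (row_word (z + 1) k)) (int i)" unfolding in_res_row_word
    proof (cases "int i > z")
      case True
      then show "\<exists>x. z + 1 \<le> x \<and> x < z + 1 + int k \<and> n dvd int i - x"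
        using i z by (intro exI[of _ "int i"]) auto
    next
      case False
      then show "\<exists>x. z + 1 \<le> x \<and> x < z + 1 + int k \<and> n dvd int i - x"
        using nz z d by (intro exI[of _ "int i + n"]) auto
    qed
    then show ?thesis using i by (simp add: in_res_int)
  qed
  then have "set (filter (\<lambda>i. i \<in> A) (row_word (z + 1) k)) = A" by auto
  then show ?thesis using cyc_decreasing_filter[OF row_word_cyc[of k]] by blast
qed

lemma cl_move_front:
  assumes "\<And>x. x \<in> set a \<Longrightarrow> s x \<cdot> s i = s i \<cdot> s x" "a \<in> words" "i \<le> k" "b \<in> words"
  shows "cl (a @ i # b) = cl (i # a @ b)"
  using assms(1,2)
proof (induction a)
  case (Cons x a)
  then have x: "x \<le> k" "a \<in> words" "s x \<cdot> s i = s i \<cdot> s x" by auto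
  have "cl ((x # a) @ i # b) = s x \<cdot> (s i \<cdot> cl (a @ b))" using Cons by (simp add: cl_Cons)
  also have "\<dots> = s i \<cdot> (s x \<cdot> cl (a @ b))" using x assms(3,4) by (simp flip: m_assoc)
  finally show ?case by (simp add: cl_Cons)
qed simp

lemma cyc_decreasing_append:
  "cyc_decreasing k (a @ i # b) \<Longrightarrow> x \<in> set a \<Longrightarrow> i \<noteq> x \<and> i \<noteq> (x + 1) mod (k + 1)"
  by (induction a) (auto simp: cyc_decreasing_Cons)

text \<open>The first letter i of u can be moved to the front of v: a letter x before it in v is not
  i - 1 because v is cyclically decreasing, and not i + 1 because x comes after i in u, so it
  commutes with i.\<close>

lemma cyc_word_unique:
  assumes "cyc_decreasing k u" "cyc_decreasing k v" "set u = set v" "u \<in> words"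
  shows "cl u = cl v"
  using assms
proof (induction u arbitrary: v)
  case (Cons i u)
  have vw: "v \<in> words" using Cons.prems by (metis in_lists_conv_set)
  obtain a b where v: "v = a @ i # b" using Cons.prems(3) by (metis list.set_intros(1) split_list)
  have iu: "i \<le> k" "u \<in> words" using Cons.prems by auto
  have ab: "a \<in> words" "b \<in> words" "cyc_decreasing k (a @ b)"
    using vw v cyc_decreasing_subseq[OF _ Cons.prems(2), of "a @ b"]
    by (auto intro: list_emb_append_mono)
  have "distinct (a @ i # b)" using Cons.prems(2) v cyc_decreasing_distinct by blast
  then have "set (a @ b) = set v - {i}" using v by auto
  moreover have "set u = set (i # u) - {i}" using Cons.prems(1) by (auto simp: cyc_decreasing_Cons)
  ultimately have su: "set u = set (a @ b)" using Cons.prems(3) by metis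
  have "s x \<cdot> s i = s i \<cdot> s x" if x: "x \<in> set a" for x
  proof (rule s_comm)
    show "x \<le> k" using x ab by (auto simp: in_lists_conv_set)
    show "i \<noteq> (x + 1) mod (k + 1)" using cyc_decreasing_append x Cons.prems(2) v by blast
    have "x \<in> set u" using su x by simp
    then show "x \<noteq> (i + 1) mod (k + 1)" using Cons.prems(1) by (auto simp: cyc_decreasing_Cons)
  qed (rule iu)
  then have "cl v = cl (i # a @ b)" using v ab iu cl_move_front by simp
  moreover have "cl u = cl (a @ b)"
    using Cons.IH[OF _ ab(3) su iu(2)] Cons.prems(1) by (simp add: cyc_decreasing_Cons)
  ultimately show ?case by (simp add: cl_Cons)
qed simp

text \<open>Words without the letter \<open>i\<close> preserve \<open>{p. p \<le> i}\<close>; a single letter \<open>i\<close> does not.\<close>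

lemma act_word_halfline:
  assumes "u \<in> words" "i \<notin> set u" "i \<le> k"
  shows "act_word u (\<lambda>p. p \<le> int i) = (\<lambda>p. p \<le> int i)"
  using assms(1,2)
proof (induction u)
  case (Cons j u)
  then have j: "j \<le> k" "j \<noteq> i" by auto
  have "\<bar>int i - int j\<bar> < n" using j assms(3) by linarith
  then have nd: "\<not> n dvd int i - int j" using j n_dvd_small[of "int i - int j"] by auto
  then have "sg (int j) p \<le> int i \<longleftrightarrow> p \<le> int i" for p
    by (cases "p = int i"; cases "p = int i + 1") (auto simp: sg_def)
  then show ?case using Cons by auto
qed simp

lemma letter_in_word:
  assumes "distinct u" "u \<in> words" "v \<in> words" "cl u = cl v"
  shows "set u \<subseteq> set v"
proof
  fix i assume "i \<in> set u"
  then obtain a b where u: "u = a @ i # b" by (metis split_list)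
  have w: "a \<in> words" "b \<in> words" "i \<le> k" "i \<notin> set a" "i \<notin> set b" using assms u by auto
  let ?f = "\<lambda>p. p \<le> int i"
  show "i \<in> set v"
  proof (rule ccontr)
    assume "i \<notin> set v"
    then have "act_word u ?f = ?f" using act_word_halfline assms w act_word_cl by metis
    then have "act_word a (?f \<circ> sg (int i)) = ?f"
      unfolding u act_word_append act_word_simps using act_word_halfline[OF w(2,5,3)] by simp
    then have "act_word (rev a) (act_word a (?f \<circ> sg (int i))) = ?f"
      using act_word_halfline[of "rev a" i] w by simp
    moreover have "cl (rev a @ a) = cl []" using w by (simp add: cl_append cl_Nil flip: inv_cl)
    then have "act_word (rev a) (act_word a (?f \<circ> sg (int i))) = ?f \<circ> sg (int i)"
      using act_word_cl[of "rev a @ a" "[]" "?f \<circ> sg (int i)"] by (simp add: act_word_append)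
    ultimately have "(?f \<circ> sg (int i)) (int i) = ?f (int i)" by metis
    then show False by (simp add: sg_def)
  qed
qed

text \<open>A reduced word of \<open>cl u\<close> contains all letters of u, hence has at least as
  many letters.\<close>

lemma distinct_reduced:
  assumes "distinct u" "u \<in> words" shows "ln (cl u) = length u"
proof -
  obtain v where v: "v \<in> words" "cl u = cl v" "length v = ln (cl u)"
    using reducedE[OF cl_closed[OF assms(2)]] .
  have "length u = card (set u)" using assms(1) by (simp add: distinct_card)
  also have "\<dots> \<le> card (set v)" using letter_in_word assms v by (intro card_mono) auto
  also have "\<dots> \<le> length v" by (rule card_length)
  finally show ?thesis using v ln_cl_le[OF assms(2)] by simp
qed

definition cyc_word :: "nat set \<Rightarrow> nat list" where
  "cyc_word A = (SOME u. set u = A \<and> cyc_decreasing k u)"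

lemma dA_cyc_word: "dA k A = cl (cyc_word A)"
  by (simp add: dA_def cyc_word_def)

lemma cyc_word:
  assumes "A \<subset> {..k}"
  shows "set (cyc_word A) = A" "cyc_decreasing k (cyc_word A)" "cyc_word A \<in> words"
    "distinct (cyc_word A)" "length (cyc_word A) = card A" "ln (cl (cyc_word A)) = card A"
proof -
  have *: "set (cyc_word A) = A \<and> cyc_decreasing k (cyc_word A)"
    unfolding cyc_word_def by (rule someI_ex) (rule cyc_word_exists[OF assms])
  then show d: "set (cyc_word A) = A" "cyc_decreasing k (cyc_word A)" "distinct (cyc_word A)"
    using cyc_decreasing_distinct by auto
  then show w: "cyc_word A \<in> words" using assms by (auto simp: in_lists_conv_set)
  show l: "length (cyc_word A) = card A" using d by (metis distinct_card)
  show "ln (cl (cyc_word A)) = card A" using distinct_reduced[OF d(3) w] l by simp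
qed

lemma dA_set:
  assumes "cyc_decreasing k u" "set u \<subset> {..k}"
  shows "dA k (set u) = cl u"
  unfolding dA_cyc_word using cyc_word[OF assms(2)] assms by (intro cyc_word_unique) auto

lemma demazure_dA: "A \<subset> {..k} \<Longrightarrow> x \<in> W \<Longrightarrow> demazure k (dA k A) x = upw (cyc_word A) x"
  unfolding dA_cyc_word using cyc_word[of A] by (intro demazure_cl) simp_all

lemma upw_cyc:
  assumes "cyc_decreasing k u" "set u \<subset> {..k}" "x \<in> W"
  shows "upw u x = upw (cyc_word (set u)) x"
proof -
  have u: "u \<in> words" using assms by (auto simp: in_lists_conv_set)
  have "ln (cl u) = length u" using distinct_reduced assms cyc_decreasing_distinct u by blast
  then have "demazure k (cl u) x = upw u x" using demazure_cl u assms by simp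
  then show ?thesis using demazure_dA[OF assms(2,3)] dA_set[OF assms(1,2)] by simp
qed

text \<open>The subword property gives the residual z a cyclically decreasing word, and C is its set
  of letters. Any A with z \<preceq> d_A contains C by \<open>letter_in_word\<close>; conversely,
  \<open>cyc_word A\<close> filtered by C represents z, by uniqueness of cyclically decreasing
  words.\<close>

lemma minimal_index_set:
  assumes "x \<in> W" "w \<in> W" "B \<subset> {..k}" "x \<preceq> upw (cyc_word B) w"
  shows "\<exists>C\<subseteq>B. \<forall>A. A \<subset> {..k} \<longrightarrow> (x \<preceq> upw (cyc_word A) w \<longleftrightarrow> C \<subseteq> A)"
proof -
  obtain z where z: "z \<in> W" "\<And>u. u \<in> words \<Longrightarrow> x \<preceq> upw u w \<longleftrightarrow> z \<preceq> upw u \<epsilon>"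
    using sle_upw_residual[OF assms(1,2)] by blast
  have iff: "x \<preceq> upw (cyc_word A) w \<longleftrightarrow> z \<preceq> cl (cyc_word A)" if "A \<subset> {..k}" for A
    using z(2) cyc_word[OF that] upw_reduced by simp
  have sub: "\<exists>v. set v \<subseteq> A \<and> cyc_decreasing k v \<and> z = cl v" if A: "A \<subset> {..k}" "z \<preceq> cl (cyc_word A)" for A
  proof -
    obtain v where v: "subseq v (cyc_word A)" "z = cl v" using sle_subword[OF A(2) cyc_word(3)[OF A(1)]] by blast
    then show ?thesis using list_emb_set[OF v(1)] cyc_word[OF A(1)] cyc_decreasing_subseq[OF v(1)]
      by (intro exI[of _ v]) auto
  qed
  obtain v where v: "set v \<subseteq> B" "cyc_decreasing k v" "z = cl v"
    using sub[OF assms(3)] iff[OF assms(3)] assms(4) by blast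
  have vw: "v \<in> words" "set v \<subset> {..k}" using v(1) assms(3) by (auto simp: in_lists_conv_set)
  have "x \<preceq> upw (cyc_word A) w \<longleftrightarrow> set v \<subseteq> A" if A: "A \<subset> {..k}" for A
  proof
    assume "x \<preceq> upw (cyc_word A) w"
    then obtain v' where v': "set v' \<subseteq> A" "cyc_decreasing k v'" "z = cl v'"
      using sub[OF A] iff[OF A] by blast
    have "v' \<in> words" using v'(1) A by (auto simp: in_lists_conv_set)
    then have "set v \<subseteq> set v'" using letter_in_word[of v v'] vw v v' cyc_decreasing_distinct by simp
    then show "set v \<subseteq> A" using v' by blast
  next
    assume *: "set v \<subseteq> A"
    note cw = cyc_word[OF A]
    let ?f = "filter (\<lambda>i. i \<in> set v) (cyc_word A)"
    have f: "set ?f = set v" "cyc_decreasing k ?f"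
      using * cw cyc_decreasing_filter by auto
    moreover have "?f \<in> words" using cw(3) by (auto simp: in_lists_conv_set)
    ultimately have clf: "cl ?f = z" using v(2,3) cyc_word_unique[of ?f v] by simp
    have fw: "?f \<in> words" using cw(3) by (auto simp: in_lists_conv_set)
    have "ln (cl ?f) = length ?f" using fw cw(4) by (intro distinct_reduced) simp_all
    then have "upw ?f \<epsilon> = z" using upw_reduced[OF fw] clf by simp
    then have "z \<preceq> upw (cyc_word A) \<epsilon>"
      using upw_filter_sle[OF cw(3) one_closed, of "\<lambda>i. i \<in> set v"] by simp
    then show "x \<preceq> upw (cyc_word A) w" using z(2) cw(3) by simp
  qed
  then show ?thesis using v(1) by blast
qed

text \<open>Whether p itself is in A is left open: p may lie inside the run or be the first position
  after it, and q = p outside A describes an empty run.\<close>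

definition run_start :: "nat set \<Rightarrow> int \<Rightarrow> int \<Rightarrow> bool" where
  "run_start A q p \<longleftrightarrow> q \<le> p \<and> (\<forall>x. q \<le> x \<and> x < p \<longrightarrow> in_res A x) \<and> \<not> in_res A (q - 1)"

lemma run_start_exists:
  assumes "z < p" "\<not> in_res A z" shows "\<exists>q>z. run_start A q p"
  using assms(1)
proof (induction p rule: int_gr_induct)
  case base
  then show ?case using assms(2) by (intro exI[of _ "z + 1"]) (auto simp: run_start_def)
next
  case (step p)
  then obtain q where q: "q > z" "run_start A q p" by blast
  show ?case
  proof (cases "in_res A p")
    case True
    then have "in_res A x" if "q \<le> x" "x < p + 1" for x
      using q(2) that by (cases "x = p") (auto simp: run_start_def)
    then have "run_start A q (p + 1)" using q(2) by (simp add: run_start_def)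
    then show ?thesis using q by blast
  next
    case False
    then have "run_start A (p + 1) (p + 1)" by (auto simp: run_start_def)
    then show ?thesis using step by (intro exI[of _ "p + 1"]) simp
  qed
qed

lemma run_start_unique: "run_start A q p \<Longrightarrow> run_start A q' p \<Longrightarrow> q = q'"
proof (induction q q' rule: linorder_wlog)
  case (le q q')
  have "\<not> q < q'"
  proof
    assume "q < q'"
    then have "in_res A (q' - 1)" using le by (auto simp: run_start_def)
    then show False using le by (simp add: run_start_def)
  qed
  then show ?case using le by simp
qed simp

lemma run_start_shift: "run_start A q p \<Longrightarrow> run_start A (q + n * m) (p + n * m)"
proof -
  assume q: "run_start A q p"
  have "in_res A x" if "q + n * m \<le> x" "x < p + n * m" for x
    using q that in_res_cong[of x "x - n * m" A] by (auto simp: run_start_def)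
  moreover have "in_res A (q + n * m - 1) \<longleftrightarrow> in_res A (q - 1)" by (rule in_res_cong) simp
  ultimately show ?thesis using q by (auto simp: run_start_def)
qed

lemma not_in_res_window: "A \<subset> {..k} \<Longrightarrow> \<exists>z. q \<le> z \<and> z < q + n \<and> \<not> in_res A z"
proof -
  assume "A \<subset> {..k}"
  then obtain z where z: "\<not> in_res A z" using not_in_res_exists by blast
  have "n dvd (z - q) - (z - q) mod n" by (rule dvd_minus_mod)
  then have "n dvd z - (q + (z - q) mod n)" by (simp only: diff_diff_add)
  then have "\<not> in_res A (q + (z - q) mod n)" using z in_res_cong by blast
  then show ?thesis
    using pos_mod_sign[of n "z - q"] pos_mod_bound[of n "z - q"] by (intro exI[of _ "q + (z - q) mod n"]) simp
qed

lemma in_res_Cons: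
  assumes "i # u \<in> words" "cyc_decreasing k (i # u)"
  shows "in_res (set (i # u)) p \<longleftrightarrow> n dvd p - int i \<or> in_res (set u) p"
    and "n dvd p - int i \<Longrightarrow> \<not> in_res (set u) p"
    and "n dvd p - int i \<Longrightarrow> \<not> in_res (set (i # u)) (p + 1)"
proof -
  have i: "i \<le> k" using assms by simp
  show 1: "in_res (set (i # u)) p \<longleftrightarrow> n dvd p - int i \<or> in_res (set u) p" for p
    using in_res_insert[OF i] by simp
  show "n dvd p - int i \<Longrightarrow> \<not> in_res (set u) p"
    using in_res_cong[of p "int i"] i assms(2) by (simp add: in_res_int cyc_decreasing_Cons)
  assume p: "n dvd p - int i"
  have i_mod: "nat (int i mod n) = i" using i by simp
  have "nat ((int i + 1) mod n) = (i + 1) mod (k + 1)"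
    using int_succ_mod[of "int i"] nat_int i_mod by metis
  then have "\<not> in_res (set u) (int i + 1)" using assms(2) by (simp add: in_res_def cyc_decreasing_Cons)
  then have "\<not> in_res (set u) (p + 1)" using in_res_cong[of "p + 1" "int i + 1"] p by simp
  moreover have "\<not> n dvd p + 1 - int i"
    using dvd_diff[of n "p + 1 - int i" "p - int i"] p n_dvd_1 by auto
  ultimately show "\<not> in_res (set (i # u)) (p + 1)" by (simp only: 1) simp
qed

text \<open>A run q, ..., t acts as a cycle on the positions q, ..., t + 1: the other entries move
  one place down and the entry at q jumps over the run. In the second case p is the position just
  after its run, and is fixed if the run is empty.\<close>

lemma act_cyc_word:
  assumes "u \<in> words" "cyc_decreasing k u"
  shows "(in_res (set u) p \<longrightarrow> act_word u f p = f (p + 1)) \<and>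
    (\<not> in_res (set u) p \<longrightarrow> run_start (set u) q p \<longrightarrow> act_word u f p = f q)"
  using assms
proof (induction u arbitrary: p q)
  case Nil
  have "q = p" if "run_start {} q p"
  proof (rule ccontr)
    assume "q \<noteq> p"
    then have "in_res {} q" using that by (simp add: run_start_def)
    then show False by (simp add: in_res_def)
  qed
  then show ?case by (auto simp: in_res_def)
next
  case (Cons i u)
  then have u: "u \<in> words" "cyc_decreasing k u" "i \<le> k" by (auto simp: cyc_decreasing_Cons)
  note IH = Cons.IH[OF u(2)]
  have cw: "i # u \<in> words" using u by simp
  note res = in_res_Cons[OF cw Cons.prems]
  consider "n dvd p - int i" | "n dvd p - int i - 1" | "\<not> n dvd p - int i" "\<not> n dvd p - int i - 1" by blast
  then show ?case
  proof cases
    case 1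
    have "\<not> in_res (set u) (p + 1)" using res(3)[OF 1] res(1) by blast
    moreover have "run_start (set u) (p + 1) (p + 1)" using res(2)[OF 1] by (force simp: run_start_def)
    ultimately have "act_word u f (p + 1) = f (p + 1)" using IH by blast
    then show ?thesis using 1 res(1)[of p] by (simp add: sg_cases)
  next
    case 2
    then have d: "n dvd (p - 1) - int i" by (simp add: algebra_simps)
    have np: "\<not> in_res (set (i # u)) p" using res(3)[OF d] by simp
    have "act_word u f (p - 1) = f q" if q: "run_start (set (i # u)) q p"
    proof -
      have "in_res (set (i # u)) (p - 1)" using res(1) d by blast
      then have "q \<noteq> p" using q by (auto simp: run_start_def)
      have "in_res (set u) x" if x: "q \<le> x" "x < p - 1" for x
      proof (rule ccontr)
        assume "\<not> in_res (set u) x"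
        then have "n dvd x - int i" using q x res(1)[of x] by (auto simp: run_start_def)
        then have "\<not> in_res (set (i # u)) (x + 1)" using res(3) by blast
        then show False using q x by (auto simp: run_start_def)
      qed
      then have "run_start (set u) q (p - 1)" using q \<open>q \<noteq> p\<close> res(1) by (auto simp: run_start_def)
      then show ?thesis using IH res(2)[OF d] by blast
    qed
    then show ?thesis using np 2 by (simp add: sg_cases)
  next
    case 3
    have "in_res (set (i # u)) p \<longleftrightarrow> in_res (set u) p" using 3 res(1) by blast
    moreover have "run_start (set u) q p" if q: "run_start (set (i # u)) q p" "\<not> in_res (set (i # u)) p"
    proof -
      have "in_res (set u) x" if x: "q \<le> x" "x < p" for x
      proof (rule ccontr)
        assume "\<not> in_res (set u) x"
        then have d: "n dvd x - int i" using q x res(1)[of x] by (auto simp: run_start_def)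
        then have "\<not> in_res (set (i # u)) (x + 1)" using res(3) by blast
        then have "\<not> x + 1 < p" using q(1) x by (auto simp: run_start_def)
        then have "x + 1 = p" using x by simp
        then have "p - int i - 1 = x - int i" by simp
        then show False using 3 d by metis
      qed
      then show ?thesis using q res(1) by (auto simp: run_start_def)
    qed
    ultimately show ?thesis using 3 IH by (auto simp: sg_cases)
  qed
qed

lemma al_mul: "u \<in> words \<Longrightarrow> w \<in> W \<Longrightarrow> al (cl u \<cdot> w) = act_word u (al w)"
  using word_exists[of w] by (auto simp: al_cl act_word_append simp flip: cl_append)

section \<open>Weak strips\<close>

definition strip_cond :: "nat set \<Rightarrow> (int \<Rightarrow> int) \<Rightarrow> bool" where
  "strip_cond A f \<longleftrightarrow> (\<forall>q t. run_start A q t \<longrightarrow> in_res A t \<longrightarrow> f (t + 1) < f q)"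

text \<open>The residue i + 1 is not in \<open>i # u\<close>, so i ends its run and no nonempty run
  of u is extended to the left. The only new inequality is the one at i, up to translation by
  periods.\<close>

lemma strip_cond_Cons:
  assumes w: "w \<in> W" and iu: "i # u \<in> words" "cyc_decreasing k (i # u)"
  shows "strip_cond (set (i # u)) (al w) \<longleftrightarrow> strip_cond (set u) (al w) \<and>
    (\<forall>q. run_start (set u) q (int i) \<longrightarrow> al w (int i + 1) < al w q)"
proof -
  note res = in_res_Cons[OF iu]
  have i: "i \<le> k" using iu by simp
  have start: "run_start (set (i # u)) q t"
    if q: "run_start (set u) q t" and c: "q < t \<or> in_res (set u) t \<or> t = int i" for q t
  proof -
    have "\<not> n dvd (q - 1) - int i"
    proof
      assume d: "n dvd (q - 1) - int i"
      then have nq: "\<not> in_res (set (i # u)) q" using res(3)[OF d] by simp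
      then have "\<not> in_res (set u) q" using res(1) by blast
      then have "q = t" using q by (auto simp: run_start_def)
      then have "q = int i" using c \<open>\<not> in_res (set u) q\<close> by auto
      then show False using d n_dvd_1 by simp
    qed
    then show ?thesis using q res(1) by (auto simp: run_start_def)
  qed
  show ?thesis
  proof
    assume L: "strip_cond (set (i # u)) (al w)"
    have "al w (t + 1) < al w q" if "run_start (set u) q t" "in_res (set u) t" for q t
      using L start[OF that(1)] that(2) res(1) unfolding strip_cond_def by blast
    moreover have "al w (int i + 1) < al w q" if "run_start (set u) q (int i)" for q
      using L start[OF that] res(1)[of "int i"] unfolding strip_cond_def by simp
    ultimately show "strip_cond (set u) (al w) \<and>
        (\<forall>q. run_start (set u) q (int i) \<longrightarrow> al w (int i + 1) < al w q)"
      unfolding strip_cond_def by blast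
  next
    assume R: "strip_cond (set u) (al w) \<and>
        (\<forall>q. run_start (set u) q (int i) \<longrightarrow> al w (int i + 1) < al w q)"
    show "strip_cond (set (i # u)) (al w)" unfolding strip_cond_def
    proof (intro allI impI)
      fix q t assume q: "run_start (set (i # u)) q t" and t: "in_res (set (i # u)) t"
      have only: "x = t" if x: "q \<le> x" "x \<le> t" "n dvd x - int i" for x
      proof (rule ccontr)
        assume "x \<noteq> t"
        then have "in_res (set (i # u)) (x + 1)" using x q t
          by (cases "x + 1 = t") (auto simp: run_start_def)
        then show False using res(3)[OF x(3)] by simp
      qed
      have nq: "\<not> in_res (set u) (q - 1)" using q res(1) by (auto simp: run_start_def)
      have inu: "in_res (set u) x" if "q \<le> x" "x < t" for x
        using q that res(1)[of x] only[of x] by (auto simp: run_start_def)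
      show "al w (t + 1) < al w q"
      proof (cases "n dvd t - int i")
        case False
        then have "in_res (set u) t" using t res(1) by blast
        then show ?thesis using R nq inu q unfolding strip_cond_def run_start_def by blast
      next
        case True
        then obtain m where m: "int i = t + n * m"
          by (metis add.commute diff_add_cancel dvd_def minus_diff_eq minus_mult_right)
        have "in_res (set u) x" if "q + n * m \<le> x" "x < int i" for x
          using inu[of "x - n * m"] in_res_cong[of x "x - n * m"] that m by simp
        moreover have "\<not> in_res (set u) (q + n * m - 1)"
          using nq in_res_cong[of "q + n * m - 1" "q - 1"] by simp
        ultimately have "run_start (set u) (q + n * m) (int i)"
          using q m by (simp add: run_start_def)
        then have "al w (int i + 1) < al w (q + n * m)" using R by blast
        moreover have "int i + 1 = (t + 1) + n * m" using m by simp
        ultimately show ?thesis using al_period[OF w, of "t + 1" m] al_period[OF w, of q m] by simp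
      qed
    qed
  qed
qed

text \<open>Letters are added on the left. When \<open>s i\<close> acts on y =
  \<open>cl u \<cdot> w\<close>, the entries of y in positions i and i + 1 are those of w in
  positions q and i + 1, where q starts the run of u that reaches up to i. So
  \<open>al_greater_iff\<close> for y is exactly the condition that \<open>strip_cond_Cons\<close>
  adds.\<close>

lemma strip_cond_word:
  assumes "w \<in> Wgr k" "u \<in> words" "cyc_decreasing k u"
  shows "strip_cond (set u) (al w) \<longleftrightarrow> cl u \<cdot> w \<in> Wgr k \<and> ln (cl u \<cdot> w) = ln w + length u"
  using assms(2,3)
proof (induction u)
  case Nil
  then show ?case using assms(1) Wgr_closed by (auto simp: strip_cond_def in_res_def cl_Nil)
next
  case (Cons i u)
  have iu: "i # u \<in> words" "i \<le> k" "u \<in> words" "cyc_decreasing k u"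
    using Cons by (auto simp: cyc_decreasing_Cons)
  have w: "w \<in> W" using assms Wgr_closed by simp
  let ?y = "cl u \<cdot> w"
  have y: "?y \<in> W" using iu w by simp
  have siy: "cl (i # u) \<cdot> w = s i \<cdot> ?y" using iu w by (simp add: cl_Cons m_assoc)
  note res = in_res_Cons[OF iu(1) Cons.prems]
  have ni: "\<not> in_res (set u) (int i)" "\<not> in_res (set u) (int i + 1)" using res by force+
  have "\<not> in_res (set u) (int i - n)" using ni in_res_period[of "set u" "int i - n"] by simp
  then obtain q0 where q0: "run_start (set u) q0 (int i)" using run_start_exists[of "int i - n" "int i"] by auto
  have aly: "al ?y = act_word u (al w)" using al_mul iu w by simp
  have ali: "al ?y (int i) = al w q" if "run_start (set u) q (int i)" for q
    unfolding aly using act_cyc_word[OF iu(3,4)] ni that by blast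
  have "run_start (set u) (int i + 1) (int i + 1)" using ni by (force simp: run_start_def)
  then have ali1: "al ?y (int i + 1) = al w (int i + 1)"
    unfolding aly using act_cyc_word[OF iu(3,4)] ni by blast
  have cond: "(\<forall>q. run_start (set u) q (int i) \<longrightarrow> al w (int i + 1) < al w q) \<longleftrightarrow>
      al ?y (int i + 1) < al ?y (int i)"
    using ali ali1 q0 by metis
  have gr: "al ?y (int i + 1) < al ?y (int i) \<longleftrightarrow> ln ?y < ln (s i \<cdot> ?y) \<and> s i \<cdot> ?y \<in> Wgr k"
    if "?y \<in> Wgr k"
    using al_greater_iff[OF that, of "int i"] iu by simp
  have le: "ln ?y \<le> ln w + length u" using ln_mul_le[of "cl u" w] ln_cl_le[of u] iu w by simp
  have st: "ln (s i \<cdot> ?y) = ln ?y + 1 \<or> ln ?y = ln (s i \<cdot> ?y) + 1" using ln_s_mul iu y by simp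
  have prev: "?y \<in> Wgr k" if "s i \<cdot> ?y \<in> Wgr k" "ln ?y < ln (s i \<cdot> ?y)"
    using Wgr_descent[of "s i \<cdot> ?y" i] that iu y by simp
  have "strip_cond (set (i # u)) (al w) \<longleftrightarrow>
      (?y \<in> Wgr k \<and> ln ?y = ln w + length u) \<and> al ?y (int i + 1) < al ?y (int i)"
    using strip_cond_Cons[OF w iu(1) Cons.prems] Cons.IH[OF iu(4)] cond by simp
  also have "\<dots> \<longleftrightarrow> s i \<cdot> ?y \<in> Wgr k \<and> ln (s i \<cdot> ?y) = ln w + length (i # u)"
    using gr le st prev by auto
  finally show ?case by (simp add: siy)
qed

definition strip :: "nat list set \<Rightarrow> nat set \<Rightarrow> bool" where
  "strip w A \<longleftrightarrow> A \<subset> {..k} \<and> dA k A \<cdot> w \<in> Wgr k \<and> ln (dA k A \<cdot> w) = ln w + card A"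

lemma strip_iff:
  assumes "w \<in> Wgr k" "A \<subset> {..k}" shows "strip w A \<longleftrightarrow> strip_cond A (al w)"
  using strip_cond_word[OF assms(1) cyc_word(3,2)[OF assms(2)]] cyc_word[OF assms(2)] assms(2)
  by (simp add: strip_def dA_cyc_word)

text \<open>If a run of the intersection starts at q, some member A omits q - 1. The run is then an
  initial part of a run of A, and the required inequality is among those for A.\<close>

lemma strip_Inter:
  assumes "w \<in> Wgr k" "\<A> \<noteq> {}" "\<And>A. A \<in> \<A> \<Longrightarrow> strip w A"
  shows "strip w (\<Inter>\<A>)"
proof -
  obtain A0 where "A0 \<in> \<A>" using assms(2) by blast
  then have sub: "\<Inter>\<A> \<subset> {..k}" using assms(3)[of A0] unfolding strip_def by blast
  have in_Inter: "in_res (\<Inter>\<A>) p \<longleftrightarrow> (\<forall>A\<in>\<A>. in_res A p)" for p by (auto simp: in_res_def)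
  have "strip_cond (\<Inter>\<A>) (al w)" unfolding strip_cond_def
  proof (intro allI impI)
    fix q t assume qt: "run_start (\<Inter>\<A>) q t" "in_res (\<Inter>\<A>) t"
    then obtain A where A: "A \<in> \<A>" "\<not> in_res A (q - 1)" by (auto simp: run_start_def in_Inter)
    then have "run_start A q t" "in_res A t" using qt by (auto simp: run_start_def in_Inter)
    moreover have "strip_cond A (al w)" using strip_iff assms A unfolding strip_def by blast
    ultimately show "al w (t + 1) < al w q" by (simp add: strip_cond_def)
  qed
  then show ?thesis using strip_iff assms(1) sub by blast
qed

section \<open>Demazure action compared with weak strips\<close>

lemma upw_additive:
  assumes "w \<in> W" "u \<in> words" "ln (cl u \<cdot> w) = ln w + length u"
  shows "upw u w = cl u \<cdot> w"
  using assms(2,3)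
proof (induction u)
  case (Cons i u)
  have iu: "i \<le> k" "u \<in> words" using Cons by simp_all
  let ?y = "cl u \<cdot> w"
  have siy: "cl (i # u) \<cdot> w = s i \<cdot> ?y" using iu assms(1) by (simp add: cl_Cons m_assoc)
  have "ln ?y \<le> ln w + length u" using ln_mul_le[of "cl u" w] ln_cl_le[of u] iu assms(1) by simp
  moreover have "ln (s i \<cdot> ?y) \<le> ln ?y + 1" using ln_s_le iu assms(1) by simp
  ultimately have "ln ?y = ln w + length u" "ln ?y < ln (s i \<cdot> ?y)"
    using Cons.prems siy by simp_all
  then show ?case using Cons.IH iu assms(1) siy by (simp add: up_eq)
qed (use assms(1) in \<open>simp add: cl_Nil\<close>)

lemma strip_upw:
  assumes "w \<in> W" "strip w A" shows "upw (cyc_word A) w = dA k A \<cdot> w"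
  unfolding dA_cyc_word using assms(2) cyc_word[of A]
  by (intro upw_additive[OF assms(1)]) (auto simp: strip_def dA_cyc_word)

text \<open>Letters that act trivially, or move \<open>w\<close> only inside its coset of \<open>\<langle>s\<^sub>1, \<dots>, s\<^sub>k\<rangle>\<close>,
  do not help to get above elements of \<^term>\<open>Wgr k\<close> and can be dropped.\<close>

lemma sle_upw_subseq:
  assumes "w \<in> Wgr k" "u \<in> words"
  shows "\<exists>v. subseq v u \<and> cl v \<cdot> w \<in> Wgr k \<and> ln (cl v \<cdot> w) = ln w + length v \<and>
    (\<forall>x\<in>Wgr k. x \<preceq> upw u w \<longrightarrow> x \<preceq> cl v \<cdot> w)"
  using assms(2)
proof (induction u)
  case Nil
  then show ?case using assms(1) Wgr_closed by (intro exI[of _ "[]"]) (auto simp: cl_Nil)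
next
  case (Cons i u)
  have iu: "i \<le> k" "u \<in> words" using Cons by simp_all
  have w: "w \<in> W" using assms Wgr_closed by simp
  obtain v where v: "subseq v u" "cl v \<cdot> w \<in> Wgr k" "ln (cl v \<cdot> w) = ln w + length v"
    "\<And>x. x \<in> Wgr k \<Longrightarrow> x \<preceq> upw u w \<Longrightarrow> x \<preceq> cl v \<cdot> w"
    using Cons.IH by blast
  have vw: "v \<in> words" using list_emb_set[OF v(1)] iu by (fastforce simp: in_lists_conv_set)
  let ?y = "cl v \<cdot> w"
  have y: "?y \<in> W" using vw w by simp
  have siy: "cl (i # v) \<cdot> w = s i \<cdot> ?y" using iu vw w by (simp add: cl_Cons m_assoc)
  have le: "x \<preceq> up i ?y" if x: "x \<in> Wgr k" "x \<preceq> upw (i # u) w" for x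
  proof -
    have xW: "x \<in> W" using x Wgr_closed by simp
    have "dn i x \<preceq> upw u w" using x xW iu w sle_up_iff by simp
    moreover have "dn i x \<in> Wgr k" using x iu Wgr_descent by (simp add: dn_def)
    ultimately show ?thesis using v(4) sle_up_iff xW y iu by blast
  qed
  show ?case
  proof (cases "ln ?y < ln (s i \<cdot> ?y) \<and> s i \<cdot> ?y \<in> Wgr k")
    case True
    then have "ln (s i \<cdot> ?y) = ln w + length (i # v)" using ln_s_mul[OF iu(1) y] v(3) by auto
    moreover have "up i ?y = s i \<cdot> ?y" using True iu y by (simp add: up_eq)
    ultimately show ?thesis using True v(1) le siy by (intro exI[of _ "i # v"]) auto
  next
    case False
    have "x \<preceq> ?y" if x: "x \<in> Wgr k" "x \<preceq> upw (i # u) w" for x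
    proof (cases "ln ?y < ln (s i \<cdot> ?y)")
      case less: True
      \<comment> \<open>Here s_i merely multiplies y by \<open>s j\<close> on the right. As x is
        Grassmannian, \<open>dnr j x = x\<close>, and the right-hand adjunction removes the
        letter.\<close>
      then obtain j where j: "j \<in> {1..k}" "s i \<cdot> ?y = ?y \<cdot> s j"
        using False Wgr_ascent[OF v(2) iu(1)] by blast
      have "upr j ?y = s i \<cdot> ?y" using less j(2) by (simp add: upr_def)
      then have "x \<preceq> upr j ?y" using le[OF x] less iu y by (simp add: up_eq)
      then have "dnr j x \<preceq> ?y" using sle_upr_iff[of x ?y j] x Wgr_closed y j by simp
      moreover have "ln x < ln (x \<cdot> s j)" using x(1) j(1) by (simp add: Wgr_iff)
      then have "dnr j x = x" by (simp add: dnr_def)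
      ultimately show ?thesis by simp
    next
      case notless: False
      then show ?thesis using le[OF x] iu y by (simp add: up_eq)
    qed
    then show ?thesis using v by (intro exI[of _ v]) auto
  qed
qed

lemma strip_below:
  assumes "w \<in> Wgr k" "B \<subset> {..k}" "x \<in> Wgr k" "x \<preceq> upw (cyc_word B) w"
  shows "\<exists>A\<subseteq>B. strip w A \<and> x \<preceq> dA k A \<cdot> w"
proof -
  note B = cyc_word[OF assms(2)]
  obtain v where v: "subseq v (cyc_word B)" "cl v \<cdot> w \<in> Wgr k" "ln (cl v \<cdot> w) = ln w + length v"
    "x \<preceq> cl v \<cdot> w"
    using sle_upw_subseq[OF assms(1) B(3)] assms(3,4) by blast
  have sub: "set v \<subseteq> B" using list_emb_set[OF v(1)] B(1) by blast
  have cv: "cyc_decreasing k v" using cyc_decreasing_subseq v(1) B(2) by blast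
  have "set v \<subset> {..k}" using sub assms(2) by blast
  then have d: "dA k (set v) = cl v" using dA_set cv by blast
  have "card (set v) = length v" using cyc_decreasing_distinct[OF cv] by (rule distinct_card)
  then have "strip w (set v)" using v d \<open>set v \<subset> {..k}\<close> by (simp add: strip_def)
  then show ?thesis using sub v d by (intro exI[of _ "set v"]) simp
qed

text \<open>Periodicity yields a position t0 outside B whose right neighbour has a smaller entry
  than the start of the run before t0. Inserting t0 joins that run to the one starting at t0 + 1.
  Entries of the latter are below \<open>al w (t0 + 1)\<close>, hence below the new start.\<close>

lemma strip_extend:
  assumes w: "w \<in> Wgr k" and B: "strip w B" "card B < k"
  shows "\<exists>t. t \<notin> B \<and> strip w (insert t B)"
proof -
  have wW: "w \<in> W" using w Wgr_closed by simp
  have Bk: "B \<subset> {..k}" using B by (simp add: strip_def)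
  have condB: "strip_cond B (al w)" using strip_iff w Bk B(1) by blast
  have "\<exists>q t. \<not> in_res B t \<and> run_start B q t \<and> al w (t + 1) < al w q"
  proof (rule ccontr)
    assume "\<not> ?thesis"
    then have le: "al w q \<le> al w (t + 1)" if "\<not> in_res B t" "run_start B q t" for q t
      using that by force
    obtain z where z: "\<not> in_res B z" using not_in_res_exists[OF Bk] by blast
    \<comment> \<open>Positions q with q - 1 outside B are chained downwards: \<open>le\<close>
      compares q with the start q' of the run before q - 1, possibly an empty one, until z + 1 is
      reached.\<close>
    have mono: "\<not> in_res B (q - 1) \<longrightarrow> al w (z + 1) \<le> al w q" if "z + 1 \<le> q" for q
      using that
    proof (induction "nat (q - z)" arbitrary: q rule: less_induct)
      case less
      show ?case
      proof (cases "q = z + 1")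
        case False
        show ?thesis
        proof
          assume nq: "\<not> in_res B (q - 1)"
          obtain q' where q': "q' > z" "run_start B q' (q - 1)"
            using run_start_exists[OF _ z, of "q - 1"] less.prems False by auto
          then have "q' \<le> q - 1" "\<not> in_res B (q' - 1)" by (auto simp: run_start_def)
          then have "al w (z + 1) \<le> al w q'" using less.hyps[of q'] q'(1) by simp
          also have "\<dots> \<le> al w q" using le[OF nq q'(2)] by simp
          finally show "al w (z + 1) \<le> al w q" .
        qed
      qed simp
    qed
    have eq: "z + 1 + n - 1 = z + n" by simp
    have "\<not> in_res B (z + 1 + n - 1)" unfolding eq using z in_res_period[of B z] by simp
    then have "al w (z + 1) \<le> al w (z + 1 + n)" using mono[of "z + 1 + n"] by simp
    then show False using al_period1[OF wW, of "z + 1"] by simp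
  qed
  then obtain q0 t0 where t0: "\<not> in_res B t0" "run_start B q0 t0" "al w (t0 + 1) < al w q0" by blast
  define t where "t = nat (t0 mod n)"
  have tk: "t \<le> k" "t \<notin> B" using t0 by (simp_all add: t_def in_res_def)
  have finB: "finite B" using Bk finite_subset by blast
  have "card (insert t B) \<le> k" using B(2) tk finB by simp
  then have "insert t B \<noteq> {..k}" by (metis Suc_n_not_le_n card_atMost)
  then have Ak: "insert t B \<subset> {..k}" using Bk tk by auto
  have tt: "n dvd int t - t0" by (simp add: t_def mod_eq_dvd_iff[symmetric])
  have inA: "in_res (insert t B) p \<longleftrightarrow> n dvd p - t0 \<or> in_res B p" for p
    using in_res_insert[OF tk(1)] dvd_add_left_iff[OF tt, of "p - int t"] by (simp add: tk)
  have start: "al w (t' + 1) < al w q" if t': "n dvd t' - t0" and q: "run_start B q t'" for q t'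
  proof -
    obtain m where m: "t' = t0 + n * m" using t' by (metis add.commute diff_add_cancel dvd_def)
    have "q = q0 + n * m" using run_start_shift[OF t0(2), of m] run_start_unique q m by blast
    then have "al w q = al w q0 - m" using al_period[OF wW, of q0 m] by simp
    moreover have "t' + 1 = (t0 + 1) + n * m" using m by simp
    then have "al w (t' + 1) = al w (t0 + 1) - m" using al_period[OF wW, of "t0 + 1" m] by (simp only:)
    ultimately show ?thesis using t0(3) by simp
  qed
  have "strip_cond (insert t B) (al w)" unfolding strip_cond_def
  proof (intro allI impI)
    fix q x assume q: "run_start (insert t B) q x" and x: "in_res (insert t B) x"
    have qx: "q \<le> x" and nq: "\<not> in_res B (q - 1)" using q inA by (auto simp: run_start_def)
    have all: "in_res (insert t B) y" if "q \<le> y" "y \<le> x" for y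
      using q x that by (cases "y = x") (auto simp: run_start_def)
    obtain z where "q \<le> z" "z < q + n" "\<not> in_res (insert t B) z" using not_in_res_window[OF Ak] by blast
    \<comment> \<open>A run of a proper subset is shorter than a period, so it meets the residue
      class of t at most once.\<close>
    then have short: "x < q + n" using all[of z] by linarith
    show "al w (x + 1) < al w q"
    proof (cases "\<exists>t'. q \<le> t' \<and> t' \<le> x \<and> n dvd t' - t0")
      case True
      then obtain t' where t': "q \<le> t'" "t' \<le> x" "n dvd t' - t0" by blast
      have inB: "in_res B y" if "q \<le> y" "y \<le> x" "y \<noteq> t'" for y
      proof -
        have "\<not> n dvd y - t0"
        proof
          assume "n dvd y - t0"
          then have "n dvd y - t'" using dvd_diff[OF _ t'(3), of "y - t0"] by simp
          then have "y - t' = 0" using that t' short by (intro n_dvd_small) auto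
          then show False using that by simp
        qed
        then show ?thesis using all[OF that(1,2)] inA by blast
      qed
      have "run_start B q t'" using t' inB nq by (simp add: run_start_def)
      then have 1: "al w (t' + 1) < al w q" using start t'(3) by blast
      show ?thesis
      proof (cases "x = t'")
        case False
        have "\<not> in_res B t'" using t0(1) in_res_cong[OF t'(3)] by simp
        then have "run_start B (t' + 1) x" using False t' inB by (auto simp: run_start_def)
        moreover have "in_res B x" using inB[of x] qx False by simp
        ultimately have "al w (x + 1) < al w (t' + 1)" using condB by (simp add: strip_cond_def)
        then show ?thesis using 1 by simp
      qed (use 1 in simp)
    next
      case False
      then have inB: "in_res B y" if "q \<le> y" "y \<le> x" for y using all[OF that] inA that by blast
      have "run_start B q x" using qx nq inB by (simp add: run_start_def)
      then show ?thesis using condB inB[of x] qx by (simp add: strip_cond_def)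
    qed
  qed
  then show ?thesis using strip_iff[OF w Ak] tk by blast
qed

lemma strip_extend_card:
  assumes "w \<in> Wgr k" "strip w B" "card B \<le> r" "r \<le> k"
  shows "\<exists>A. B \<subseteq> A \<and> strip w A \<and> card A = r"
  using assms(2,3)
proof (induction "r - card B" arbitrary: B)
  case 0
  then show ?case by (intro exI[of _ B]) auto
next
  case (Suc d)
  then have "card B < k" using assms(4) by linarith
  then obtain t where t: "t \<notin> B" "strip w (insert t B)" using strip_extend assms(1) Suc.prems by blast
  have "finite B" using Suc.prems finite_subset[of B "{..k}"] by (auto simp: strip_def)
  then have "card (insert t B) = card B + 1" using t by simp
  then have "\<exists>A. insert t B \<subseteq> A \<and> strip w A \<and> card A = r" using Suc t by (intro Suc.hyps) auto
  then show ?case by blast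
qed

lemma dA_mono:
  assumes "w \<in> W" "strip w A" "strip w B" "B \<subseteq> A"
  shows "dA k B \<cdot> w \<preceq> dA k A \<cdot> w"
proof -
  have A: "A \<subset> {..k}" "B \<subset> {..k}" using assms by (simp_all add: strip_def)
  note cw = cyc_word[OF A(1)]
  let ?f = "filter (\<lambda>i. i \<in> B) (cyc_word A)"
  have f: "set ?f = B" "cyc_decreasing k ?f" using assms(4) cw cyc_decreasing_filter by auto
  then have "upw ?f w = upw (cyc_word B) w" using upw_cyc[of ?f w] A assms(1) by simp
  then show ?thesis
    using upw_filter_sle[OF cw(3) assms(1), of "\<lambda>i. i \<in> B"] strip_upw assms by simp
qed

section \<open>Bounded partitions\<close>

lemma div_n_less_one: "x < n \<Longrightarrow> x div n < 1"
proof -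
  assume "x < n"
  then have "x div n \<le> (n - 1) div n" by (intro zdiv_mono1) auto
  moreover have "(n - 1) div n = 0" by (rule div_pos_pos_trivial) auto
  ultimately show ?thesis by simp
qed

lemma al_nonneg_window:
  assumes "x \<in> W" "\<And>p. a \<le> p \<Longrightarrow> p < a + n \<Longrightarrow> 0 \<le> al x p" "p < a + n"
  shows "0 \<le> al x p"
proof -
  define p0 where "p0 = a + (p - a) mod n"
  define j where "j = (p - a) div n"
  have p: "p = p0 + n * j" by (simp add: p0_def j_def)
  have "a \<le> p0" "p0 < a + n"
    using pos_mod_sign[of n "p - a"] pos_mod_bound[of n "p - a"] by (simp_all add: p0_def)
  moreover have "j < 1" unfolding j_def using assms(3) by (intro div_n_less_one) simp
  ultimately show ?thesis using al_period[OF assms(1), of p0 j] assms(2)[of p0] p by simp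
qed

lemma al_pos_below:
  assumes "x \<in> W" "\<And>p. a \<le> p \<Longrightarrow> p < a + n \<Longrightarrow> 0 \<le> al x p" "p < a"
  shows "1 \<le> al x p"
  using al_nonneg_window[OF assms(1,2), of a "p + n"] al_period1[OF assms(1), of p] assms(3) by simp

text \<open>The sequence is positive far to the left. Its first nonpositive entry is 0, because the
  entry one period earlier is positive and larger only by one.\<close>

lemma al_first_nonpos:
  assumes "x \<in> W"
  shows "\<exists>a. al x a = 0 \<and> (\<forall>p<a. 1 \<le> al x p)"
proof -
  obtain u where u: "x = cl u" using word_exists assms by metis
  have "(\<exists>N. \<forall>p\<le>N. 1 \<le> act_word u al0 p) \<and> (\<exists>p. act_word u al0 p \<le> 0)"
  proof (induction u)
    case Nil
    have "1 \<le> al0 p" if "p \<le> 0" for p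
    proof -
      have "(p - 1) div n < 0" using that by (intro div_neg_pos_less0) auto
      then show ?thesis by (simp add: al0_def)
    qed
    moreover have "al0 1 \<le> 0" by (simp add: al0_def)
    ultimately show ?case by auto
  next
    case (Cons i u)
    then obtain N p where N: "\<And>p. p \<le> N \<Longrightarrow> 1 \<le> act_word u al0 p" "act_word u al0 p \<le> 0" by blast
    have "sg (int i) q \<le> q + 1" for q by (simp add: sg_def)
    then have "1 \<le> act_word (i # u) al0 q" if "q \<le> N - 1" for q
      using N(1)[of "sg (int i) q"] that order_trans[of "sg (int i) q" "q + 1" N] by simp
    moreover have "act_word (i # u) al0 (sg (int i) p) \<le> 0" using N(2) by (simp add: sg_sg)
    ultimately show ?case by blast
  qed
  then obtain N b where N: "\<And>p. p \<le> N \<Longrightarrow> 1 \<le> al x p" "al x b \<le> 0" by (auto simp: u al_cl)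
  define d where "d = (LEAST d. al x (N + int d) \<le> 0)"
  have "al x (N + int (nat (b - N))) \<le> 0" using N(1)[of b] N(2) by (cases "b \<le> N") auto
  then have d: "al x (N + int d) \<le> 0" unfolding d_def by (rule LeastI)
  have pos: "1 \<le> al x p" if "p < N + int d" for p
  proof (cases "p \<le> N")
    case False
    then have "\<not> al x (N + int (nat (p - N))) \<le> 0"
      using that not_less_Least[of "nat (p - N)" "\<lambda>d. al x (N + int d) \<le> 0"] by (simp add: d_def)
    then show ?thesis using False by simp
  qed (use N in simp)
  have "1 \<le> al x (N + int d - n)" using pos by simp
  then have "al x (N + int d) = 0" using d al_period1[OF assms, of "N + int d - n"] by simp
  then show ?thesis using pos by blast
qed

section \<open>Action of row words on sequences\<close>

lemma not_in_res_row_word: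
  assumes "r \<le> k" "z + int r \<le> y" "y < z + n" shows "\<not> in_res (set (row_word z r)) y"
proof
  assume "in_res (set (row_word z r)) y"
  then obtain x where x: "z \<le> x" "x < z + int r" "n dvd y - x" by (auto simp: in_res_row_word)
  then have "y - x = 0" using assms by (intro n_dvd_small) auto
  then show False using x assms by simp
qed

lemma run_start_row_word:
  assumes "r \<le> k" "z \<le> x" "x \<le> z + int r" shows "run_start (set (row_word z r)) z x"
proof -
  have eq: "z - 1 + n = z + int k" by simp
  have "\<not> in_res (set (row_word z r)) (z - 1 + n)"
    unfolding eq using assms(1) by (intro not_in_res_row_word) auto
  then have "\<not> in_res (set (row_word z r)) (z - 1)" by (simp only: in_res_period not_False_eq_True)
  moreover have "in_res (set (row_word z r)) y" if "z \<le> y" "y < x" for y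
    unfolding in_res_row_word using that assms by (intro exI[of _ y]) auto
  ultimately show ?thesis using assms by (simp add: run_start_def)
qed

lemma al_row_word:
  assumes "w \<in> W" "r \<le> k"
  shows "z \<le> p \<Longrightarrow> p < z + int r \<Longrightarrow> al (cl (row_word z r) \<cdot> w) p = al w (p + 1)"
    and "al (cl (row_word z r) \<cdot> w) (z + int r) = al w z"
    and "z + int r < p \<Longrightarrow> p < z + n \<Longrightarrow> al (cl (row_word z r) \<cdot> w) p = al w p"
proof -
  let ?A = "set (row_word z r)"
  have *: "(in_res ?A p \<longrightarrow> al (cl (row_word z r) \<cdot> w) p = al w (p + 1)) \<and>
    (\<not> in_res ?A p \<longrightarrow> run_start ?A q p \<longrightarrow> al (cl (row_word z r) \<cdot> w) p = al w q)" for p q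
    unfolding al_mul[OF row_word_words assms(1)]
    by (rule act_cyc_word[OF row_word_words row_word_cyc[OF assms(2)]])
  show "al (cl (row_word z r) \<cdot> w) p = al w (p + 1)" if "z \<le> p" "p < z + int r"
  proof -
    have "in_res ?A p" unfolding in_res_row_word using that by (intro exI[of _ p]) auto
    then show ?thesis using * by blast
  qed
  show "al (cl (row_word z r) \<cdot> w) (z + int r) = al w z"
    using *[of "z + int r" z] not_in_res_row_word[OF assms(2), of z "z + int r"]
      run_start_row_word[OF assms(2), of z "z + int r"] assms(2) by simp
  show "al (cl (row_word z r) \<cdot> w) p = al w p" if "z + int r < p" "p < z + n"
  proof -
    have n1: "\<not> in_res ?A p" "\<not> in_res ?A (p - 1)"
      using that by (intro not_in_res_row_word[OF assms(2)]; simp)+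
    then have "run_start ?A p p" by (force simp: run_start_def)
    then show ?thesis using * n1 by blast
  qed
qed

lemma row_word_ascend:
  assumes "w \<in> Wgr k" "r \<le> k" "\<And>x. z < x \<Longrightarrow> x \<le> z + int r \<Longrightarrow> al w x < al w z"
  shows "cl (row_word z r) \<cdot> w \<in> Wgr k"
proof -
  have w: "w \<in> W" using assms Wgr_closed by simp
  have "strip_cond (set (row_word z r)) (al w)" unfolding strip_cond_def
  proof (intro allI impI)
    fix q t assume q: "run_start (set (row_word z r)) q t" and "in_res (set (row_word z r)) t"
    then obtain x where x: "z \<le> x" "x < z + int r" "n dvd t - x" by (auto simp: in_res_row_word)
    then obtain m where m: "t = x + n * m" by (metis add.commute diff_add_cancel dvd_def)
    have "run_start (set (row_word z r)) (z + n * m) t"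
      unfolding m using x run_start_row_word[OF assms(2)] by (intro run_start_shift) simp
    then have "q = z + n * m" using q run_start_unique by blast
    then have "al w q = al w z - m" using al_period[OF w, of z m] by simp
    moreover have "t + 1 = (x + 1) + n * m" using m by simp
    then have "al w (t + 1) = al w (x + 1) - m" using al_period[OF w, of "x + 1" m] by (simp only:)
    ultimately show "al w (t + 1) < al w q" using assms(3)[of "x + 1"] x by simp
  qed
  then show ?thesis using strip_cond_word[OF assms(1) row_word_words row_word_cyc[OF assms(2)]] by blast
qed

text \<open>The entry at z + r exceeds the r entries before it. Removing the letters of the row from
  the left lets it travel down to z, each exchange being a descent.\<close>

lemma row_word_descend:
  assumes "w \<in> Wgr k" "r \<le> k" "\<And>x. z \<le> x \<Longrightarrow> x < z + int r \<Longrightarrow> al w x < al w (z + int r)"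
  shows "\<exists>w'\<in>Wgr k. w = cl (row_word z r) \<cdot> w' \<and> ln w' + r = ln w"
  using assms
proof (induction r arbitrary: w)
  case 0
  then show ?case using Wgr_closed by (intro bexI[of _ w]) (auto simp: cl_Nil)
next
  case (Suc m)
  let ?p = "z + int m"
  have w: "w \<in> W" using Suc.prems Wgr_closed by simp
  have "al w ?p < al w (?p + 1)" using Suc.prems(3)[of ?p] by (simp add: ac_simps)
  then have d: "ln (S ?p \<cdot> w) < ln w" using al_less_iff Suc.prems(1) by blast
  let ?v = "S ?p \<cdot> w"
  have g: "?v \<in> Wgr k" using Wgr_descent Suc.prems(1) d by simp
  have "al ?v x < al ?v ?p" if x: "z \<le> x" "x < ?p" for x
  proof -
    have nd: "\<not> n dvd x - ?p" "\<not> n dvd x - ?p - 1"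
      using x Suc.prems(2) n_dvd_small[of "x - ?p"] n_dvd_small[of "x - ?p - 1"] by auto
    then have "al ?v x = al w x" "al ?v ?p = al w (?p + 1)"
      by (simp_all add: al_S[OF w] sg_cases)
    then show ?thesis using Suc.prems(3)[of x] x by (simp add: ac_simps)
  qed
  then obtain w' where w': "w' \<in> Wgr k" "?v = cl (row_word z m) \<cdot> w'" "ln w' + m = ln ?v"
    using Suc.IH[OF g] Suc.prems(2) by auto
  have "w = S ?p \<cdot> ?v" using w by simp
  then have "w = cl (row_word z (Suc m)) \<cdot> w'"
    unfolding w'(2) using w'(1) Wgr_closed by (simp add: cl_Cons m_assoc)
  moreover have "ln w' + Suc m = ln w" using w'(3) ln_s_mul[of "nat (?p mod n)" w] w d by auto
  ultimately show ?case using w'(1) by blast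
qed

section \<open>Bijection between bounded partitions and affine Grassmannian elements\<close>

lemma par_word_Nil: "par_word k [] = []"
  by (simp add: par_word_def)

lemma residue_row: "map (residue k i) (rev [1..<r + 1]) = row_word (1 - int i) r"
proof (induction r)
  case (Suc r)
  have "residue k i (Suc r) = nat ((1 - int i + int r) mod n)" by (simp add: residue_def algebra_simps)
  then show ?case using Suc by simp
qed simp

lemma par_word_snoc: "par_word k (la @ [r]) = row_word (- int (length la)) r @ par_word k la"
proof -
  have "map (\<lambda>i. map (residue k i) (rev [1..<(la @ [r]) ! (i - 1) + 1])) (rev [1..<length la + 1])
      = map (\<lambda>i. map (residue k i) (rev [1..<la ! (i - 1) + 1])) (rev [1..<length la + 1])"
    by (rule map_cong) (auto simp: nth_append)
  moreover have "rev [1..<length (la @ [r]) + 1] = (length la + 1) # rev [1..<length la + 1]" by simp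
  moreover have "(la @ [r]) ! (length la + 1 - 1) = r" by simp
  moreover have "map (residue k (length la + 1)) (rev [1..<r + 1]) = row_word (- int (length la)) r"
    using residue_row[of "length la + 1" r] by (simp del: upt_Suc)
  ultimately show ?thesis by (simp only: par_word_def list.map concat.simps)
qed

lemma par_word_words: "par_word k la \<in> words"
  by (induction la rule: rev_induct) (simp_all add: par_word_Nil par_word_snoc)

lemma par_elt_Nil: "par_elt k [] = \<epsilon>"
  by (simp add: par_elt_def par_word_Nil cl_Nil)

lemma par_elt_snoc: "par_elt k (la @ [r]) = cl (row_word (- int (length la)) r) \<cdot> par_elt k la"
  by (simp add: par_elt_def par_word_snoc cl_append)

lemma par_elt_closed: "par_elt k la \<in> W"
  by (simp add: par_elt_def par_word_words)

lemma Par_Nil: "[] \<in> Par k"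
  by (simp add: Par_def)

lemma Par_snoc: "la @ [r] \<in> Par k \<longleftrightarrow> la \<in> Par k \<and> 1 \<le> r \<and> r \<le> k \<and> (la \<noteq> [] \<longrightarrow> r \<le> last la)"
proof -
  have "(\<forall>x\<in>set la. r \<le> x) \<longleftrightarrow> (la \<noteq> [] \<longrightarrow> r \<le> last la)" if "sorted_wrt (\<ge>) la"
    using that by (cases la rule: rev_cases) (auto simp: sorted_wrt_append)
  then show ?thesis by (auto simp: Par_def sorted_wrt_append)
qed

text \<open>After \<open>m\<close> rows the first nonpositive entry of the sequence is a zero in position \<open>1 - m\<close>,
  and the number of consecutive zeros starting there is the length of the last row.\<close>

lemma par_elt_al:
  assumes "la \<in> Par k"
  shows "par_elt k la \<in> Wgr k"
    and "p < 1 - int (length la) + n \<Longrightarrow> 0 \<le> al (par_elt k la) p"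
    and "al (par_elt k la) (1 - int (length la)) = 0"
    and "la \<noteq> [] \<Longrightarrow> 1 - int (length la) \<le> p \<Longrightarrow> p \<le> int (last la) - int (length la) \<Longrightarrow>
      al (par_elt k la) p = 0"
    and "la \<noteq> [] \<Longrightarrow> 1 \<le> al (par_elt k la) (1 - int (length la) + int (last la))"
proof -
  have "par_elt k la \<in> Wgr k \<and>
    (\<forall>p<1 - int (length la) + n. 0 \<le> al (par_elt k la) p) \<and>
    al (par_elt k la) (1 - int (length la)) = 0 \<and>
    (la \<noteq> [] \<longrightarrow> (\<forall>p. 1 - int (length la) \<le> p \<and> p \<le> int (last la) - int (length la) \<longrightarrow>
        al (par_elt k la) p = 0) \<and>
      1 \<le> al (par_elt k la) (1 - int (length la) + int (last la)))"
    using assms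
  proof (induction la rule: rev_induct)
    case Nil
    have "0 \<le> al0 p" if "p < 1 + n" for p
    proof -
      have "(p - 1) div n < 1" using that by (intro div_n_less_one) simp
      then show ?thesis by (simp add: al0_def)
    qed
    then show ?case by (simp add: par_elt_Nil unit_Wgr al_unit) (simp add: al0_def)
  next
    case (snoc r la)
    let ?w = "par_elt k la" and ?m = "int (length la)"
    let ?v = "par_elt k (la @ [r])"
    have la: "la \<in> Par k" "1 \<le> r" "r \<le> k" "la \<noteq> [] \<longrightarrow> r \<le> last la" using snoc.prems Par_snoc by auto
    note IH = snoc.IH[OF la(1)]
    have w: "?w \<in> Wgr k" "?w \<in> W" using IH par_elt_closed by auto
    have v: "?v = cl (row_word (- ?m) r) \<cdot> ?w" by (rule par_elt_snoc)
    have zero: "al ?w x = 0" if x: "- ?m < x" "x \<le> - ?m + int r" for x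
    proof (cases "la = []")
      case True
      then have "(x - 1) div n = 0" using x la(3) by (intro div_pos_pos_trivial) auto
      then show ?thesis using True by (simp add: par_elt_Nil al_unit al0_def)
    next
      case False
      then show ?thesis using IH la(4) x by auto
    qed
    \<comment> \<open>The entry at -m is one more than the entry a period later, which is
      nonnegative by induction. It is the positive entry that the new row carries past r
      zeros.\<close>
    have "- ?m + n < 1 - ?m + n" by simp
    then have "0 \<le> al ?w (- ?m + n)" using IH by blast
    then have pos: "1 \<le> al ?w (- ?m)" using al_period1[OF w(2), of "- ?m"] by linarith
    have vg: "?v \<in> Wgr k" unfolding v
    proof (rule row_word_ascend[OF w(1) la(3)])
      fix x assume "- ?m < x" "x \<le> - ?m + int r"
      then show "al ?w x < al ?w (- ?m)" using zero[of x] pos by simp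
    qed
    note row = al_row_word[OF w(2) la(3), of "- ?m", folded v]
    have z: "al ?v p = 0" if "- ?m \<le> p" "p < - ?m + int r" for p
      using row(1)[OF that] zero[of "p + 1"] that by simp
    have one: "1 \<le> al ?v (- ?m + int r)" using row(2) pos by simp
    have nn: "0 \<le> al ?v p" if "- ?m \<le> p" "p < - ?m + n" for p
    proof -
      consider "p < - ?m + int r" | "p = - ?m + int r" | "- ?m + int r < p" by linarith
      then show ?thesis
      proof cases
        case 3
        then show ?thesis using row(3)[OF 3 that(2)] IH that by simp
      qed (use z that one in auto)
    qed
    have "0 \<le> al ?v p" if "p < - ?m + n" for p
      using al_nonneg_window[OF par_elt_closed nn that] .
    moreover have "al ?v (- ?m) = 0" using z[of "- ?m"] la by simp
    ultimately show ?case using vg z one by simp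
  qed
  then show "par_elt k la \<in> Wgr k"
    and "p < 1 - int (length la) + n \<Longrightarrow> 0 \<le> al (par_elt k la) p"
    and "al (par_elt k la) (1 - int (length la)) = 0"
    and "la \<noteq> [] \<Longrightarrow> 1 - int (length la) \<le> p \<Longrightarrow> p \<le> int (last la) - int (length la) \<Longrightarrow>
      al (par_elt k la) p = 0"
    and "la \<noteq> [] \<Longrightarrow> 1 \<le> al (par_elt k la) (1 - int (length la) + int (last la))"
    by blast+
qed

text \<open>The first zero cannot be to the left of a. If it were to the right, then a + n, with
  entry -1, would lie in the range of nonnegative entries.\<close>

lemma par_elt_length:
  assumes "la \<in> Par k" "al (par_elt k la) a = 0" "\<And>p. p < a \<Longrightarrow> 1 \<le> al (par_elt k la) p"
  shows "a = 1 - int (length la)"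
proof (rule ccontr)
  assume "a \<noteq> 1 - int (length la)"
  moreover have "\<not> 1 - int (length la) < a" using assms(3) par_elt_al(3)[OF assms(1)] by force
  ultimately have "a + n < 1 - int (length la) + n" by simp
  then have "0 \<le> al (par_elt k la) (a + n)" using par_elt_al(2)[OF assms(1)] by blast
  then show False using al_period1[OF par_elt_closed, of la a] assms(2) by simp
qed

lemma al_par_elt_pos:
  assumes "la \<in> Par k" "p < 1 - int (length la)" shows "1 \<le> al (par_elt k la) p"
  using par_elt_al(2)[OF assms(1)] assms(2) by (intro al_pos_below[OF par_elt_closed]) auto

text \<open>The number of rows and the last row can be read off from the sequence, so the last row
  can be cancelled from both sides.\<close>

lemma par_elt_inj: "inj_on (par_elt k) (Par k)"
proof (rule inj_onI)
  fix la mu assume "la \<in> Par k" "mu \<in> Par k" "par_elt k la = par_elt k mu"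
  then show "la = mu"
  proof (induction la arbitrary: mu rule: rev_induct)
    case Nil
    have "1 - int (length ([] :: nat list)) = 1 - int (length mu)"
      using Nil par_elt_al(3)[OF Nil(1)] al_par_elt_pos[OF Nil(1)] by (intro par_elt_length) auto
    then show ?case by simp
  next
    case (snoc r la)
    have len: "1 - int (length (la @ [r])) = 1 - int (length mu)"
      using snoc.prems par_elt_al(3)[OF snoc.prems(1)] al_par_elt_pos[OF snoc.prems(1)]
      by (intro par_elt_length) auto
    then obtain mu' r' where mu: "mu = mu' @ [r']" by (cases mu rule: rev_cases) auto
    have l: "length mu' = length la" using len mu by simp
    note f = par_elt_al(4,5)[OF snoc.prems(1)] par_elt_al(4,5)[OF snoc.prems(2)]
    have "\<not> r < r'" using f(2) f(3)[of "1 - int (length mu) + int r"] snoc.prems(3) mu l by auto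
    moreover have "\<not> r' < r" using f(4) f(1)[of "1 - int (length mu) + int r'"] snoc.prems(3) mu l by auto
    ultimately have r: "r' = r" by simp
    have "par_elt k la = par_elt k mu'"
      using snoc.prems(3) by (simp add: mu r l par_elt_snoc par_elt_closed)
    then show ?case using snoc.IH[of mu'] snoc.prems mu r by (simp add: Par_snoc)
  qed
qed

text \<open>Rows are split off: a is the first zero and r the distance to the first positive entry
  after it. The quotient has its first zero at a + 1 and is zero up to a + r, so r is at most the
  last row of its partition. If there is no positive entry in positions a, ..., a + k, the sequence
  is weakly decreasing, w has no left descent and is the unit.\<close>

lemma par_elt_surj: "w \<in> Wgr k \<Longrightarrow> \<exists>la\<in>Par k. par_elt k la = w"
proof (induction "ln w" arbitrary: w rule: less_induct)
  case less
  have w: "w \<in> W" using less.prems Wgr_closed by simp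
  obtain a where a: "al w a = 0" "\<And>p. p < a \<Longrightarrow> 1 \<le> al w p" using al_first_nonpos[OF w] by blast
  have nn: "0 \<le> al w p" if "p < a + n" for p
    using a(2)[of "p - n"] al_period1[OF w, of "p - n"] that by simp
  show ?case
  proof (cases "\<exists>r. 1 \<le> al w (a + int r) \<and> r \<le> k")
    case False
    have zero: "al w p = 0" if "a \<le> p" "p < a + n" for p
    proof -
      have "nat (p - a) \<le> k" "a + int (nat (p - a)) = p" using that by auto
      then have "\<not> 1 \<le> al w p" using False by metis
      then show ?thesis using nn[of p] that by simp
    qed
    have "al w (p + 1) \<le> al w p" for p
    proof -
      define p0 where "p0 = a + (p - a) mod n"
      define j where "j = (p - a) div n"
      have p: "p = p0 + n * j" "p + 1 = (p0 + 1) + n * j" by (simp_all add: p0_def j_def)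
      have b: "a \<le> p0" "p0 < a + n"
        using pos_mod_sign[of n "p - a"] pos_mod_bound[of n "p - a"] by (simp_all add: p0_def)
      have "al w (p0 + 1) \<le> al w p0"
      proof (cases "p0 + 1 < a + n")
        case True
        then show ?thesis using zero[of p0] zero[of "p0 + 1"] b by simp
      next
        case False
        then have "p0 + 1 = a + n" using b by simp
        then show ?thesis using zero[of p0] b al_period1[OF w, of a] a(1) by (simp only:)
      qed
      then show ?thesis using al_period[OF w, of p0 j] al_period[OF w, of "p0 + 1" j] p by (simp only:)
    qed
    then have "\<not> ln (S p \<cdot> w) < ln w" for p using al_less_iff[OF less.prems] by (metis not_le)
    then have "\<not> ln (s i \<cdot> w) < ln w" if "i \<le> k" for i using that by (metis S_nat)
    then have "w = \<epsilon>" using descent_exists[OF w] by blast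
    then show ?thesis using Par_Nil par_elt_Nil by blast
  next
    case True
    define r where "r = (LEAST r. 1 \<le> al w (a + int r) \<and> r \<le> k)"
    have r: "1 \<le> al w (a + int r)" "r \<le> k"
      unfolding r_def using LeastI_ex[OF True] by blast+
    have r1: "1 \<le> r" using r(1) a(1) by (cases r) auto
    have zero: "al w x = 0" if x: "a \<le> x" "x < a + int r" for x
    proof -
      have "\<not> 1 \<le> al w (a + int (nat (x - a)))"
        using not_less_Least[of "nat (x - a)" "\<lambda>r. 1 \<le> al w (a + int r) \<and> r \<le> k"] x r(2)
        unfolding r_def[symmetric] by auto
      then show ?thesis using nn[of x] x r(2) by simp
    qed
    obtain v where v: "v \<in> Wgr k" "w = cl (row_word a r) \<cdot> v" "ln v + r = ln w"
      using row_word_descend[OF less.prems r(2), of a] zero r(1) by fastforce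
    obtain la where la: "la \<in> Par k" "par_elt k la = v" using less.hyps v r1 by force
    have vW: "v \<in> W" using v Wgr_closed by simp
    note row = al_row_word[OF vW r(2), of a, folded v(2)]
    have vzero: "al v x = 0" if "a < x" "x \<le> a + int r" for x
      using row(1)[of "x - 1"] zero[of "x - 1"] that by simp
    have va: "1 \<le> al v a" using row(2) r(1) by simp
    have vnn: "0 \<le> al v p" if p: "a + 1 \<le> p" "p < a + 1 + n" for p
    proof -
      consider "p \<le> a + int r" | "a + int r < p" "p < a + n" | "p = a + n" using p by linarith
      then show ?thesis
      proof cases
        case 2
        then show ?thesis using row(3)[OF 2] nn[of p] by simp
      next
        case 3
        then show ?thesis using al_period1[OF vW, of a] va by simp
      qed (use vzero[of p] p in simp)
    qed
    have "a + 1 = 1 - int (length la)"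
      using la vzero[of "a + 1"] r1 al_pos_below[OF vW vnn] by (intro par_elt_length) auto
    then have len: "a = - int (length la)" by simp
    have "r \<le> last la" if ne: "la \<noteq> []"
    proof (rule ccontr)
      assume "\<not> r \<le> last la"
      then have "al v (1 - int (length la) + int (last la)) = 0" using len by (intro vzero) auto
      then show False using par_elt_al(5)[OF la(1) ne] la(2) by simp
    qed
    then have "la @ [r] \<in> Par k" using la r r1 by (simp add: Par_snoc)
    moreover have "par_elt k (la @ [r]) = w" using v(2) la(2) len by (simp add: par_elt_snoc)
    ultimately show ?thesis by blast
  qed
qed

section \<open>The Pieri formula\<close>

text \<open>The Pieri term of the word u with its sign; F will be the family extended by 0 outside
  the affine Grassmannian elements. The exponent is a true difference by
  \<open>ln_upw_le\<close>.\<close>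

definition twist :: "nat list \<Rightarrow> (nat list set \<Rightarrow> 'b :: comm_ring_1) \<Rightarrow> nat list set \<Rightarrow> 'b" where
  "twist u F x = (- 1) ^ (length u + ln x - ln (upw u x)) * F (upw u x)"

definition lower_sum :: "nat list set \<Rightarrow> (nat list set \<Rightarrow> 'b :: comm_ring_1) \<Rightarrow> 'b" where
  "lower_sum w F = (\<Sum>x | x \<preceq> w. F x)"

lemma ln_upw_le: "u \<in> words \<Longrightarrow> x \<in> W \<Longrightarrow> ln (upw u x) \<le> length u + ln x"
proof (induction u)
  case (Cons i u)
  then have "i \<le> k" "u \<in> words" "ln (upw u x) \<le> length u + ln x" by auto
  then show ?case using ln_s_le[of i "upw u x"] Cons.prems by (simp add: up_eq)
qed simp

text \<open>The last letter acts on x first: it raises x, or leaves x alone at the cost of a sign.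
  This is one factor \<tau>_j.\<close>

lemma twist_snoc:
  assumes "u \<in> words" "j \<le> k" "x \<in> W"
  shows "twist (u @ [j]) F x = (if ln x < ln (s j \<cdot> x) then twist u F (s j \<cdot> x) else - twist u F x)"
proof (cases "ln x < ln (s j \<cdot> x)")
  case True
  then have "ln (s j \<cdot> x) = ln x + 1" using ln_s_mul assms by force
  then show ?thesis using True assms by (simp add: twist_def up_eq)
next
  case False
  have "length u + 1 + ln x - ln (upw u x) = Suc (length u + ln x - ln (upw u x))"
    using ln_upw_le[OF assms(1,3)] by simp
  then show ?thesis using False assms by (simp add: twist_def up_eq)
qed

text \<open>The elements below \<open>up j w\<close> come in pairs x, s_j x, and by
  \<open>sle_up_iff\<close> a pair lies there iff its smaller member is below w.\<close>

lemma lower_sum_up: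
  assumes "w \<in> W" "j \<le> k"
  shows "lower_sum w (\<lambda>x. if ln x < ln (s j \<cdot> x) then F (s j \<cdot> x) else - F x)
    = lower_sum (up j w) F - lower_sum w F"
proof -
  let ?X = "{x. x \<preceq> w \<and> ln x < ln (s j \<cdot> x)}"
  have fin: "finite {x. x \<preceq> w}" using finite_sle assms by simp
  have W: "x \<in> W" if "x \<preceq> w" for x using that sle_closed' assms by blast
  have sx: "ln (s j \<cdot> x) \<noteq> ln x" if "x \<in> W" for x using ln_s_mul[OF assms(2) that] by auto
  have dn1: "dn j x = x" "dn j (s j \<cdot> x) = x" if "x \<in> W" "ln x < ln (s j \<cdot> x)" for x
    using that assms by (simp_all add: dn_def)
  have inj: "inj_on (\<lambda>x. s j \<cdot> x) ?X"
  proof (rule inj_onI)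
    fix x y assume "x \<in> ?X" "y \<in> ?X" "s j \<cdot> x = s j \<cdot> y"
    then show "x = y" using W assms(2) by (metis (no_types, lifting) mem_Collect_eq s_s_left)
  qed
  have split: "{y. y \<preceq> up j w} = ?X \<union> (\<lambda>x. s j \<cdot> x) ` ?X"
  proof (rule Set.set_eqI, rule iffI)
    fix y assume "y \<in> {y. y \<preceq> up j w}"
    then have y: "y \<preceq> up j w" "y \<in> W" using sle_closed' assms by auto
    then have d: "dn j y \<preceq> w" using sle_up_iff assms by blast
    show "y \<in> ?X \<union> (\<lambda>x. s j \<cdot> x) ` ?X"
    proof (cases "ln (s j \<cdot> y) < ln y")
      case True
      then have "s j \<cdot> y \<in> ?X" using d y assms by (simp add: dn_def)
      moreover have "y = s j \<cdot> (s j \<cdot> y)" using y assms by simp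
      ultimately show ?thesis by blast
    next
      case False
      then show ?thesis using d sx[OF y(2)] by (simp add: dn_def)
    qed
  next
    fix y assume "y \<in> ?X \<union> (\<lambda>x. s j \<cdot> x) ` ?X"
    then obtain x where x: "x \<preceq> w" "ln x < ln (s j \<cdot> x)" "y = x \<or> y = s j \<cdot> x" by blast
    then have "dn j y = x" "y \<in> W" using dn1[OF W[OF x(1)] x(2)] W[OF x(1)] assms by auto
    then show "y \<in> {y. y \<preceq> up j w}" using x(1) sle_up_iff assms by simp
  qed
  have disj: "?X \<inter> (\<lambda>x. s j \<cdot> x) ` ?X = {}"
    using W assms(2) by (auto simp: disjoint_iff)
  have "lower_sum (up j w) F = (\<Sum>x\<in>?X. F x) + (\<Sum>x\<in>?X. F (s j \<cdot> x))"
    unfolding lower_sum_def split using fin disj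
    by (subst sum.union_disjoint) (auto simp: sum.reindex[OF inj])
  \<comment> \<open>An x below w with s_j x < x contributes F x - F x = 0, so the range can be
    enlarged to all x below w.\<close>
  also have "\<dots> = (\<Sum>x | x \<preceq> w. F x + (if ln x < ln (s j \<cdot> x) then F (s j \<cdot> x) else - F x))"
    unfolding sum.distrib[symmetric] by (rule sum.mono_neutral_cong_left) (use fin in auto)
  also have "\<dots> = lower_sum w F + lower_sum w (\<lambda>x. if ln x < ln (s j \<cdot> x) then F (s j \<cdot> x) else - F x)"
    unfolding lower_sum_def by (rule sum.distrib)
  finally show ?thesis by (simp add: algebra_simps)
qed

text \<open>Each letter of the word contributes a factor \<open>D\<^sub>i - 1\<close>, where \<open>D\<^sub>i\<close> replaces the sum over
  the elements below \<open>w\<close> by the sum over the elements below \<open>s\<^sub>i * w\<close>.\<close>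

lemma lower_sum_twist:
  assumes "w \<in> W" "u \<in> words" "distinct u"
  shows "lower_sum w (twist u F)
    = (\<Sum>B\<in>Pow (set u). (- 1) ^ card (set u - B) * lower_sum (upw (filter (\<lambda>i. i \<in> B) u) w) F)"
  using assms
proof (induction u arbitrary: w rule: rev_induct)
  case Nil
  have "twist [] F x = F x" for x by (simp add: twist_def)
  then show ?case by simp
next
  case (snoc j u)
  have u: "u \<in> words" "j \<le> k" "distinct u" "j \<notin> set u" using snoc.prems by auto
  have w: "w \<in> W" by fact
  let ?t = "\<lambda>B v. (- 1) ^ card (set u - B) * lower_sum (upw (filter (\<lambda>i. i \<in> B) u) v) F"
  let ?T = "\<lambda>B. (- 1) ^ card (set (u @ [j]) - B)
      * lower_sum (upw (filter (\<lambda>i. i \<in> B) (u @ [j])) w) F"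
  have f: "filter (\<lambda>i. i \<in> insert j B) u = filter (\<lambda>i. i \<in> B) u" for B
    using u(4) by (intro filter_cong) auto
  have 1: "?T (insert j B) = ?t B (up j w)" if "B \<in> Pow (set u)" for B
  proof -
    have "set (u @ [j]) - insert j B = set u - B" using u(4) by auto
    then show ?thesis using f by simp
  qed
  have 2: "?T B = - ?t B w" if "B \<in> Pow (set u)" for B
  proof -
    have "set (u @ [j]) - B = insert j (set u - B)" "j \<notin> B" using u(4) that by auto
    then show ?thesis using u(4) by simp
  qed
  have inj: "inj_on (insert j) (Pow (set u))" using u(4) by (auto simp: inj_on_def)
  have "lower_sum w (twist (u @ [j]) F)
      = lower_sum w (\<lambda>x. if ln x < ln (s j \<cdot> x) then twist u F (s j \<cdot> x) else - twist u F x)"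
    unfolding lower_sum_def using twist_snoc u sle_closed' w by (intro sum.cong) blast+
  also have "\<dots> = lower_sum (up j w) (twist u F) - lower_sum w (twist u F)"
    by (rule lower_sum_up) (use w u in auto)
  also have "\<dots> = (\<Sum>B\<in>Pow (set u). ?t B (up j w)) - (\<Sum>B\<in>Pow (set u). ?t B w)"
    using snoc.IH u w by simp
  also have "\<dots> = (\<Sum>B\<in>Pow (set u). ?T (insert j B)) + (\<Sum>B\<in>Pow (set u). ?T B)"
    using 1 2 by (simp add: sum_negf)
  also have "\<dots> = (\<Sum>B\<in>Pow (set (u @ [j])). ?T B)"
  proof -
    have "Pow (set (u @ [j])) = Pow (set u) \<union> insert j ` Pow (set u)" by (simp add: Pow_insert)
    moreover have "Pow (set u) \<inter> insert j ` Pow (set u) = {}" using u(4) by auto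
    ultimately show ?thesis by (simp only: sum.union_disjoint finite_Pow_iff finite_imageI List.finite_set
          sum.reindex[OF inj] comp_def add.commute)
  qed
  finally show ?case .
qed

lemma lower_sum_twist_cyc:
  assumes "w \<in> W" "A \<subset> {..k}"
  shows "lower_sum w (twist (cyc_word A) F)
    = (\<Sum>B\<in>Pow A. (- 1) ^ card (A - B) * lower_sum (upw (cyc_word B) w) F)"
proof -
  note cw = cyc_word[OF assms(2)]
  have "upw (filter (\<lambda>i. i \<in> B) (cyc_word A)) w = upw (cyc_word B) w" if "B \<subseteq> A" for B
  proof -
    have "set (filter (\<lambda>i. i \<in> B) (cyc_word A)) = B" using cw(1) that by auto
    then show ?thesis
      using upw_cyc[OF cyc_decreasing_filter[OF cw(2)], of "\<lambda>i. i \<in> B" w] assms that by auto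
  qed
  then show ?thesis using lower_sum_twist[OF assms(1) cw(3,4), of F] cw(1) by simp
qed

text \<open>Ensures that the Pieri rule for the zero extension also holds at x outside
  \<open>Wgr k\<close>: all terms on the right vanish there too.\<close>

lemma upw_Wgr: "u \<in> words \<Longrightarrow> x \<in> W \<Longrightarrow> upw u x \<in> Wgr k \<Longrightarrow> x \<in> Wgr k"
proof (induction u)
  case (Cons i u)
  then have i: "i \<le> k" "upw u x \<in> W" by auto
  have "upw u x \<in> Wgr k"
  proof (cases "ln (upw u x) < ln (s i \<cdot> upw u x)")
    case True
    then have "s i \<cdot> upw u x \<in> Wgr k" using Cons.prems i by (simp add: up_eq)
    then show ?thesis using Wgr_descent[of "s i \<cdot> upw u x" i] True i by simp
  qed (use Cons.prems i in \<open>simp add: up_eq\<close>)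
  then show ?case using Cons by simp
qed simp

text \<open>For fixed A the inner sum runs over the interval from C to A in the Boolean lattice, so
  only A = C survives, and it is counted iff C has at most r elements.\<close>

lemma index_set_coefficient:
  assumes x: "x \<in> W" and w: "w \<in> W" and r: "r \<le> k"
  shows "(\<Sum>A | A \<subset> {..k} \<and> card A \<le> r. \<Sum>B\<in>Pow A. (- 1) ^ card (A - B)
      * (if x \<preceq> upw (cyc_word B) w then 1 else 0))
    = (if \<exists>B. B \<subset> {..k} \<and> card B \<le> r \<and> x \<preceq> upw (cyc_word B) w then 1 else 0 :: 'a :: comm_ring_1)"
proof (cases "\<exists>B. B \<subset> {..k} \<and> x \<preceq> upw (cyc_word B) w")
  case True
  then obtain B0 where B0: "B0 \<subset> {..k}" "x \<preceq> upw (cyc_word B0) w" by blast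
  obtain C where "C \<subseteq> B0"
    and C': "\<forall>A. A \<subset> {..k} \<longrightarrow> (x \<preceq> upw (cyc_word A) w \<longleftrightarrow> C \<subseteq> A)"
    using minimal_index_set[OF x w B0] by metis
  then have C: "C \<subset> {..k}" "\<And>A. A \<subset> {..k} \<Longrightarrow> x \<preceq> upw (cyc_word A) w \<longleftrightarrow> C \<subseteq> A"
    using B0(1) by simp_all
  have "(\<Sum>B\<in>Pow A. (- 1) ^ card (A - B) * (if x \<preceq> upw (cyc_word B) w then 1 else 0))
      = (if A = C then 1 else 0 :: 'a)" if A: "A \<subset> {..k}" for A
  proof -
    have fA: "finite A" using A finite_subset by blast
    have "(\<Sum>B\<in>Pow A. (- 1) ^ card (A - B) * (if x \<preceq> upw (cyc_word B) w then 1 else 0))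
        = (\<Sum>B | C \<subseteq> B \<and> B \<subseteq> A. (- 1) ^ card (A - B) :: 'a)"
      using fA C(2) A by (intro sum.mono_neutral_cong_right) auto
    also have "\<dots> = (if A = C then 1 else 0)"
    proof (cases "C \<subseteq> A")
      case True
      then show ?thesis by (rule sum_alternating_interval[OF fA])
    next
      case False
      then have "{B. C \<subseteq> B \<and> B \<subseteq> A} = {}" by auto
      then show ?thesis using False by (simp only: sum.empty) auto
    qed
    finally show ?thesis .
  qed
  then have "(\<Sum>A | A \<subset> {..k} \<and> card A \<le> r. \<Sum>B\<in>Pow A. (- 1) ^ card (A - B)
      * (if x \<preceq> upw (cyc_word B) w then 1 else 0))
    = (\<Sum>A | A \<subset> {..k} \<and> card A \<le> r. if A = C then 1 else 0 :: 'a)"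
    by (intro sum.cong) auto
  also have "\<dots> = (if card C \<le> r then 1 else 0)"
  proof -
    have "finite {A. A \<subset> {..k} \<and> card A \<le> r}" by (rule finite_subset[of _ "Pow {..k}"]) auto
    then show ?thesis using C(1) by simp
  qed
  also have "card C \<le> r \<longleftrightarrow> (\<exists>B. B \<subset> {..k} \<and> card B \<le> r \<and> x \<preceq> upw (cyc_word B) w)"
  proof
    assume "\<exists>B. B \<subset> {..k} \<and> card B \<le> r \<and> x \<preceq> upw (cyc_word B) w"
    then obtain B where B: "B \<subset> {..k}" "card B \<le> r" "C \<subseteq> B" using C(2) by metis
    then have "card C \<le> card B" using finite_subset[of B "{..k}"] by (intro card_mono) auto
    then show "card C \<le> r" using B by simp
  qed (use C in blast)
  finally show ?thesis .
next
  case False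
  then have "x \<preceq> upw (cyc_word B) w \<longleftrightarrow> False" if "B \<subseteq> A" "A \<subset> {..k}" for A B using that by blast
  then have "(\<Sum>A | A \<subset> {..k} \<and> card A \<le> r. \<Sum>B\<in>Pow A. (- 1) ^ card (A - B)
      * (if x \<preceq> upw (cyc_word B) w then 1 else 0 :: 'a)) = 0"
    by (intro sum.neutral ballI) auto
  then show ?thesis using False by auto
qed

section \<open>Translation to partitions, meets and weak strips\<close>

lemma weak_strips_iff:
  assumes "lam \<in> Par k"
  shows "weak_strips k lam r = {A. strip (par_elt k lam) A \<and> card A = r}"
proof -
  have "lweak_le k (par_elt k lam) (dA k A \<cdot> par_elt k lam)
      \<longleftrightarrow> ln (dA k A \<cdot> par_elt k lam) = ln (par_elt k lam) + card A" if "A \<subset> {..k}" for A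
  proof -
    have d: "dA k A \<in> W" using cyc_word(3)[OF that] by (simp add: dA_cyc_word)
    have "dA k A \<cdot> par_elt k lam \<cdot> inve (par_elt k lam) = dA k A"
      using d par_elt_closed by (simp add: m_assoc)
    then show ?thesis using cyc_word(6)[OF that] by (auto simp: lweak_le_def dA_cyc_word)
  qed
  then show ?thesis by (auto simp: weak_strips_def act_defined_def strip_def)
qed

lemma strip_act:
  assumes "lam \<in> Par k" "strip (par_elt k lam) A"
  shows "act_defined k A lam" "act k A lam \<in> Par k"
    "par_elt k (act k A lam) = dA k A \<cdot> par_elt k lam"
proof -
  show "act_defined k A lam" using assms(2) by (simp add: strip_def act_defined_def)
  have g: "dA k A \<cdot> par_elt k lam \<in> Wgr k" using assms(2) by (simp add: strip_def)
  have "\<exists>!mu. mu \<in> Par k \<and> par_elt k mu = dA k A \<cdot> par_elt k lam"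
    using par_elt_surj[OF g] inj_onD[OF par_elt_inj] by metis
  from theI'[OF this] show "act k A lam \<in> Par k" "par_elt k (act k A lam) = dA k A \<cdot> par_elt k lam"
    unfolding act_def by simp_all
qed

lemma gtilde_eq:
  assumes "la \<in> Par k"
  shows "gtilde k g la = (\<Sum>x | x \<in> Wgr k \<and> x \<preceq> par_elt k la. g x)"
proof -
  let ?M = "{mu. mu \<in> Par k \<and> mu \<sqsubseteq>\<^bsub>par_poset k\<^esub> la}"
  have "inj_on (par_elt k) ?M" by (rule inj_on_subset[OF par_elt_inj]) auto
  moreover have "par_elt k ` ?M = {x. x \<in> Wgr k \<and> x \<preceq> par_elt k la}"
    using par_elt_surj par_elt_al(1) by (fastforce simp: par_poset_def)
  ultimately have "bij_betw (par_elt k) ?M {x. x \<in> Wgr k \<and> x \<preceq> par_elt k la}"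
    by (simp add: bij_betw_def)
  then show ?thesis unfolding gtilde_def by (rule sum.reindex_bij_betw)
qed

text \<open>One minimal index set C for x serves all members of the family at once; it is contained
  in all of them iff it is contained in their intersection.\<close>

lemma sle_dA_Inter_iff:
  assumes w: "w \<in> Wgr k" and A: "\<A> \<noteq> {}" "\<And>A. A \<in> \<A> \<Longrightarrow> strip w A" and x: "x \<in> W"
  shows "x \<preceq> dA k (\<Inter>\<A>) \<cdot> w \<longleftrightarrow> (\<forall>A\<in>\<A>. x \<preceq> dA k A \<cdot> w)"
proof -
  have wW: "w \<in> W" using w Wgr_closed by simp
  have sI: "strip w (\<Inter>\<A>)" using strip_Inter w A by blast
  show ?thesis
  proof
    assume L: "x \<preceq> dA k (\<Inter>\<A>) \<cdot> w"
    show "\<forall>A\<in>\<A>. x \<preceq> dA k A \<cdot> w"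
      using sle_trans[OF L dA_mono[OF wW _ sI]] A(2) by blast
  next
    assume R: "\<forall>A\<in>\<A>. x \<preceq> dA k A \<cdot> w"
    have up: "x \<preceq> upw (cyc_word A) w" if "A \<in> \<A>" for A using R that strip_upw[OF wW A(2)] by simp
    have sub: "A \<subset> {..k}" if "A \<in> \<A>" for A using A(2)[OF that] by (simp add: strip_def)
    obtain A0 where "A0 \<in> \<A>" using A(1) by blast
    then obtain C where C: "\<forall>A. A \<subset> {..k} \<longrightarrow> (x \<preceq> upw (cyc_word A) w \<longleftrightarrow> C \<subseteq> A)"
      using minimal_index_set[OF x wW sub up] by metis
    then have "C \<subseteq> A" if "A \<in> \<A>" for A using up[OF that] sub[OF that] by simp
    then have "C \<subseteq> \<Inter>\<A>" by (rule Inter_greatest)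
    then have "x \<preceq> upw (cyc_word (\<Inter>\<A>)) w" using C sI by (simp add: strip_def)
    then show "x \<preceq> dA k (\<Inter>\<A>) \<cdot> w" using strip_upw[OF wW sI] by simp
  qed
qed

text \<open>Passes from the index sets of size at most r in the coefficient formula to weak strips
  of size exactly r: \<open>strip_below\<close> shrinks B to a strip,
  \<open>strip_extend_card\<close> enlarges that strip.\<close>

lemma strip_above_iff:
  assumes w: "w \<in> Wgr k" and x: "x \<in> Wgr k" and r: "r \<le> k"
  shows "(\<exists>B. B \<subset> {..k} \<and> card B \<le> r \<and> x \<preceq> upw (cyc_word B) w) \<longleftrightarrow>
    (\<exists>A. strip w A \<and> card A = r \<and> x \<preceq> dA k A \<cdot> w)"
proof
  have wW: "w \<in> W" using w Wgr_closed by simp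
  {
    assume "\<exists>B. B \<subset> {..k} \<and> card B \<le> r \<and> x \<preceq> upw (cyc_word B) w"
    then obtain B where B: "B \<subset> {..k}" "card B \<le> r" "x \<preceq> upw (cyc_word B) w" by blast
    then obtain C where C: "C \<subseteq> B" "strip w C" "x \<preceq> dA k C \<cdot> w"
      using strip_below[OF w B(1) x B(3)] by blast
    have "card C \<le> card B" using C(1) B(1) finite_subset[of B "{..k}"] by (intro card_mono) auto
    then obtain A where A: "C \<subseteq> A" "strip w A" "card A = r"
      using strip_extend_card[OF w C(2) _ r] B(2) by auto
    have "x \<preceq> dA k A \<cdot> w" by (rule sle_trans[OF C(3) dA_mono[OF wW A(2) C(2) A(1)]])
    then show "\<exists>A. strip w A \<and> card A = r \<and> x \<preceq> dA k A \<cdot> w" using A by blast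
  next
    assume "\<exists>A. strip w A \<and> card A = r \<and> x \<preceq> dA k A \<cdot> w"
    then obtain A where A: "strip w A" "card A = r" "x \<preceq> dA k A \<cdot> w" by blast
    then have "A \<subset> {..k}" "x \<preceq> upw (cyc_word A) w"
      using strip_upw[OF wW A(1)] by (simp_all add: strip_def)
    then show "\<exists>B. B \<subset> {..k} \<and> card B \<le> r \<and> x \<preceq> upw (cyc_word B) w" using A(2) by blast
  }
qed

lemma KkSchur_pieri:
  assumes g: "is_KkSchur k g" and x: "x \<in> Wgr k" and i: "i \<le> k"
  defines "F \<equiv> \<lambda>x. if x \<in> Wgr k then g x else 0"
  shows "hsym i * g x = (\<Sum>A | A \<subset> {..k} \<and> card A = i. twist (cyc_word A) F x)"
\<comment> \<open>The defining rule starts at 1. For i = 0 the only index set is empty and h_0 =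
  1.\<close>
proof (cases "i = 0")
  case True
  have "{A. A \<subset> {..k} \<and> card A = i} = {{}}"
    using True finite_subset by (auto simp: card_eq_0_iff)
  moreover have "cyc_word {} = []" using cyc_word(1)[of "{}"] by auto
  ultimately show ?thesis using True x by (simp add: hsym_0 twist_def F_def)
next
  case False
  have xW: "x \<in> W" using x Wgr_closed by simp
  have fin: "finite {A. A \<subset> {..k} \<and> card A = i}" by (rule finite_subset[of _ "Pow {..k}"]) auto
  have "hsym i * g x = (\<Sum>A | A \<subset> {..k} \<and> card A = i \<and> demazure k (dA k A) x \<in> Wgr k.
      (- 1) ^ (i + ln x - ln (demazure k (dA k A) x)) * g (demazure k (dA k A) x))"
    using g x i False unfolding is_KkSchur_def by auto
  also have "\<dots> = (\<Sum>A | A \<subset> {..k} \<and> card A = i. twist (cyc_word A) F x)"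
  proof (rule sum.mono_neutral_cong_left[OF fin])
    have d: "demazure k (dA k A) x = upw (cyc_word A) x" "length (cyc_word A) = i"
      if "A \<subset> {..k}" "card A = i" for A
      using demazure_dA xW cyc_word(5) that by simp_all
    show "\<forall>A\<in>{A. A \<subset> {..k} \<and> card A = i} - {A. A \<subset> {..k} \<and> card A = i \<and>
        demazure k (dA k A) x \<in> Wgr k}. twist (cyc_word A) F x = 0"
      using d by (simp add: twist_def F_def)
    show "(- 1) ^ (i + ln x - ln (demazure k (dA k A) x)) * g (demazure k (dA k A) x)
        = twist (cyc_word A) F x"
      if "A \<in> {A. A \<subset> {..k} \<and> card A = i \<and> demazure k (dA k A) x \<in> Wgr k}" for A
      using d[of A] that by (simp add: twist_def F_def)
  qed blast
  finally show ?thesis .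
qed

text \<open>U is one finite range for all lower sets that occur. Writing their sums as sums over U
  with indicators allows the summations to be exchanged and \<open>index_set_coefficient\<close> to
  be applied to each x.\<close>

lemma gtilde_htilde:
  assumes g: "is_KkSchur k g" and lam: "lam \<in> Par k" and r: "r \<le> k"
    and U: "finite U" "U \<subseteq> W" "\<And>B x. B \<subset> {..k} \<Longrightarrow> x \<preceq> upw (cyc_word B) (par_elt k lam) \<Longrightarrow> x \<in> U"
  shows "gtilde k g lam * htilde r = (\<Sum>x\<in>U. if x \<in> Wgr k then
    g x * (if \<exists>A. strip (par_elt k lam) A \<and> card A = r \<and> x \<preceq> dA k A \<cdot> par_elt k lam then 1 else 0) else 0)"
proof -
  define w where "w = par_elt k lam"
  define F where "F = (\<lambda>x. if x \<in> Wgr k then g x else 0)"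
  let ?I = "{A. A \<subset> {..k} \<and> card A \<le> r}"
  have w: "w \<in> W" "w \<in> Wgr k" using lam par_elt_closed par_elt_al(1) by (auto simp: w_def)
  have finI: "finite ?I" by (rule finite_subset[of _ "Pow {..k}"]) auto
  have mul: "F x * htilde r = (\<Sum>A\<in>?I. twist (cyc_word A) F x)" if x: "x \<in> W" for x
  proof (cases "x \<in> Wgr k")
    case True
    have "F x * htilde r = (\<Sum>i=0..r. hsym i * g x)"
      using True by (simp add: F_def htilde_def sum_distrib_left mult.commute)
    also have "\<dots> = (\<Sum>i=0..r. \<Sum>A | A \<subset> {..k} \<and> card A = i. twist (cyc_word A) F x)"
      using KkSchur_pieri[OF g True] r by (intro sum.cong) (auto simp: F_def)
    also have "\<dots> = (\<Sum>i=0..r. \<Sum>A | A \<in> ?I \<and> card A = i. twist (cyc_word A) F x)"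
      by (intro sum.cong) auto
    also have "\<dots> = (\<Sum>A\<in>?I. twist (cyc_word A) F x)"
      using finI by (intro sum.group) auto
    finally show ?thesis .
  next
    case False
    have "twist (cyc_word A) F x = 0" if "A \<in> ?I" for A
      using upw_Wgr[of "cyc_word A" x] cyc_word(3)[of A] that x False by (auto simp: twist_def F_def)
    then show ?thesis using False by (simp add: F_def)
  qed
  have lsF: "lower_sum w F = gtilde k g lam"
  proof -
    have "(\<Sum>x | x \<in> Wgr k \<and> x \<preceq> w. g x) = lower_sum w F" unfolding lower_sum_def
      using finite_sle[OF w(1)] by (intro sum.mono_neutral_cong_left) (auto simp: F_def)
    then show ?thesis using gtilde_eq[OF lam] by (simp add: w_def)
  qed
  have ls: "lower_sum (upw (cyc_word B) w) F
      = (\<Sum>x\<in>U. F x * (if x \<preceq> upw (cyc_word B) w then 1 else 0))" if "B \<subset> {..k}" for B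
    unfolding lower_sum_def using U(1) U(3)[OF that] by (intro sum.mono_neutral_cong_left) (auto simp: w_def)
  have "gtilde k g lam * htilde r = (\<Sum>x | x \<preceq> w. F x * htilde r)"
    unfolding lsF[symmetric] by (simp add: lower_sum_def sum_distrib_right)
  also have "\<dots> = (\<Sum>x | x \<preceq> w. \<Sum>A\<in>?I. twist (cyc_word A) F x)"
    using mul sle_closed' w(1) by (intro sum.cong) auto
  also have "\<dots> = (\<Sum>A\<in>?I. lower_sum w (twist (cyc_word A) F))"
    unfolding lower_sum_def by (rule sum.swap)
  also have "\<dots> = (\<Sum>A\<in>?I. \<Sum>B\<in>Pow A. (- 1) ^ card (A - B)
      * (\<Sum>x\<in>U. F x * (if x \<preceq> upw (cyc_word B) w then 1 else 0)))"
  proof (rule sum.cong)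
    fix A assume A: "A \<in> ?I"
    then have "lower_sum w (twist (cyc_word A) F)
        = (\<Sum>B\<in>Pow A. (- 1) ^ card (A - B) * lower_sum (upw (cyc_word B) w) F)"
      using lower_sum_twist_cyc w(1) by blast
    also have "\<dots> = (\<Sum>B\<in>Pow A. (- 1) ^ card (A - B)
      * (\<Sum>x\<in>U. F x * (if x \<preceq> upw (cyc_word B) w then 1 else 0)))"
    proof (rule sum.cong)
      fix B assume "B \<in> Pow A"
      then have "B \<subset> {..k}" using A by auto
      then show "(- 1) ^ card (A - B) * lower_sum (upw (cyc_word B) w) F = (- 1) ^ card (A - B)
          * (\<Sum>x\<in>U. F x * (if x \<preceq> upw (cyc_word B) w then 1 else 0))"
        using ls by simp
    qed simp
    finally show "lower_sum w (twist (cyc_word A) F) = (\<Sum>B\<in>Pow A. (- 1) ^ card (A - B)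
      * (\<Sum>x\<in>U. F x * (if x \<preceq> upw (cyc_word B) w then 1 else 0)))" .
  qed simp
  also have "\<dots> = (\<Sum>A\<in>?I. \<Sum>B\<in>Pow A. \<Sum>x\<in>U. F x * ((- 1) ^ card (A - B)
      * (if x \<preceq> upw (cyc_word B) w then 1 else 0)))"
    by (simp only: sum_distrib_left mult.left_commute)
  also have "\<dots> = (\<Sum>A\<in>?I. \<Sum>x\<in>U. \<Sum>B\<in>Pow A. F x * ((- 1) ^ card (A - B)
      * (if x \<preceq> upw (cyc_word B) w then 1 else 0)))"
    by (intro sum.cong HOL.refl sum.swap)
  also have "\<dots> = (\<Sum>x\<in>U. \<Sum>A\<in>?I. \<Sum>B\<in>Pow A. F x * ((- 1) ^ card (A - B)
      * (if x \<preceq> upw (cyc_word B) w then 1 else 0)))"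
    by (rule sum.swap)
  also have "\<dots> = (\<Sum>x\<in>U. F x *
      (if \<exists>B. B \<subset> {..k} \<and> card B \<le> r \<and> x \<preceq> upw (cyc_word B) w then 1 else 0))"
  proof (rule sum.cong)
    fix x assume "x \<in> U"
    then have x: "x \<in> W" using U(2) by blast
    show "(\<Sum>A\<in>?I. \<Sum>B\<in>Pow A. F x * ((- 1) ^ card (A - B)
        * (if x \<preceq> upw (cyc_word B) w then 1 else 0)))
      = F x * (if \<exists>B. B \<subset> {..k} \<and> card B \<le> r \<and> x \<preceq> upw (cyc_word B) w then 1 else 0)"
      unfolding index_set_coefficient[OF x w(1) r, symmetric] by (simp only: sum_distrib_left)
  qed simp
  also have "\<dots> = (\<Sum>x\<in>U. if x \<in> Wgr k then
    g x * (if \<exists>A. strip w A \<and> card A = r \<and> x \<preceq> dA k A \<cdot> w then 1 else 0) else 0)"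
    using strip_above_iff[OF w(2) _ r] by (intro sum.cong) (auto simp: F_def)
  finally show ?thesis unfolding w_def .
qed

end

theorem theorem1p3:
  fixes k r :: nat and lam :: "nat list" and As :: "nat set list"
    and g :: "nat list set \<Rightarrow> pseries"
  assumes "1 \<le> k"
    and "is_KkSchur k g"
    and "lam \<in> Par k"
    and "1 \<le> r" and "r \<le> k"
    and "distinct As" and "set As = weak_strips k lam r"
  shows "(\<forall>S. S \<subseteq> {..<length As} \<and> S \<noteq> {} \<longrightarrow>
            act_defined k (\<Inter>a\<in>S. As ! a) lam \<and>
            is_glb (par_poset k) (act k (\<Inter>a\<in>S. As ! a) lam) ((\<lambda>a. act k (As ! a) lam) ` S)) \<and>
         gtilde k g lam * htilde r =
           (\<Sum>m = 1..length As. (- 1) ^ (m - 1) *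
              (\<Sum>S | S \<subseteq> {..<length As} \<and> card S = m.
                 gtilde k g (act k (\<Inter>a\<in>S. As ! a) lam)))"
proof -
  interpret affine k by (rule affine.intro) fact
  define w where "w = par_elt k lam"
  have w: "w \<in> Wgr k" "w \<in> W" using par_elt_al(1) par_elt_closed assms(3) by (auto simp: w_def)
  have As: "strip w A \<and> card A = r \<longleftrightarrow> A \<in> set As" for A
    using assms(3,7) weak_strips_iff by (simp add: w_def)
  define N where "N = length As"
  have strips: "strip w (As ! a)" if "a < N" for a
    using As[of "As ! a"] that by (simp add: N_def)
  have strip_S: "strip w (\<Inter>a\<in>S. As ! a)" if "S \<subseteq> {..<N}" "S \<noteq> {}" for S
    using strips that by (intro strip_Inter w) auto
  have le_S: "x \<preceq> dA k (\<Inter>a\<in>S. As ! a) \<cdot> w \<longleftrightarrow> (\<forall>a\<in>S. x \<preceq> dA k (As ! a) \<cdot> w)"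
    if "S \<subseteq> {..<N}" "S \<noteq> {}" "x \<in> W" for S x
  proof -
    have "x \<preceq> dA k (\<Inter>((\<lambda>a. As ! a) ` S)) \<cdot> w \<longleftrightarrow> (\<forall>A\<in>(\<lambda>a. As ! a) ` S. x \<preceq> dA k A \<cdot> w)"
      using strips that by (intro sle_dA_Inter_iff[OF w(1)]) auto
    then show ?thesis by simp
  qed
  note act = strip_act[OF assms(3), folded w_def]
  have glb: "act_defined k (\<Inter>a\<in>S. As ! a) lam \<and>
      is_glb (par_poset k) (act k (\<Inter>a\<in>S. As ! a) lam) ((\<lambda>a. act k (As ! a) lam) ` S)"
    if S: "S \<subseteq> {..<N}" "S \<noteq> {}" for S
  proof
    show "act_defined k (\<Inter>a\<in>S. As ! a) lam" using act(1) strip_S[OF S] .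
    have aS: "act k (As ! a) lam \<in> Par k" "par_elt k (act k (As ! a) lam) = dA k (As ! a) \<cdot> w"
      if "a \<in> S" for a
      using act(2,3)[OF strips] S that by auto
    have iff: "strong_le k (par_elt k mu) (par_elt k (act k (\<Inter>a\<in>S. As ! a) lam)) \<longleftrightarrow>
        (\<forall>a\<in>S. strong_le k (par_elt k mu) (par_elt k (act k (As ! a) lam)))" for mu
      using le_S[OF S par_elt_closed, of mu] act(3)[OF strip_S[OF S]] aS(2) by simp
    \<comment> \<open>The instance of \<open>iff\<close> at the candidate itself gives a lower
      bound, the general one that it is the greatest.\<close>
    show "is_glb (par_poset k) (act k (\<Inter>a\<in>S. As ! a) lam) ((\<lambda>a. act k (As ! a) lam) ` S)"
      unfolding greatest_def Lower_def
      using act(2)[OF strip_S[OF S]] aS(1) iff iff[of "act k (\<Inter>a\<in>S. As ! a) lam"]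
      by (auto simp: par_poset_def)
  qed
  define U where "U = (\<Union>B\<in>{B. B \<subset> {..k}}. {x. x \<preceq> upw (cyc_word B) w})"
  have U: "finite U" "U \<subseteq> W"
  proof -
    have "upw (cyc_word B) w \<in> W" if "B \<subset> {..k}" for B using cyc_word(3)[OF that] w by simp
    moreover have "finite {B. B \<subset> {..k}}" by (rule finite_subset[of _ "Pow {..k}"]) auto
    ultimately show "finite U" "U \<subseteq> W" using finite_sle sle_closed' by (auto simp: U_def)
  qed
  have gt: "gtilde k g (act k (\<Inter>a\<in>S. As ! a) lam) = (\<Sum>x\<in>U. if x \<in> Wgr k then
      g x * (if x \<preceq> dA k (\<Inter>a\<in>S. As ! a) \<cdot> w then 1 else 0) else 0)"
    if S: "S \<subseteq> {..<N}" "S \<noteq> {}" for S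
  proof -
    note st = strip_S[OF S]
    define D where "D = dA k (\<Inter>a\<in>S. As ! a) \<cdot> w"
    have inU: "x \<in> U" if "x \<preceq> D" for x
    proof -
      have "x \<preceq> upw (cyc_word (\<Inter>a\<in>S. As ! a)) w" using that strip_upw[OF w(2) st] by (simp only: D_def)
      moreover have "(\<Inter>a\<in>S. As ! a) \<in> {B. B \<subset> {..k}}" using st by (simp only: strip_def mem_Collect_eq)
      ultimately have "\<exists>B\<in>{B. B \<subset> {..k}}. x \<preceq> upw (cyc_word B) w" by (rule bexI)
      then show ?thesis by (simp only: U_def UN_iff mem_Collect_eq)
    qed
    have "gtilde k g (act k (\<Inter>a\<in>S. As ! a) lam) = (\<Sum>x | x \<in> Wgr k \<and> x \<preceq> D. g x)"
      unfolding gtilde_eq[OF act(2)[OF st]] act(3)[OF st] D_def ..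
    also have "\<dots> = (\<Sum>x\<in>U. if x \<in> Wgr k then g x * (if x \<preceq> D then 1 else 0) else 0)"
      by (rule sum.mono_neutral_cong_left[OF U(1)]) (use inU in auto)
    finally show ?thesis unfolding D_def .
  qed
  have "(\<Sum>m = 1..N. (- 1) ^ (m - 1) * (\<Sum>S | S \<subseteq> {..<N} \<and> card S = m.
          gtilde k g (act k (\<Inter>a\<in>S. As ! a) lam)))
      = (\<Sum>m = 1..N. \<Sum>S | S \<in> {S. S \<subseteq> {..<N} \<and> S \<noteq> {}} \<and> card S = m.
          (- 1) ^ (card S - 1) * gtilde k g (act k (\<Inter>a\<in>S. As ! a) lam))"
    unfolding sum_distrib_left by (intro sum.cong) auto
  also have "\<dots> = (\<Sum>S | S \<subseteq> {..<N} \<and> S \<noteq> {}. (- 1) ^ (card S - 1) * gtilde k g (act k (\<Inter>a\<in>S. As ! a) lam))"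
  proof (rule sum.group)
    show "card ` {S. S \<subseteq> {..<N} \<and> S \<noteq> {}} \<subseteq> {1..N}"
    proof clarify
      fix S assume S: "S \<subseteq> {..<N}" "S \<noteq> {}"
      then have "finite S" using finite_subset by blast
      then show "card S \<in> {1..N}" using S card_mono[of "{..<N}" S] by (simp add: Suc_le_eq card_gt_0_iff)
    qed
  qed simp_all
  also have "\<dots> = (\<Sum>S | S \<subseteq> {..<N} \<and> S \<noteq> {}. \<Sum>x\<in>U. if x \<in> Wgr k then g x * ((- 1) ^ (card S - 1)
      * (if x \<preceq> dA k (\<Inter>a\<in>S. As ! a) \<cdot> w then 1 else 0)) else 0)"
  proof (rule sum.cong)
    fix S assume "S \<in> {S. S \<subseteq> {..<N} \<and> S \<noteq> {}}"
    then have S: "S \<subseteq> {..<N}" "S \<noteq> {}" by simp_all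
    show "(- 1) ^ (card S - 1) * gtilde k g (act k (\<Inter>a\<in>S. As ! a) lam)
        = (\<Sum>x\<in>U. if x \<in> Wgr k then g x * ((- 1) ^ (card S - 1)
          * (if x \<preceq> dA k (\<Inter>a\<in>S. As ! a) \<cdot> w then 1 else 0)) else 0)"
      unfolding gt[OF S] sum_distrib_left by (rule sum.cong) simp_all
  qed simp
  also have "\<dots> = (\<Sum>x\<in>U. \<Sum>S | S \<subseteq> {..<N} \<and> S \<noteq> {}. if x \<in> Wgr k then g x * ((- 1) ^ (card S - 1)
      * (if x \<preceq> dA k (\<Inter>a\<in>S. As ! a) \<cdot> w then 1 else 0)) else 0)"
    by (rule sum.swap)
  also have "\<dots> = (\<Sum>x\<in>U. if x \<in> Wgr k then
      g x * (if \<exists>A. strip w A \<and> card A = r \<and> x \<preceq> dA k A \<cdot> w then 1 else 0) else 0)"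
  proof (rule sum.cong)
    fix x assume "x \<in> U"
    then have x: "x \<in> W" using U(2) by blast
    \<comment> \<open>Inclusion-exclusion collapses the coefficient of \<open>g x\<close> to the
      indicator that x lies below some strip of size r, which is the coefficient in
      \<open>gtilde_htilde\<close>.\<close>
    have "(\<Sum>S | S \<subseteq> {..<N} \<and> S \<noteq> {}. (- 1) ^ (card S - 1)
        * (if x \<preceq> dA k (\<Inter>a\<in>S. As ! a) \<cdot> w then 1 else 0))
      = (if \<exists>a\<in>{..<N}. x \<preceq> dA k (As ! a) \<cdot> w then 1 else 0 :: pseries)"
      using le_S x by (intro inclusion_exclusion_indicator) auto
    moreover have "(\<exists>a\<in>{..<N}. x \<preceq> dA k (As ! a) \<cdot> w) \<longleftrightarrow>
        (\<exists>A. strip w A \<and> card A = r \<and> x \<preceq> dA k A \<cdot> w)"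
      using As unfolding N_def by (metis in_set_conv_nth lessThan_iff)
    ultimately show "(\<Sum>S | S \<subseteq> {..<N} \<and> S \<noteq> {}. if x \<in> Wgr k then g x * ((- 1) ^ (card S - 1)
      * (if x \<preceq> dA k (\<Inter>a\<in>S. As ! a) \<cdot> w then 1 else 0)) else 0)
      = (if x \<in> Wgr k then
      g x * (if \<exists>A. strip w A \<and> card A = r \<and> x \<preceq> dA k A \<cdot> w then 1 else 0) else 0)"
      by (cases "x \<in> Wgr k") (simp_all only: if_True if_False sum_distrib_left[symmetric] sum.neutral_const)
  qed simp
  also have "\<dots> = gtilde k g lam * htilde r"
    unfolding w_def
    by (rule gtilde_htilde[symmetric, OF assms(2,3,5) U]) (auto simp: U_def w_def)
  finally show ?thesis using glb by (simp add: N_def)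
qed

end
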